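(* Let $X$ be a curve of genus $g$ over a finite field $\mathbb{F}$ with canonical divisor $K$. Let $D=P_1+\cdots+P_n$ be a sum of $n$ distinct rational points and $G$ a divisor with support disjoint from $D$. Suppose $G=K+C=A+B+Z$ where $A,B$ are divisors and $Z\geq 0$ is an effective divisor whose support is disjoint from $D$. Then every nonzero word of the code $C_\Omega(D,G)$ has Hamming weight at least \[ l(A)-l(A-C)+l(B)-l(B-C). \]
   Context: $L(E)=\{f\in\mathbb{F}(X)^\times:(f)+E\geq0\}\cup\{0\}$, $l(E)=\dim_{\mathbb{F}}L(E)$, and $\Omega(E)$ is the space of rational differentials $\omega$ with $(\omega)\geq E$ together with $0$. The code $C_\Omega(D,G)$ is the image of $\Omega(G-D)\to\mathbb{F}^n$, $\omega\mapsto(\mathrm{res}_{P_1}(\omega),\ldots,\mathrm{res}_{P_n}(\omega))$. Equalities of divisors such as $G=K+C=A+B+Z$ may be read up to linear equivalence. *)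

theory Defs
  imports
    "HOL-Library.Poly_Mapping"
    "HOL-Library.Function_Algebras"
    "HOL-Computational_Algebra.Computational_Algebra"
begin

text \<open>
  A smooth projective geometrically irreducible curve over the finite field \<open>'k\<close> is given by
  its function field \<open>'f\<close>, an extension of \<open>'k\<close> along the embedding \<open>emb\<close>.  Its closed points
  are the normalised discrete valuations of \<open>'f\<close> that are trivial on \<open>'k\<close>.
\<close>

definition rational_subfield :: "('k::field \<Rightarrow> 'f::field) \<Rightarrow> 'f \<Rightarrow> 'f set" where
  "rational_subfield emb x =
     {poly (map_poly emb p) x / poly (map_poly emb q) x | p q. poly (map_poly emb q) x \<noteq> 0}"

text \<open>
  The last but one assumption says that \<open>'k\<close> is algebraically closed in \<open>'f\<close>; as \<open>'k\<close> is perfect,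
  this is geometric irreducibility of the curve.  The last one says that \<open>'f\<close> is a finite
  extension of \<open>'k(x)\<close> for some \<open>x\<close> that is transcendental over \<open>'k\<close>.
\<close>

locale function_field =
  fixes emb :: "'k::{field,finite} \<Rightarrow> 'f::field"
  assumes emb_1: "emb 1 = 1"
    and emb_add: "emb (a + b) = emb a + emb b"
    and emb_mult: "emb (a * b) = emb a * emb b"
    and full_constants: "p \<noteq> 0 \<Longrightarrow> poly (map_poly emb p) y = 0 \<Longrightarrow> y \<in> range emb"
    and function_field_ext:
      "\<exists>x. (\<forall>p. p \<noteq> 0 \<longrightarrow> poly (map_poly emb p) x \<noteq> 0) \<and>
         (\<exists>S. finite S \<and>
            (\<forall>y. \<exists>c. (\<forall>s\<in>S. c s \<in> rational_subfield emb x) \<and> y = (\<Sum>s\<in>S. c s * s)))"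

text \<open>The clause \<open>v 0 = 0\<close> only pins down the otherwise irrelevant value at \<open>0\<close>, so that distinct
  functions are distinct points.\<close>

type_synonym 'f place = "'f \<Rightarrow> int"

definition places :: "('k::field \<Rightarrow> 'f::field) \<Rightarrow> 'f place set" where
  "places emb = {v. v 0 = 0 \<and> (\<forall>c. v (emb c) = 0) \<and>
     (\<forall>a b. a \<noteq> 0 \<longrightarrow> b \<noteq> 0 \<longrightarrow> v (a * b) = v a + v b) \<and>
     (\<forall>a b. a \<noteq> 0 \<longrightarrow> b \<noteq> 0 \<longrightarrow> a + b \<noteq> 0 \<longrightarrow> min (v a) (v b) \<le> v (a + b)) \<and>
     (\<exists>t. v t = 1)}"

text \<open>A point is rational if its residue field is \<open>'k\<close>: every \<open>f\<close> in the valuation ring is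
  congruent to a constant modulo the maximal ideal.\<close>

definition rational_place :: "('k::field \<Rightarrow> 'f::field) \<Rightarrow> 'f place \<Rightarrow> bool" where
  "rational_place emb P \<longleftrightarrow> P \<in> places emb \<and>
     (\<forall>f. 0 \<le> P f \<longrightarrow> (\<exists>c. f = emb c \<or> 0 < P (f - emb c)))"

text \<open>Divisors form the free abelian group on the points.  The order relation that
  \<open>Poly_Mapping\<close> puts on its type is lexicographic and is not used here.\<close>

type_synonym 'f divisor = "'f place \<Rightarrow>\<^sub>0 int"

definition is_divisor :: "('k::field \<Rightarrow> 'f::field) \<Rightarrow> 'f divisor \<Rightarrow> bool" where
  "is_divisor emb E \<longleftrightarrow> Poly_Mapping.keys E \<subseteq> places emb"

definition effective :: "'f divisor \<Rightarrow> bool" where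
  "effective E \<longleftrightarrow> (\<forall>P. 0 \<le> Poly_Mapping.lookup E P)"

definition linearly_equivalent ::
  "('k::field \<Rightarrow> 'f::field) \<Rightarrow> 'f divisor \<Rightarrow> 'f divisor \<Rightarrow> bool" where
  "linearly_equivalent emb E E' \<longleftrightarrow>
     (\<exists>f. f \<noteq> 0 \<and> (\<forall>P\<in>places emb. Poly_Mapping.lookup E P = Poly_Mapping.lookup E' P + P f))"

definition riemann_roch_space :: "('k::field \<Rightarrow> 'f::field) \<Rightarrow> 'f divisor \<Rightarrow> 'f set" where
  "riemann_roch_space emb E =
     {f. f \<noteq> 0 \<and> (\<forall>P\<in>places emb. 0 \<le> P f + Poly_Mapping.lookup E P)} \<union> {0}"

definition l_dim :: "('k::field \<Rightarrow> 'f::field) \<Rightarrow> 'f divisor \<Rightarrow> nat" where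
  "l_dim emb E = vector_space.dim (\<lambda>c f. emb c * f) (riemann_roch_space emb E)"

text \<open>
  A rational differential is a linear form on the \<open>'f\<close>-space of \<open>'k\<close>-derivations of \<open>'f\<close>, of the
  form \<open>a\<^sub>1 dg\<^sub>1 + \<dots> + a\<^sub>r dg\<^sub>r\<close>, where \<open>dg\<close> is evaluation of derivations at \<open>g\<close>.  This is the
  module of Kaehler differentials of \<open>'f\<close> over \<open>'k\<close>: derivations are the elements of its dual,
  and a vector space embeds in its bidual.
\<close>

definition derivations :: "('k::field \<Rightarrow> 'f::field) \<Rightarrow> ('f \<Rightarrow> 'f) set" where
  "derivations emb = {\<delta>. (\<forall>a b. \<delta> (a + b) = \<delta> a + \<delta> b) \<and>
     (\<forall>a b. \<delta> (a * b) = a * \<delta> b + b * \<delta> a) \<and> (\<forall>c. \<delta> (emb c) = 0)}"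

type_synonym 'f differential = "('f \<Rightarrow> 'f) \<Rightarrow> 'f"

definition dscale :: "'f::field \<Rightarrow> 'f differential \<Rightarrow> 'f differential" where
  "dscale a \<omega> = (\<lambda>\<delta>. a * \<omega> \<delta>)"

definition diff :: "('k::field \<Rightarrow> 'f::field) \<Rightarrow> 'f \<Rightarrow> 'f differential" where
  "diff emb g = (\<lambda>\<delta>. if \<delta> \<in> derivations emb then \<delta> g else 0)"

definition differentials :: "('k::field \<Rightarrow> 'f::field) \<Rightarrow> 'f differential set" where
  "differentials emb = module.span dscale (range (diff emb))"

definition uniformizer :: "'f place \<Rightarrow> 'f" where
  "uniformizer P = (SOME t. P t = 1)"

text \<open>The function \<open>h\<close> with \<open>\<omega> = h dt\<close> for the chosen uniformizer \<open>t\<close> at \<open>P\<close>; the order and the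
  residue derived from it do not depend on this choice.\<close>

definition local_coeff :: "('k::field \<Rightarrow> 'f::field) \<Rightarrow> 'f place \<Rightarrow> 'f differential \<Rightarrow> 'f" where
  "local_coeff emb P \<omega> = (THE h. \<omega> = dscale h (diff emb (uniformizer P)))"

definition ord_diff :: "('k::field \<Rightarrow> 'f::field) \<Rightarrow> 'f place \<Rightarrow> 'f differential \<Rightarrow> int" where
  "ord_diff emb P \<omega> = P (local_coeff emb P \<omega>)"

definition laurent_expansion ::
  "('k::field \<Rightarrow> 'f::field) \<Rightarrow> 'f place \<Rightarrow> 'f \<Rightarrow> 'f \<Rightarrow> 'k fls" where
  "laurent_expansion emb P t h =
     (THE \<phi>. \<forall>n. h = (\<Sum>i=fls_subdegree \<phi>..n. emb (fls_nth \<phi> i) * t powi i) \<or>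
             n < P (h - (\<Sum>i=fls_subdegree \<phi>..n. emb (fls_nth \<phi> i) * t powi i)))"

text \<open>Used at rational points only, where all coefficients lie in \<open>'k\<close>.\<close>

definition residue :: "('k::field \<Rightarrow> 'f::field) \<Rightarrow> 'f place \<Rightarrow> 'f differential \<Rightarrow> 'k" where
  "residue emb P \<omega> =
     fls_residue (laurent_expansion emb P (uniformizer P) (local_coeff emb P \<omega>))"

definition canonical_divisor :: "('k::field \<Rightarrow> 'f::field) \<Rightarrow> 'f divisor \<Rightarrow> bool" where
  "canonical_divisor emb K \<longleftrightarrow> is_divisor emb K \<and>
     (\<exists>\<omega>\<in>differentials emb. \<omega> \<noteq> 0 \<and>
        (\<forall>P\<in>places emb. Poly_Mapping.lookup K P = ord_diff emb P \<omega>))"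

definition differential_space ::
  "('k::field \<Rightarrow> 'f::field) \<Rightarrow> 'f divisor \<Rightarrow> 'f differential set" where
  "differential_space emb E =
     {\<omega>\<in>differentials emb. \<omega> \<noteq> 0 \<and>
        (\<forall>P\<in>places emb. Poly_Mapping.lookup E P \<le> ord_diff emb P \<omega>)} \<union> {0}"

text \<open>The dimension of the space of regular differentials.\<close>

definition genus :: "('k::field \<Rightarrow> 'f::field) \<Rightarrow> nat" where
  "genus emb = vector_space.dim (\<lambda>c. dscale (emb c)) (differential_space emb 0)"

definition code_Omega ::
  "('k::field \<Rightarrow> 'f::field) \<Rightarrow> 'f place list \<Rightarrow> 'f divisor \<Rightarrow> 'k list set" where
  "code_Omega emb ps G =
     (\<lambda>\<omega>. map (\<lambda>P. residue emb P \<omega>) ps) `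
       differential_space emb (G - (\<Sum>P\<leftarrow>ps. frag_of P))"

definition hamming_weight :: "'k::zero list \<Rightarrow> nat" where
  "hamming_weight w = length (filter (\<lambda>c. c \<noteq> 0) w)"

lemma vector_space_dscale: "vector_space dscale"
  by unfold_locales (auto simp: dscale_def fun_eq_iff algebra_simps)

context function_field
begin

lemma vector_space_constants: "vector_space (\<lambda>c f. emb c * f)"
  by unfold_locales (simp_all add: emb_1 emb_add emb_mult algebra_simps)

lemma vector_space_dscale_constants: "vector_space (\<lambda>c. dscale (emb c))"
  by unfold_locales
    (auto simp: dscale_def fun_eq_iff emb_1 emb_add emb_mult algebra_simps)

end

end

theory Submission
  imports Defs
begin

text \<open>
  Let \<open>T\<close> be the set of those points among \<open>P\<^sub>1, \<dots>, P\<^sub>n\<close> at which a differential \<open>\<omega>\<close> giving the word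
  \<open>w\<close> has a pole.  The pole is simple, so the residue does not vanish and \<open>|T|\<close> is at most the weight.
  As \<open>(\<omega>) = G - T + E\<close> with \<open>E\<close> effective, \<open>C\<close> is equivalent to \<open>T - E\<close>, and \<open>l(A - C)\<close>, \<open>l(B - C)\<close> are at
  least \<open>l(A - T)\<close>, \<open>l(B - T)\<close>.  It remains to see that
  \<open>l(A) - l(A - T) + l(B) - l(B - T) \<le> |T|\<close>; taking the points of \<open>T\<close> one at a time, this reduces to the
  fact that no differential has a simple pole at a rational point \<open>P\<close> as its only pole.

  That fact is a case of the residue theorem and is proved with Tate's trace of commutators.  Write the
  differential as \<open>h dt\<close> and let \<open>S\<close> be the pole set of a function, containing \<open>P\<close> and all poles of \<open>h\<close>
  and \<open>t\<close>.  Let \<open>\<pi>\<close> be a projection of the function field onto the semilocal ring of \<open>S\<close> and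
  \<open>\<theta> f = \<pi> f \<pi>\<close>.  Up to operators of finite rank \<open>\<theta>\<close> is multiplicative, so the trace of \<open>[\<theta> f, \<theta> g]\<close> depends
  only on \<open>f dg\<close>; computed with a common uniformizer at all points of \<open>S\<close>, it is the residue of \<open>h dt\<close>
  at \<open>P\<close>.  On the other hand \<open>\<pi>\<close> may be replaced by a projection whose kernel is the ring of functions
  regular outside \<open>S\<close>, and then \<open>\<theta> h\<close> and \<open>\<theta> t\<close> commute.

  Since the function field has degree \<open>p\<close> over its \<open>p\<close>-th powers, it is generated over them by any
  uniformizer \<open>t\<close>; this yields \<open>d/dt\<close> and its integrality without completions.
\<close>

subsection \<open>Linear algebra over subfields\<close>

text \<open>Exchanging the projections rests on two facts about the semilocal ring \<open>L\<close>
  of \<open>S\<close> and the ring \<open>R\<close> of functions regular outside \<open>S\<close>: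
  \<open>L \<inter> R\<close> consists of constants, and \<open>L + R\<close> has finite
  codimension. A projection onto \<open>L\<close> and one with kernel \<open>R\<close> then differ
  only by finite rank, which the trace of a commutator does not detect. The first fact needs a pole
  of every nonconstant function. Points being bare valuations, such a pole has to be constructed:
  Zorn's lemma gives a valuation ring, and finiteness over \<open>'k(y)\<close> makes it discrete.
  The second fact is why \<open>S\<close> is taken to be the full pole set of a function
  \<open>x\<close>: division with remainder in \<open>'k[x]\<close> then separates a part regular
  outside \<open>S\<close> from a part with bounded poles on \<open>S\<close>. A common uniformizer
  at all points of \<open>S\<close> maps \<open>L\<close> into itself, so that the decisive
  commutator is an operator of rank one, whose trace can be read off.\<close>

definition is_subfield :: "'f::field set \<Rightarrow> bool" where
  "is_subfield K \<longleftrightarrow> 1 \<in> K \<and> (\<forall>a\<in>K. \<forall>b\<in>K. a - b \<in> K) \<and> (\<forall>a\<in>K. \<forall>b\<in>K. a * b \<in> K) \<and>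
     (\<forall>a\<in>K. inverse a \<in> K)"

lemma is_subfieldD:
  assumes "is_subfield K"
  shows "1 \<in> K" "0 \<in> K" "a \<in> K \<Longrightarrow> b \<in> K \<Longrightarrow> a - b \<in> K" "a \<in> K \<Longrightarrow> b \<in> K \<Longrightarrow> a * b \<in> K"
    "a \<in> K \<Longrightarrow> inverse a \<in> K" "a \<in> K \<Longrightarrow> - a \<in> K" "a \<in> K \<Longrightarrow> b \<in> K \<Longrightarrow> a + b \<in> K"
    "a \<in> K \<Longrightarrow> b \<in> K \<Longrightarrow> a / b \<in> K"
proof -
  show 1: "1 \<in> K" and d: "a \<in> K \<Longrightarrow> b \<in> K \<Longrightarrow> a - b \<in> K"
    and m: "a \<in> K \<Longrightarrow> b \<in> K \<Longrightarrow> a * b \<in> K" and i: "a \<in> K \<Longrightarrow> inverse a \<in> K" for a b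
    using assms by (auto simp: is_subfield_def)
  show 0: "0 \<in> K" using d[OF 1 1] by simp
  show n: "a \<in> K \<Longrightarrow> - a \<in> K" for a using d[OF 0, of a] by simp
  show "a \<in> K \<Longrightarrow> b \<in> K \<Longrightarrow> a + b \<in> K" using d[of a "- b"] n[of b] by simp
  show "a \<in> K \<Longrightarrow> b \<in> K \<Longrightarrow> a / b \<in> K" using m[of a "inverse b"] i[of b] by (simp add: divide_inverse)
qed

lemma is_subfield_sum:
  assumes "is_subfield K" "\<And>i. i \<in> I \<Longrightarrow> f i \<in> K"
  shows "(\<Sum>i\<in>I. f i) \<in> K"
  using assms(2) by (induction I rule: infinite_finite_induct) (auto simp: is_subfieldD[OF assms(1)])

definition power_span :: "'f::field set \<Rightarrow> 'f \<Rightarrow> nat \<Rightarrow> 'f set" where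
  "power_span K x m = {f. \<exists>c. (\<forall>j<m. c j \<in> K) \<and> f = (\<Sum>j<m. c j * x ^ j)}"

lemma power_span_scale:
  assumes K: "is_subfield K" and "a \<in> K" "f \<in> power_span K x m"
  shows "a * f \<in> power_span K x m"
proof -
  obtain c where "\<forall>j<m. c j \<in> K" "f = (\<Sum>j<m. c j * x ^ j)" using assms(3) by (auto simp: power_span_def)
  then show ?thesis unfolding power_span_def using assms(2) is_subfieldD(4)[OF K]
    by (auto intro!: exI[of _ "\<lambda>j. a * c j"] simp: sum_distrib_left mult.assoc)
qed

lemma power_span_add:
  assumes K: "is_subfield K" and "f \<in> power_span K x m" "g \<in> power_span K x m"
  shows "f + g \<in> power_span K x m"
proof -
  obtain c where c: "\<forall>j<m. c j \<in> K" "f = (\<Sum>j<m. c j * x ^ j)" using assms(2) by (auto simp: power_span_def)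
  obtain d where d: "\<forall>j<m. d j \<in> K" "g = (\<Sum>j<m. d j * x ^ j)" using assms(3) by (auto simp: power_span_def)
  show ?thesis unfolding power_span_def using c d is_subfieldD(7)[OF K]
    by (auto intro!: exI[of _ "\<lambda>j. c j + d j"] simp: sum.distrib distrib_right)
qed

lemma power_span_sum:
  assumes K: "is_subfield K" and "\<And>i. i \<in> I \<Longrightarrow> f i \<in> power_span K x m"
  shows "(\<Sum>i\<in>I. f i) \<in> power_span K x m"
proof -
  have "0 \<in> power_span K x m"
    unfolding power_span_def using is_subfieldD(2)[OF K] by (auto intro!: exI[of _ "\<lambda>_. 0"])
  then show ?thesis using assms(2)
    by (induction I rule: infinite_finite_induct) (auto intro: power_span_add[OF K])
qed

lemma power_span_base:
  assumes K: "is_subfield K" and "i < m" shows "x ^ i \<in> power_span K x m"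
proof -
  have "x ^ i = (\<Sum>j<m. (if j = i then 1 else 0) * x ^ j)"
    using assms(2) by (simp add: if_distrib[of "\<lambda>u. u * _"] cong: if_cong)
  then show ?thesis unfolding power_span_def using is_subfieldD(1,2)[OF K]
    by (auto intro!: exI[of _ "\<lambda>j. if j = i then 1 else 0"])
qed

section \<open>Spanning and independent sets over a subfield\<close>

definition spans_over :: "'f::field set \<Rightarrow> 'f set \<Rightarrow> bool" where
  "spans_over K S \<longleftrightarrow> finite S \<and> (\<forall>f. \<exists>c. (\<forall>s\<in>S. c s \<in> K) \<and> f = (\<Sum>s\<in>S. c s * s))"

definition indep_over :: "'f::field set \<Rightarrow> 'f set \<Rightarrow> bool" where
  "indep_over K U \<longleftrightarrow> finite U \<and>
     (\<forall>c. (\<forall>u\<in>U. c u \<in> K) \<longrightarrow> (\<Sum>u\<in>U. c u * u) = 0 \<longrightarrow> (\<forall>u\<in>U. c u = 0))"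

lemma indep_overD:
  assumes "indep_over K U" "\<And>u. u \<in> U \<Longrightarrow> c u \<in> K" "(\<Sum>u\<in>U. c u * u) = 0" "u \<in> U"
  shows "c u = 0"
  using assms unfolding indep_over_def by blast

text \<open>Gaussian elimination, by induction on the equations: an unknown \<open>j\<close> that
  occurs in equation \<open>s\<close> is solved for and substituted into the others, at the price of
  one unknown. If no unknown occurs in \<open>s\<close>, that equation is void.\<close>

lemma homogeneous_system_nontrivial:
  fixes c :: "'i \<Rightarrow> 's \<Rightarrow> 'f::field"
  assumes K: "is_subfield K" and "finite S" "finite I" "card S < card I"
    and "\<And>i s. i \<in> I \<Longrightarrow> s \<in> S \<Longrightarrow> c i s \<in> K"
  shows "\<exists>d. (\<forall>i\<in>I. d i \<in> K) \<and> (\<exists>i\<in>I. d i \<noteq> 0) \<and> (\<forall>s\<in>S. (\<Sum>i\<in>I. d i * c i s) = 0)"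
  using assms(2-5)
proof (induction S arbitrary: I c rule: finite_induct)
  case empty
  then obtain i where "i \<in> I" by fastforce
  then show ?case using K by (intro exI[of _ "\<lambda>_. 1"]) (auto simp: is_subfieldD)
next
  case (insert s S)
  show ?case
  proof (cases "\<forall>i\<in>I. c i s = 0")
    case True
    have "card S < card I" using insert by simp
    with insert.IH[of I c] insert.prems obtain d where
      "\<forall>i\<in>I. d i \<in> K" "\<exists>i\<in>I. d i \<noteq> 0" "\<forall>s\<in>S. (\<Sum>i\<in>I. d i * c i s) = 0" by auto
    with True show ?thesis by (intro exI[of _ d]) auto
  next
    case False
    then obtain j where j: "j \<in> I" "c j s \<noteq> 0" by blast
    \<comment> \<open>The coefficients after \<open>j\<close> has been eliminated with the help of
      equation \<open>s\<close>.\<close>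
    define c' where "c' i r = c i r - c i s / c j s * c j r" for i r
    have "c' i r \<in> K" if "i \<in> I - {j}" "r \<in> S" for i r
      using that j insert.prems K by (auto simp: c'_def intro!: is_subfieldD)
    moreover have "card S < card (I - {j})" using insert j by simp
    ultimately obtain d where d: "\<forall>i\<in>I - {j}. d i \<in> K" "\<exists>i\<in>I - {j}. d i \<noteq> 0"
      "\<forall>r\<in>S. (\<Sum>i\<in>I - {j}. d i * c' i r) = 0"
      using insert.IH[of "I - {j}" c'] insert.prems by auto
    define e where "e = (\<lambda>i. if i = j then - (\<Sum>i\<in>I - {j}. d i * c i s / c j s) else d i)"
    have "e i \<in> K" if "i \<in> I" for i
      using that d(1) j insert.prems K
      by (auto simp: e_def intro!: is_subfieldD(6)[OF K] is_subfield_sum[OF K] is_subfieldD(8)[OF K] is_subfieldD(4)[OF K])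
    moreover have "\<exists>i\<in>I. e i \<noteq> 0" using d(2) by (auto simp: e_def)
    moreover have sum_e: "(\<Sum>i\<in>I. e i * c i r) = e j * c j r + (\<Sum>i\<in>I - {j}. d i * c i r)" for r
    proof -
      have "(\<Sum>i\<in>I. e i * c i r) = e j * c j r + (\<Sum>i\<in>I - {j}. e i * c i r)"
        using j insert.prems by (simp add: sum.remove)
      also have "(\<Sum>i\<in>I - {j}. e i * c i r) = (\<Sum>i\<in>I - {j}. d i * c i r)"
        by (intro sum.cong) (auto simp: e_def)
      finally show ?thesis .
    qed
    moreover have "(\<Sum>i\<in>I. e i * c i s) = 0"
      unfolding sum_e using j by (simp add: e_def sum_distrib_right)
    moreover have "(\<Sum>i\<in>I. e i * c i r) = 0" if "r \<in> S" for r
    proof -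
      have "0 = (\<Sum>i\<in>I - {j}. d i * c' i r)" using d(3) that by simp
      also have "\<dots> = (\<Sum>i\<in>I - {j}. d i * c i r - d i * c i s / c j s * c j r)"
        by (intro sum.cong) (auto simp: c'_def algebra_simps)
      also have "\<dots> = (\<Sum>i\<in>I. e i * c i r)"
        unfolding sum_e by (simp add: e_def sum_subtractf sum_distrib_right)
      finally show ?thesis by simp
    qed
    ultimately show ?thesis by (intro exI[of _ e]) auto
  qed
qed

text \<open>The vectors form a family \<open>z\<close> rather than a set, so powers
  \<open>y ^ i\<close> can be inserted without knowing that they are distinct.\<close>

lemma spans_over_dependence:
  assumes K: "is_subfield K" and S: "spans_over K S" and I: "finite I" "card S < card I"
  shows "\<exists>d. (\<forall>i\<in>I. d i \<in> K) \<and> (\<exists>i\<in>I. d i \<noteq> 0) \<and> (\<Sum>i\<in>I. d i * z i) = (0::'f::field)"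
proof -
  have "\<forall>i. \<exists>c. (\<forall>s\<in>S. c s \<in> K) \<and> z i = (\<Sum>s\<in>S. c s * s)"
    using S by (auto simp: spans_over_def)
  then obtain c where c: "\<And>i s. s \<in> S \<Longrightarrow> c i s \<in> K" "\<And>i. z i = (\<Sum>s\<in>S. c i s * s)"
    by metis
  obtain d where d: "\<forall>i\<in>I. d i \<in> K" "\<exists>i\<in>I. d i \<noteq> 0" "\<forall>s\<in>S. (\<Sum>i\<in>I. d i * c i s) = 0"
    using homogeneous_system_nontrivial[OF K _ I, of c] c(1) S by (auto simp: spans_over_def)
  have "(\<Sum>i\<in>I. d i * z i) = (\<Sum>i\<in>I. \<Sum>s\<in>S. d i * c i s * s)"
    by (simp add: c(2) sum_distrib_left mult.assoc)
  also have "\<dots> = (\<Sum>s\<in>S. \<Sum>i\<in>I. d i * c i s * s)" by (rule sum.swap)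
  also have "\<dots> = (\<Sum>s\<in>S. (\<Sum>i\<in>I. d i * c i s) * s)" by (simp add: sum_distrib_right)
  also have "\<dots> = 0" using d(3) by simp
  finally show ?thesis using d by blast
qed

lemma spans_overI_maximal:
  assumes K: "is_subfield K" and U: "indep_over K U"
    and dep: "\<And>f. f \<notin> U \<Longrightarrow> \<not> indep_over K (insert f U)"
  shows "spans_over K U"
  unfolding spans_over_def
proof (intro conjI allI)
  show fU: "finite U" using U by (simp add: indep_over_def)
  fix f
  show "\<exists>c. (\<forall>s\<in>U. c s \<in> K) \<and> f = (\<Sum>s\<in>U. c s * s)"
  proof (cases "f \<in> U")
    case True
    then have "f = (\<Sum>s\<in>U. (if s = f then 1 else 0) * s)"
      using fU by (simp add: if_distrib[of "\<lambda>u. u * _"] cong: if_cong)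
    then show ?thesis using K by (intro exI[of _ "\<lambda>s. if s = f then 1 else 0"]) (auto simp: is_subfieldD)
  next
    case False
    from dep[OF this] fU obtain c where c: "\<forall>u\<in>insert f U. c u \<in> K"
      "(\<Sum>u\<in>insert f U. c u * u) = 0" "\<not> (\<forall>u\<in>insert f U. c u = 0)"
      unfolding indep_over_def by auto
    have s: "c f * f + (\<Sum>u\<in>U. c u * u) = 0" using c(2) False fU by simp
    have "c f \<noteq> 0"
      using s c U by (auto simp: indep_over_def)
    then have "f = (\<Sum>u\<in>U. (- c u / c f) * u)"
      using s by (simp add: sum_negf sum_divide_distrib[symmetric] field_simps eq_neg_iff_add_eq_0)
    then show ?thesis using c(1) K
      by (intro exI[of _ "\<lambda>u. - c u / c f"]) (auto intro!: is_subfieldD(8) is_subfieldD(6))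
  qed
qed

lemma basis_over_exists:
  assumes K: "is_subfield K" and n: "\<And>U. indep_over K U \<Longrightarrow> card U \<le> n"
  shows "\<exists>U. indep_over K U \<and> spans_over K U"
proof -
  have ex: "\<exists>U. indep_over K U \<and> card U = 0"
    by (intro exI[of _ "{}"]) (simp add: indep_over_def)
  define m where "m = (GREATEST m. \<exists>U. indep_over K U \<and> card U = m)"
  have "\<exists>U. indep_over K U \<and> card U = m"
    unfolding m_def by (rule GreatestI_nat[where P="\<lambda>m. \<exists>U. indep_over K U \<and> card U = m", OF ex]) (use n in auto)
  then obtain U where U: "indep_over K U" "card U = m" by blast
  have "\<not> indep_over K (insert f U)" if "f \<notin> U" for f
  proof
    assume a: "indep_over K (insert f U)"
    have "card (insert f U) \<le> m"
      unfolding m_def by (rule Greatest_le_nat[where b=n]) (use a n in auto)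
    then show False using that U by (simp add: indep_over_def)
  qed
  with spans_overI_maximal[OF K U(1)] U(1) show ?thesis by blast
qed

subsection \<open>Constants and rational subfields\<close>

context function_field
begin

lemma emb_0 [simp]: "emb 0 = 0"
  using emb_add[of 0 0] by (metis add_0 add_cancel_right_right)

lemma emb_uminus: "emb (- a) = - emb a"
  using emb_add[of a "- a"] by (simp add: eq_neg_iff_add_eq_0 add.commute)

lemma emb_diff: "emb (a - b) = emb a - emb b"
  using emb_add[of a "- b"] by (simp add: emb_uminus)

lemma emb_eq_0_iff [simp]: "emb a = 0 \<longleftrightarrow> a = 0"
proof
  assume "emb a = 0"
  then have "a \<noteq> 0 \<Longrightarrow> emb (a * inverse a) = 0" by (simp only: emb_mult) simp
  then show "a = 0" by (auto simp: emb_1)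
qed simp

lemma emb_eq_iff [simp]: "emb a = emb b \<longleftrightarrow> a = b"
  using emb_eq_0_iff[of "a - b"] by (simp add: emb_diff)

lemma emb_inverse: "emb (inverse a) = inverse (emb a)"
proof (cases "a = 0")
  case False
  then have "emb a * emb (inverse a) = 1" by (simp add: emb_1 flip: emb_mult)
  then show ?thesis by (metis inverse_unique)
qed simp

lemma emb_power: "emb (a ^ n) = emb a ^ n"
  by (induction n) (auto simp: emb_1 emb_mult)

abbreviation ev :: "'f \<Rightarrow> 'k poly \<Rightarrow> 'f" where
  "ev y p \<equiv> poly (map_poly emb p) y"

lemma ev_pCons: "ev y (pCons a p) = emb a + y * ev y p"
  by (simp add: map_poly_pCons)

lemma ev_add: "ev y (p + q) = ev y p + ev y q"
proof -
  have "map_poly emb (p + q) = map_poly emb p + map_poly emb q"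
    by (intro poly_eqI) (simp add: coeff_map_poly emb_add)
  then show ?thesis by simp
qed

lemma ev_smult: "ev y (smult c p) = emb c * ev y p"
  by (simp add: map_poly_smult emb_mult)

lemma ev_mult: "ev y (p * q) = ev y p * ev y q"
  by (induction p) (auto simp: ev_pCons ev_add ev_smult algebra_simps)

lemma ev_uminus: "ev y (- p) = - ev y p"
  using ev_smult[where c="- 1" and y=y and p=p] by (simp add: emb_uminus emb_1)

lemma ev_diff: "ev y (p - q) = ev y p - ev y q"
  using ev_add[where y=y and p=p and q="- q"] by (simp add: ev_uminus)

lemma ev_1 [simp]: "ev y 1 = 1"
  by (simp add: map_poly_1' emb_1)

lemma ev_sum: "ev y (\<Sum>i\<in>I. f i) = (\<Sum>i\<in>I. ev y (f i))"
  by (induction I rule: infinite_finite_induct) (auto simp: ev_add)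

lemma ev_monom: "ev y (monom c n) = emb c * y ^ n"
  by (simp add: map_poly_monom poly_monom)

lemma ev_altdef: "degree p \<le> n \<Longrightarrow> ev y p = (\<Sum>i\<le>n. emb (coeff p i) * y ^ i)"
  by (subst poly_as_sum_of_monoms'[symmetric, of p n]) (auto simp: ev_sum ev_monom)

text \<open>As the constants are algebraically closed in \<open>'f\<close>, nonconstant and
  transcendental mean the same. This is why \<open>y \<notin> range emb\<close> is the recurring
  hypothesis.\<close>

lemma ev_eq_0_iff: "y \<notin> range emb \<Longrightarrow> ev y p = 0 \<longleftrightarrow> p = 0"
  using full_constants[of p y] by auto

lemma mem_rational_subfield_iff:
  assumes "y \<notin> range emb"
  shows "c \<in> rational_subfield emb y \<longleftrightarrow> (\<exists>p q. q \<noteq> 0 \<and> c = ev y p / ev y q)"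
  using ev_eq_0_iff[OF assms] by (auto simp: rational_subfield_def)

lemma ev_in_rational_subfield:
  assumes "y \<notin> range emb" shows "ev y p \<in> rational_subfield emb y"
  unfolding mem_rational_subfield_iff[OF assms] by (intro exI[of _ p] exI[of _ 1]) simp

lemma is_subfield_rational_subfield:
  assumes y: "y \<notin> range emb"
  shows "is_subfield (rational_subfield emb y)"
proof -
  let ?K = "rational_subfield emb y"
  note mem = mem_rational_subfield_iff[OF y] and z = ev_eq_0_iff[OF y]
  have "1 \<in> ?K" using ev_in_rational_subfield[OF y, of 1] by simp
  moreover have "a - b \<in> ?K" "a * b \<in> ?K" "inverse a \<in> ?K" if ab: "a \<in> ?K" "b \<in> ?K" for a b
  proof -
    obtain p q r s where pq: "q \<noteq> 0" "a = ev y p / ev y q" and rs: "s \<noteq> 0" "b = ev y r / ev y s"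
      using ab unfolding mem by blast
    have "a - b = ev y (p * s - r * q) / ev y (q * s)"
      using pq(1) rs(1) z by (simp add: pq(2) rs(2) ev_diff ev_mult diff_frac_eq)
    then show "a - b \<in> ?K" unfolding mem using pq rs by (intro exI[of _ "p * s - r * q"] exI[of _ "q * s"]) auto
    have "a * b = ev y (p * r) / ev y (q * s)" using pq rs by (simp add: ev_mult)
    then show "a * b \<in> ?K" unfolding mem using pq rs by (intro exI[of _ "p * r"] exI[of _ "q * s"]) auto
    show "inverse a \<in> ?K"
    proof (cases "p = 0")
      case True
      then have "inverse a = ev y 0 / ev y 1" using pq by simp
      then show ?thesis unfolding mem by (intro exI[of _ 0] exI[of _ 1]) simp
    next
      case False
      then show ?thesis unfolding mem using pq by (intro exI[of _ q] exI[of _ p]) simp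
    qed
  qed
  ultimately show ?thesis by (simp add: is_subfield_def)
qed

lemma ev_in_power_span:
  assumes y: "y \<notin> range emb" and pow: "\<And>i. x ^ i \<in> power_span (rational_subfield emb y) x m"
  shows "ev x p \<in> power_span (rational_subfield emb y) x m"
proof -
  note K = is_subfield_rational_subfield[OF y]
  have "emb a * x ^ i \<in> power_span (rational_subfield emb y) x m" for a i
    using power_span_scale[OF K ev_in_rational_subfield[OF y, of "[:a:]"] pow[of i]] by (simp add: ev_pCons)
  then show ?thesis unfolding ev_altdef[OF order_refl] by (intro power_span_sum[OF K])
qed

lemma clear_denominators:
  assumes y: "y \<notin> range emb" and "finite I" "\<And>i. i \<in> I \<Longrightarrow> d i \<in> rational_subfield emb y"
  shows "\<exists>q c. q \<noteq> 0 \<and> (\<forall>i\<in>I. ev y q * d i = ev y (c i))"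
  using assms(2,3)
proof (induction I rule: finite_induct)
  case empty
  show ?case by (intro exI[of _ 1]) simp
next
  case (insert j I)
  obtain q c where qc: "q \<noteq> 0" "\<forall>i\<in>I. ev y q * d i = ev y (c i)" using insert by auto
  obtain r s where rs: "s \<noteq> 0" "d j = ev y r / ev y s"
    using insert.prems[of j] mem_rational_subfield_iff[OF y] by auto
  have "ev y (q * s) * d j = ev y (q * r)" using rs by (simp add: ev_mult ev_eq_0_iff[OF y])
  moreover have "ev y (q * s) * d i = ev y (s * c i)" if "i \<in> I" for i
    using qc(2) that by (simp add: ev_mult mult_ac)
  ultimately show ?case using qc rs insert.hyps
    by (intro exI[of _ "q * s"] exI[of _ "\<lambda>i. if i = j then q * r else s * c i"]) auto
qed

text \<open>The relation between \<open>x\<close> and \<open>y\<close> over \<open>'k\<close> is read as an equation for \<open>x\<close> over \<open>'k(y)\<close>.\<close>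

lemma finite_over_rational_subfield:
  assumes y: "y \<notin> range emb"
  shows "\<exists>U. indep_over (rational_subfield emb y) U \<and> spans_over (rational_subfield emb y) U"
proof -
  obtain x S where x: "\<And>p. p \<noteq> 0 \<Longrightarrow> ev x p \<noteq> 0" and S: "spans_over (rational_subfield emb x) S"
    using function_field_ext unfolding spans_over_def by blast
  have xk: "x \<notin> range emb"
  proof
    assume "x \<in> range emb"
    then obtain c where "x = emb c" by blast
    then have "ev x [:- c, 1:] = 0" by (simp add: ev_pCons emb_1 emb_uminus)
    then show False using x[of "[:- c, 1:]"] by simp
  qed
  let ?L = "rational_subfield emb x" and ?K = "rational_subfield emb y"
  note L = is_subfield_rational_subfield[OF xk] and K = is_subfield_rational_subfield[OF y]
  \<comment> \<open>\<open>card S + 1\<close> powers of \<open>y\<close> in a space spanned over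
    \<open>'k(x)\<close> by \<open>card S\<close> elements are dependent.\<close>
  obtain d where d: "\<forall>i\<in>{..card S}. d i \<in> ?L" "\<exists>i\<in>{..card S}. d i \<noteq> 0"
    "(\<Sum>i\<le>card S. d i * y ^ i) = 0"
    using spans_over_dependence[OF L S, of "{..card S}" "\<lambda>i. y ^ i"] by auto
  obtain q c where qc: "q \<noteq> 0" "\<And>i. i \<le> card S \<Longrightarrow> ev x q * d i = ev x (c i)"
    using clear_denominators[OF xk, of "{..card S}" d] d(1) by auto
  have rel: "(\<Sum>i\<le>card S. ev x (c i) * y ^ i) = 0"
  proof -
    have "(\<Sum>i\<le>card S. ev x (c i) * y ^ i) = ev x q * (\<Sum>i\<le>card S. d i * y ^ i)"
      by (simp add: sum_distrib_left qc(2)[symmetric] mult.assoc)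
    then show ?thesis using d by simp
  qed
  obtain i0 where i0: "i0 \<le> card S" "c i0 \<noteq> 0" 
    using d(2) qc x by (metis atMost_iff ev_eq_0_iff mult_eq_0_iff xk)
  define N where "N = Max ((\<lambda>i. degree (c i)) ` {..card S})"
  have N: "degree (c i) \<le> N" if "i \<le> card S" for i
    unfolding N_def using that by (intro Max_ge) auto
  \<comment> \<open>The transposed relation: \<open>e j\<close> collects the coefficients of
    \<open>x ^ j\<close>, as a polynomial in \<open>y\<close>.\<close>
  define e where "e j = (\<Sum>i\<le>card S. monom (coeff (c i) j) i)" for j
  have coeff_e: "coeff (e j) i = coeff (c i) j" if "i \<le> card S" for i j
    using that by (simp add: e_def coeff_sum)
  have "(\<Sum>j\<le>N. ev y (e j) * x ^ j) = (\<Sum>j\<le>N. \<Sum>i\<le>card S. emb (coeff (c i) j) * y ^ i * x ^ j)"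
    by (simp add: e_def ev_sum ev_monom sum_distrib_right)
  also have "\<dots> = (\<Sum>i\<le>card S. \<Sum>j\<le>N. emb (coeff (c i) j) * y ^ i * x ^ j)" by (rule sum.swap)
  also have "\<dots> = (\<Sum>i\<le>card S. ev x (c i) * y ^ i)"
    by (intro sum.cong) (auto simp: ev_altdef[OF N] sum_distrib_right sum_distrib_left mult_ac)
  finally have rel': "(\<Sum>j\<le>N. ev y (e j) * x ^ j) = 0" using rel by simp
  have "e (degree (c i0)) \<noteq> 0" 
    using coeff_e[OF i0(1), of "degree (c i0)"] i0 by (metis coeff_0 leading_coeff_0_iff)
  then have ex: "\<exists>j\<le>N. e j \<noteq> 0" using N[OF i0(1)] by blast
  \<comment> \<open>The degree of the relation in \<open>x\<close>. Dividing by
    \<open>ev y (e m)\<close> writes \<open>x ^ m\<close> through lower powers over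
    \<open>'k(y)\<close>.\<close>
  define m where "m = (GREATEST j. j \<le> N \<and> e j \<noteq> 0)"
  have m: "m \<le> N" "e m \<noteq> 0"
    using GreatestI_ex_nat[of "\<lambda>j. j \<le> N \<and> e j \<noteq> 0" N] ex unfolding m_def by auto
  have m_max: "e j = 0" if "j \<le> N" "j > m" for j
    using Greatest_le_nat[of "\<lambda>j. j \<le> N \<and> e j \<noteq> 0" j N] that unfolding m_def by fastforce
  have "(\<Sum>j\<le>N. ev y (e j) * x ^ j) = (\<Sum>j\<le>m. ev y (e j) * x ^ j)"
    using m m_max by (intro sum.mono_neutral_right) auto
  then have "ev y (e m) * x ^ m + (\<Sum>j<m. ev y (e j) * x ^ j) = 0"
    using rel' by (simp add: lessThan_Suc_atMost[symmetric] add.commute)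
  then have xm: "x ^ m = (\<Sum>j<m. (- ev y (e j) / ev y (e m)) * x ^ j)"
    using m(2) by (simp add: ev_eq_0_iff[OF y] sum_negf sum_divide_distrib[symmetric] field_simps eq_neg_iff_add_eq_0)
  have "x ^ j \<in> power_span ?K x m" for j
  proof (induction j rule: less_induct)
    case (less j)
    show ?case
    proof (cases "j < m")
      case True
      then show ?thesis by (rule power_span_base[OF K])
    next
      case False
      have "x ^ j = x ^ (j - m) * x ^ m" using False by (simp flip: power_add)
      also have "\<dots> = (\<Sum>i<m. (- ev y (e i) / ev y (e m)) * x ^ (j - m + i))"
        unfolding xm by (simp add: sum_distrib_left power_add mult_ac)
      also have "\<dots> \<in> power_span ?K x m"
        using False less
        by (intro power_span_sum[OF K] power_span_scale[OF K] is_subfieldD(8)[OF K] is_subfieldD(6)[OF K]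
            ev_in_rational_subfield[OF y]) auto
      finally show ?thesis .
    qed
  qed
  note W_ev = ev_in_power_span[OF y this]
  \<comment> \<open>The products \<open>x ^ j * s\<close> with \<open>j < m\<close> need not be seen
    to span everything: for a given finite \<open>V\<close>, one common denominator
    \<open>ev x q\<close> moves all of \<open>V\<close> into their span over \<open>'k(y)\<close>,
    and this factor does not affect dependence.\<close>
  have "card V \<le> card S * m" if V: "indep_over ?K V" for V
  proof (rule ccontr)
    assume "\<not> card V \<le> card S * m"
    then have cV: "card (S \<times> {..<m}) < card V" by (simp add: card_cartesian_product)
    have fV: "finite V" using V by (simp add: indep_over_def)
    have fS: "finite S" using S by (simp add: spans_over_def)
    have "\<forall>f. \<exists>c. (\<forall>s\<in>S. c s \<in> ?L) \<and> f = (\<Sum>s\<in>S. c s * s)" using S by (auto simp: spans_over_def)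
    then obtain a where a: "\<And>f s. s \<in> S \<Longrightarrow> a f s \<in> ?L" "\<And>f. f = (\<Sum>s\<in>S. a f s * s)" by metis
    obtain q p where qp: "q \<noteq> 0" "\<forall>i\<in>V \<times> S. ev x q * a (fst i) (snd i) = ev x (p i)"
      using clear_denominators[OF xk, of "V \<times> S" "\<lambda>i. a (fst i) (snd i)"] fV fS a(1) by auto
    have "\<exists>b. (\<forall>j<m. b j \<in> ?K) \<and> ev x r = (\<Sum>j<m. b j * x ^ j)" for r
      using W_ev[of r] by (auto simp: power_span_def)
    then obtain b where b: "\<And>r j. j < m \<Longrightarrow> b r j \<in> ?K" "\<And>r. ev x r = (\<Sum>j<m. b r j * x ^ j)" by metis
    have "b (p (v, fst s)) (snd s) \<in> ?K" if "v \<in> V" "s \<in> S \<times> {..<m}" for v s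
      using that b(1) by auto
    from homogeneous_system_nontrivial[where c="\<lambda>v s. b (p (v, fst s)) (snd s)",
        OF K finite_cartesian_product[OF fS finite_lessThan] fV cV this]
    obtain d where d: "\<forall>v\<in>V. d v \<in> ?K" "\<exists>v\<in>V. d v \<noteq> 0"
      "\<forall>s\<in>S \<times> {..<m}. (\<Sum>v\<in>V. d v * b (p (v, fst s)) (snd s)) = 0"
      by blast
    have "ev x q * v = (\<Sum>s\<in>S. \<Sum>j<m. b (p (v, s)) j * x ^ j * s)" if "v \<in> V" for v
    proof -
      have "ev x q * v = (\<Sum>s\<in>S. ev x q * a v s * s)" by (subst a(2)[of v]) (simp add: sum_distrib_left mult.assoc)
      also have "\<dots> = (\<Sum>s\<in>S. ev x (p (v, s)) * s)" using qp(2) that by (intro sum.cong) auto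
      finally show ?thesis unfolding b(2) by (simp add: sum_distrib_right)
    qed
    then have "ev x q * (\<Sum>v\<in>V. d v * v) = (\<Sum>v\<in>V. d v * (\<Sum>s\<in>S. \<Sum>j<m. b (p (v, s)) j * x ^ j * s))"
      by (simp add: sum_distrib_left mult.left_commute)
    also have "\<dots> = (\<Sum>v\<in>V. \<Sum>i\<in>S \<times> {..<m}. d v * b (p (v, fst i)) (snd i) * (x ^ snd i * fst i))"
      by (simp add: sum_distrib_left sum.cartesian_product split_beta mult.assoc)
    also have "\<dots> = (\<Sum>i\<in>S \<times> {..<m}. \<Sum>v\<in>V. d v * b (p (v, fst i)) (snd i) * (x ^ snd i * fst i))"
      by (rule sum.swap)
    also have "\<dots> = (\<Sum>i\<in>S \<times> {..<m}. (\<Sum>v\<in>V. d v * b (p (v, fst i)) (snd i)) * (x ^ snd i * fst i))"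
      by (simp add: sum_distrib_right)
    also have "\<dots> = 0" using d(3) by (intro sum.neutral) auto
    finally have "(\<Sum>v\<in>V. d v * v) = 0" using qp(1) by (simp add: ev_eq_0_iff[OF xk])
    then show False using V d unfolding indep_over_def by blast
  qed
  then show ?thesis by (rule basis_over_exists[OF K])
qed

text \<open>Denominators are cleared and common factors \<open>y\<close> cancelled until some
  coefficient has nonzero constant term. Wherever \<open>y\<close> vanishes, that coefficient is a
  unit; this is how finiteness over \<open>'k(y)\<close> turns into statements about
  valuations.\<close>

lemma polynomial_dependence:
  assumes y: "y \<notin> range emb"
  obtains n where "\<And>(I :: 'i set) z. finite I \<Longrightarrow> n < card I \<Longrightarrow>
    \<exists>c. (\<exists>i\<in>I. coeff (c i) 0 \<noteq> 0) \<and> (\<Sum>i\<in>I. ev y (c i) * z i) = 0"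
proof -
  note K = is_subfield_rational_subfield[OF y]
  obtain U where U: "spans_over (rational_subfield emb y) U"
    using finite_over_rational_subfield[OF y] by blast
  have y0: "y \<noteq> 0" using y emb_0 by (metis rangeI)
  have shift: "\<exists>c'. (\<exists>i\<in>I. coeff (c' i) 0 \<noteq> 0) \<and> (\<Sum>i\<in>I. ev y (c' i) * z i) = 0"
    if "\<exists>i\<in>I. c i \<noteq> 0" "(\<Sum>i\<in>I. ev y (c i) * z i) = 0" "\<And>i. i \<in> I \<Longrightarrow> degree (c i) \<le> m"
    for I :: "'i set" and c z m
    using that
  proof (induction m arbitrary: c)
    case 0
    then show ?case by (intro exI[of _ c]) (metis le_zero_eq leading_coeff_0_iff)
  next
    case (Suc m)
    show ?case
    proof (cases "\<exists>i\<in>I. coeff (c i) 0 \<noteq> 0")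
      case True
      then show ?thesis using Suc by blast
    next
      case False
      define c' where "c' i = poly_shift 1 (c i)" for i
      have c': "c i = pCons 0 (c' i)" if "i \<in> I" for i
        using False that by (intro poly_eqI) (auto simp: c'_def coeff_poly_shift coeff_pCons split: nat.split)
      have "degree (c' i) \<le> m" if "i \<in> I" for i
        using Suc.prems(3)[OF that] c'[OF that] by (cases "c' i = 0") auto
      moreover have "\<exists>i\<in>I. c' i \<noteq> 0" using Suc.prems(1) c' by auto
      moreover have "(\<Sum>i\<in>I. ev y (c i) * z i) = y * (\<Sum>i\<in>I. ev y (c' i) * z i)"
        by (simp add: sum_distrib_left c' ev_pCons mult.assoc)
      ultimately show ?thesis using Suc.IH[of c'] Suc.prems y0 by simp
    qed
  qed
  have "\<exists>c. (\<exists>i\<in>I. coeff (c i) 0 \<noteq> 0) \<and> (\<Sum>i\<in>I. ev y (c i) * z i) = 0"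
    if I: "finite I" "card U < card I" for I :: "'i set" and z
  proof -
    obtain d where d: "\<forall>i\<in>I. d i \<in> rational_subfield emb y" "\<exists>i\<in>I. d i \<noteq> 0" "(\<Sum>i\<in>I. d i * z i) = 0"
      using spans_over_dependence[OF K U I] by blast
    obtain q c where qc: "q \<noteq> 0" "\<forall>i\<in>I. ev y q * d i = ev y (c i)"
      using clear_denominators[OF y I(1), of d] d(1) by blast
    have "(\<Sum>i\<in>I. ev y (c i) * z i) = ev y q * (\<Sum>i\<in>I. d i * z i)"
      using qc(2) by (simp add: sum_distrib_left mult.assoc[symmetric])
    then have "(\<Sum>i\<in>I. ev y (c i) * z i) = 0" using d by simp
    moreover have "\<exists>i\<in>I. c i \<noteq> 0"
      using d(2) qc ev_eq_0_iff[OF y] by (metis map_poly_0 mult_eq_0_iff poly_0)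
    moreover have "degree (c i) \<le> Max ((\<lambda>i. degree (c i)) ` I)" if "i \<in> I" for i
      using that I by (intro Max_ge) auto
    ultimately show ?thesis by (intro shift)
  qed
  then show ?thesis using that by blast
qed

end

subsection \<open>Valuations\<close>

definition ball :: "'f::field place \<Rightarrow> int \<Rightarrow> 'f set" where
  "ball P n = {f. f = 0 \<or> n \<le> P f}"

lemma ball_0 [simp]: "0 \<in> ball P n"
  by (simp add: ball_def)

lemma ball_mono: "f \<in> ball P n \<Longrightarrow> m \<le> n \<Longrightarrow> f \<in> ball P m"
  by (auto simp: ball_def)

lemma mem_ballD: "f \<in> ball P n \<Longrightarrow> f \<noteq> 0 \<Longrightarrow> n \<le> P f"
  by (auto simp: ball_def)

lemma mem_ballI: "n \<le> P f \<Longrightarrow> f \<in> ball P n"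
  by (auto simp: ball_def)

context function_field
begin

context
  fixes P assumes P: "P \<in> places emb"
begin

lemma place_0: "P 0 = 0" and place_emb: "P (emb c) = 0"
  and place_mult: "a \<noteq> 0 \<Longrightarrow> b \<noteq> 0 \<Longrightarrow> P (a * b) = P a + P b"
  and place_add: "a \<noteq> 0 \<Longrightarrow> b \<noteq> 0 \<Longrightarrow> a + b \<noteq> 0 \<Longrightarrow> min (P a) (P b) \<le> P (a + b)"
  using P by (auto simp: places_def)

lemma place_1: "P 1 = 0"
  using place_emb[of 1] by (simp add: emb_1)

lemma place_uminus: "P (- a) = P a"
  using place_mult[of "emb (- 1)" a] place_emb[of "- 1"] place_0
  by (cases "a = 0") (auto simp: emb_uminus emb_1)

lemma place_inverse: "P (inverse a) = - P a"
  using place_mult[of a "inverse a"] place_1 place_0 by (cases "a = 0") auto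

lemma place_divide: "a \<noteq> 0 \<Longrightarrow> b \<noteq> 0 \<Longrightarrow> P (a / b) = P a - P b"
  by (simp add: divide_inverse place_mult place_inverse)

lemma place_power: "P (a ^ n) = int n * P a"
proof (cases "a = 0")
  case True
  then show ?thesis by (cases n) (auto simp: place_0 place_1)
next
  case False
  then show ?thesis by (induction n) (auto simp: place_1 place_mult algebra_simps)
qed

lemma place_power_int: "P (a powi n) = n * P a"
  by (auto simp: power_int_def place_power place_inverse)

lemma uniformizer: "P (uniformizer P) = 1"
proof -
  have "\<exists>t. P t = 1" using P by (simp add: places_def)
  then show ?thesis unfolding uniformizer_def by (rule someI_ex)
qed

lemma uniformizer_nonzero: "uniformizer P \<noteq> 0"
  using uniformizer place_0 by auto

lemma ball_add: "a \<in> ball P n \<Longrightarrow> b \<in> ball P n \<Longrightarrow> a + b \<in> ball P n"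
  using place_add[of a b] by (cases "a = 0"; cases "b = 0"; cases "a + b = 0") (auto simp: ball_def)

lemma ball_uminus: "a \<in> ball P n \<Longrightarrow> - a \<in> ball P n"
  by (auto simp: ball_def place_uminus)

lemma ball_diff: "a \<in> ball P n \<Longrightarrow> b \<in> ball P n \<Longrightarrow> a - b \<in> ball P n"
  using ball_add[of a n "- b"] ball_uminus by auto

lemma ball_mult: "a \<in> ball P m \<Longrightarrow> b \<in> ball P n \<Longrightarrow> a * b \<in> ball P (m + n)"
  using place_mult[of a b] by (cases "a = 0"; cases "b = 0") (auto simp: ball_def)

lemma ball_mult_le: "a \<in> ball P m \<Longrightarrow> b \<in> ball P n \<Longrightarrow> k \<le> m + n \<Longrightarrow> a * b \<in> ball P k"
  using ball_mult ball_mono by blast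

lemma ball_sum: "(\<And>i. i \<in> I \<Longrightarrow> f i \<in> ball P n) \<Longrightarrow> (\<Sum>i\<in>I. f i) \<in> ball P n"
  by (induction I rule: infinite_finite_induct) (auto intro: ball_add)

lemma ball_emb: "emb c \<in> ball P 0"
  by (rule mem_ballI) (simp add: place_emb)

lemma ball_scale: "f \<in> ball P n \<Longrightarrow> emb c * f \<in> ball P n"
  using ball_mult[OF ball_emb, of f n c] by simp

lemma ball_1: "1 \<in> ball P 0"
  using ball_emb[of 1] by (simp add: emb_1)

lemma ball_power: "a \<in> ball P 0 \<Longrightarrow> a ^ n \<in> ball P 0"
  by (induction n) (use ball_1 ball_mult[of a 0 _ 0] in auto)

lemma ball_ev: "y \<in> ball P 0 \<Longrightarrow> ev y p \<in> ball P 0"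
proof (induction p)
  case (pCons a p)
  then show ?case using ball_add[OF ball_emb[of a], of "y * ev y p"] ball_mult[of y 0 "ev y p" 0] by (simp add: ev_pCons)
qed simp

lemma place_add_dominant:
  assumes a: "a \<noteq> 0" and b: "b \<in> ball P (P a + 1)"
  shows "a + b \<noteq> 0" "P (a + b) = P a"
proof -
  have "a + b \<noteq> 0 \<and> P (a + b) = P a"
  proof (cases "b = 0")
    case False
    then have lt: "P a < P b" using b by (auto simp: ball_def)
    then have nz: "a + b \<noteq> 0" using place_uminus[of b] by (metis add.commute add_eq_0_iff less_irrefl)
    have "min (P (a + b)) (P (- b)) \<le> P a" using place_add[of "a + b" "- b"] nz False a by simp
    moreover have "min (P a) (P b) \<le> P (a + b)" using place_add[OF a False nz] .
    ultimately show ?thesis using lt nz by (auto simp: place_uminus min_def split: if_splits)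
  qed (use a in auto)
  then show "a + b \<noteq> 0" "P (a + b) = P a" by auto
qed

lemma place_sum_dominant:
  assumes "finite I" "j \<in> I" "a j \<noteq> 0" "\<And>i. i \<in> I \<Longrightarrow> i \<noteq> j \<Longrightarrow> a i \<in> ball P (P (a j) + 1)"
  shows "(\<Sum>i\<in>I. a i) \<noteq> 0" "P (\<Sum>i\<in>I. a i) = P (a j)"
proof -
  have "(\<Sum>i\<in>I - {j}. a i) \<in> ball P (P (a j) + 1)" using assms(4) by (intro ball_sum) auto
  from place_add_dominant[OF assms(3) this]
  show "(\<Sum>i\<in>I. a i) \<noteq> 0" "P (\<Sum>i\<in>I. a i) = P (a j)"
    by (simp_all add: sum.remove[OF assms(1,2)])
qed

lemma place_nonzero_nonconstant: "P f \<noteq> 0 \<Longrightarrow> f \<notin> range emb"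
  using place_emb by auto

lemma place_ev_pole:
  assumes x: "P x < 0" and p: "p \<noteq> 0"
  shows "P (ev x p) = int (degree p) * P x"
proof -
  have x0: "x \<noteq> 0" using x place_0 by auto
  have v: "P (emb c * x ^ i) = int i * P x" if "c \<noteq> 0" for c i
    using that x0 by (simp add: place_mult place_emb place_power)
  have "emb (coeff p i) * x ^ i \<in> ball P (P (emb (coeff p (degree p)) * x ^ degree p) + 1)"
    if "i \<in> {..degree p}" "i \<noteq> degree p" for i
  proof (cases "coeff p i = 0")
    case False
    have "int (degree p) * P x + 1 \<le> int i * P x"
    proof -
      have "int (degree p - i) * P x \<le> 1 * P x"
        using that x by (intro mult_right_mono_neg) auto
      moreover have "int (degree p - i) = int (degree p) - int i" using that by simp
      ultimately show ?thesis using x by (simp add: left_diff_distrib)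
    qed
    then show ?thesis using p v False by (intro mem_ballI) (simp add: v)
  qed simp
  with place_sum_dominant(2)[of "{..degree p}" "degree p" "\<lambda>i. emb (coeff p i) * x ^ i"] p x0
  show ?thesis by (simp add: ev_altdef[OF order_refl] v)
qed

end

text \<open>An inclusion of valuation rings takes units to units, so \<open>Q\<close> equals
  \<open>P\<close> multiplied by the value of \<open>Q\<close> at a uniformizer of \<open>P\<close>.
  Both valuations being normalised, this factor is 1.\<close>

lemma place_eqI:
  assumes P: "P \<in> places emb" and Q: "Q \<in> places emb" and le: "ball P 0 \<subseteq> ball Q 0"
  shows "P = Q"
proof
  let ?t = "uniformizer P"
  note t = uniformizer[OF P] uniformizer_nonzero[OF P]
  have unit: "Q f = 0" if "P f = 0" "f \<noteq> 0" for f
  proof -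
    have "f \<in> ball Q 0" "inverse f \<in> ball Q 0"
      by (rule subsetD[OF le], rule mem_ballI, simp add: that place_inverse[OF P])+
    then show ?thesis using that mem_ballD[of f Q 0] mem_ballD[of "inverse f" Q 0] by (auto simp: place_inverse[OF Q])
  qed
  have Qf: "Q f = P f * Q ?t" if f: "f \<noteq> 0" for f
  proof -
    have tn: "?t powi (P f) \<noteq> 0" using t by simp
    have "P (f / ?t powi (P f)) = 0" using f t tn by (simp add: place_divide[OF P] place_power_int[OF P])
    with unit[of "f / ?t powi (P f)"] f tn have "Q (f / ?t powi (P f)) = 0" by simp
    then show ?thesis using f tn by (simp add: place_divide[OF Q] place_power_int[OF Q])
  qed
  have "P (uniformizer Q) * Q ?t = 1"
    using Qf[OF uniformizer_nonzero[OF Q]] uniformizer[OF Q] by simp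
  moreover have "Q ?t \<ge> 0"
    by (rule mem_ballD[OF subsetD[OF le]], rule mem_ballI) (simp_all add: t)
  ultimately have "Q ?t = 1" by (auto simp: zmult_eq_1_iff)
  then show "P f = Q f" for f using Qf[of f] place_0[OF P] place_0[OF Q] by (cases "f = 0") auto
qed

subsection \<open>Weak approximation\<close>

lemma separate_two_places:
  assumes P: "P \<in> places emb" and Q: "Q \<in> places emb" and "P \<noteq> Q"
  shows "\<exists>u. u \<noteq> 0 \<and> P u > 0 \<and> Q u < 0"
proof -
  obtain a where a: "a \<in> ball P 0" "a \<notin> ball Q 0" using place_eqI[OF P Q] assms(3) by blast
  obtain b where b: "b \<in> ball Q 0" "b \<notin> ball P 0" using place_eqI[OF Q P] assms(3) by blast
  have "a \<noteq> 0" "b \<noteq> 0" using a b by auto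
  then have "P (a / b) > 0" "Q (a / b) < 0"
    using a b by (auto simp: ball_def place_divide[OF P] place_divide[OF Q])
  then show ?thesis using \<open>a \<noteq> 0\<close> \<open>b \<noteq> 0\<close> by (intro exI[of _ "a / b"]) auto
qed

lemma separate_places:
  assumes P: "P \<in> places emb" and "finite S" "S \<subseteq> places emb" "P \<notin> S"
  shows "\<exists>u. u \<noteq> 0 \<and> P u > 0 \<and> (\<forall>Q\<in>S. Q u < 0)"
  using assms(2-4)
proof (induction S rule: finite_induct)
  case empty
  then show ?case using uniformizer[OF P] uniformizer_nonzero[OF P] by (intro exI[of _ "uniformizer P"]) auto
next
  case (insert Q S)
  obtain u where u: "u \<noteq> 0" "P u > 0" "\<And>Q. Q \<in> S \<Longrightarrow> Q u < 0" using insert by auto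
  have Q: "Q \<in> places emb" "P \<noteq> Q" using insert by auto
  obtain y where y: "y \<noteq> 0" "P y > 0" "Q y < 0" using separate_two_places[OF P Q] by blast
  \<comment> \<open>\<open>r\<close> exceeds all \<open>\<bar>Q' u\<bar>\<close>, so
    \<open>u\<close> and \<open>y ^ r\<close> have different values at every \<open>Q'\<close> in
    question and cannot cancel: \<open>u\<close> dominates where \<open>y\<close> is regular,
    \<open>y ^ r\<close> where \<open>y\<close> has a pole.\<close>
  define r where "r = Suc (\<Sum>Q'\<in>insert Q S. nat \<bar>Q' u\<bar>)"
  let ?w = "u + y ^ r"
  have *: "?w \<noteq> 0 \<and> Q' ?w < 0" if Q': "Q' \<in> insert Q S" for Q'
  proof -
    have pl: "Q' \<in> places emb" using Q' insert by auto
    have "nat \<bar>Q' u\<bar> < r"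
      unfolding r_def using member_le_sum[OF Q', of "\<lambda>Q'. nat \<bar>Q' u\<bar>"] insert by auto
    then have lt: "\<bar>Q' u\<bar> < int r" by linarith
    have pw: "Q' (y ^ r) = int r * Q' y" "y ^ r \<noteq> 0" using y place_power[OF pl] by auto
    consider "Q' y = 0" | "Q' y > 0" | "Q' y < 0" by linarith
    then show ?thesis
    proof cases
      case 1
      then have "Q' \<in> S" using y Q' by auto
      then have "Q' u < 0" "y ^ r \<in> ball Q' (Q' u + 1)" using u(3)[of Q'] pw 1 by (auto intro!: mem_ballI)
      with place_add_dominant[OF pl u(1)] show ?thesis by auto
    next
      case 2
      then have "Q' \<in> S" using y Q' by auto
      moreover have "int r * 1 \<le> int r * Q' y" using 2 by (intro mult_left_mono) auto
      ultimately have "Q' u < 0" "Q' u + 1 \<le> Q' (y ^ r)" using u(3)[of Q'] lt pw by linarith+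
      then have "Q' u < 0" "y ^ r \<in> ball Q' (Q' u + 1)" by (auto intro: mem_ballI)
      with place_add_dominant[OF pl u(1)] show ?thesis by auto
    next
      case 3
      have "int r * Q' y \<le> int r * (- 1)" using 3 by (intro mult_left_mono) auto
      then have "u \<in> ball Q' (Q' (y ^ r) + 1)" "Q' (y ^ r) < 0" using lt pw by (auto simp: ball_def)
      with place_add_dominant[OF pl pw(2), of u] show ?thesis by (auto simp: add.commute)
    qed
  qed
  have "?w \<noteq> 0" using * by blast
  moreover have "?w \<in> ball P 1"
  proof (intro ball_add[OF P])
    have "1 * 1 \<le> int r * P y" using y by (intro mult_mono) (auto simp: r_def)
    then show "y ^ r \<in> ball P 1" by (intro mem_ballI) (simp add: place_power[OF P])
  qed (use u in \<open>auto simp: ball_def\<close>)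
  ultimately show ?case using * mem_ballD[of ?w P 1] by (intro exI[of _ ?w]) auto
qed

text \<open>If \<open>u\<close> vanishes at \<open>P\<close> and has poles on \<open>S\<close>, then
  \<open>1 / (1 + u ^ n)\<close> is close to 1 at \<open>P\<close> and close to 0 on
  \<open>S\<close>.\<close>

lemma approximate_idempotent:
  assumes P: "P \<in> places emb" and S: "finite S" "S \<subseteq> places emb" "P \<notin> S" and n: "n > 0"
  shows "\<exists>e. e - 1 \<in> ball P (int n) \<and> (\<forall>Q\<in>S. e \<in> ball Q (int n))"
proof -
  obtain u where u: "u \<noteq> 0" "P u > 0" "\<And>Q. Q \<in> S \<Longrightarrow> Q u < 0" using separate_places[OF assms(1-4)] by blast
  let ?d = "1 + u ^ n"
  have "int n * 1 \<le> int n * P u" using u by (intro mult_left_mono) auto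
  then have Pu: "P (u ^ n) \<ge> int n" by (simp add: place_power[OF P])
  then have d: "?d \<noteq> 0" "P ?d = 0"
    using place_add_dominant[OF P, of 1 "u ^ n"] n by (auto simp: place_1[OF P] ball_def)
  have "inverse ?d - 1 = - (u ^ n) / ?d" using d by (simp add: field_simps)
  moreover have "- (u ^ n) / ?d \<in> ball P (int n)"
    using d u Pu by (intro mem_ballI) (simp add: place_uminus[OF P] place_divide[OF P])
  moreover have "inverse ?d \<in> ball Q (int n)" if "Q \<in> S" for Q
  proof -
    have Q: "Q \<in> places emb" using that S by auto
    have "int n * Q u \<le> int n * (- 1)" using u(3)[OF that] by (intro mult_left_mono) auto
    then have Qu: "Q (u ^ n) \<le> - int n" by (simp add: place_power[OF Q])
    then have "Q ?d = Q (u ^ n)"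
      using place_add_dominant[OF Q, of "u ^ n" 1] n u(1) by (auto simp: place_1[OF Q] ball_def add.commute)
    then show ?thesis using Qu by (intro mem_ballI) (simp add: place_inverse[OF Q])
  qed
  ultimately show ?thesis by (intro exI[of _ "inverse ?d"]) auto
qed

lemma exists_common_uniformizer:
  assumes S: "finite S" "S \<subseteq> places emb"
  shows "\<exists>t. \<forall>Q\<in>S. Q t = 1"
proof -
  \<comment> \<open>Large enough to outweigh a pole of any chosen uniformizer at any point of
    \<open>S\<close>, with 2 to spare: all error terms in \<open>t\<close> then have value at least
    2 and leave the value 1 intact.\<close>
  define n where "n = Suc (Suc (\<Sum>Q\<in>S. \<Sum>Q'\<in>S. nat \<bar>Q (uniformizer Q')\<bar>))"
  have n: "2 \<le> int n + Q (uniformizer Q')" if "Q \<in> S" "Q' \<in> S" for Q Q'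
  proof -
    have "nat \<bar>Q (uniformizer Q')\<bar> \<le> (\<Sum>Q'\<in>S. nat \<bar>Q (uniformizer Q')\<bar>)"
      using S that by (intro member_le_sum) auto
    also have "\<dots> \<le> (\<Sum>Q\<in>S. \<Sum>Q'\<in>S. nat \<bar>Q (uniformizer Q')\<bar>)"
      using S that by (intro member_le_sum[of Q S]) auto
    finally show ?thesis unfolding n_def by linarith
  qed
  have "\<forall>Q\<in>S. \<exists>e. e - 1 \<in> ball Q (int n) \<and> (\<forall>Q'\<in>S - {Q}. e \<in> ball Q' (int n))"
    using S by (intro ballI approximate_idempotent) (auto simp: n_def)
  from bchoice[OF this] obtain e where e: "\<And>Q. Q \<in> S \<Longrightarrow> e Q - 1 \<in> ball Q (int n)"
    "\<And>Q Q'. Q \<in> S \<Longrightarrow> Q' \<in> S \<Longrightarrow> Q' \<noteq> Q \<Longrightarrow> e Q \<in> ball Q' (int n)"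
    by blast
  define t where "t = (\<Sum>Q\<in>S. uniformizer Q * e Q)"
  have "Q t = 1" if Q: "Q \<in> S" for Q
  proof -
    have pl: "Q \<in> places emb" using Q S by auto
    have "uniformizer Q * (e Q - 1) \<in> ball Q (1 + 1)"
      using e(1)[OF Q] n[OF Q Q] uniformizer[OF pl]
      by (intro ball_mult[OF pl]) (auto simp: ball_def n_def)
    then have 1: "uniformizer Q * e Q \<noteq> 0" "Q (uniformizer Q * e Q) = 1"
      using place_add_dominant[OF pl uniformizer_nonzero[OF pl], of "uniformizer Q * (e Q - 1)"] uniformizer[OF pl]
      by (auto simp: algebra_simps)
    have "uniformizer Q' * e Q' \<in> ball Q (Q (uniformizer Q * e Q) + 1)" if "Q' \<in> S" "Q' \<noteq> Q" for Q'
      using e(2)[OF that(1) Q] that n[OF Q that(1)] 1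
      by (intro ball_mult_le[OF pl, of _ "Q (uniformizer Q')" _ "int n"]) (auto simp: ball_def)
    from place_sum_dominant(2)[where a="\<lambda>Q. uniformizer Q * e Q", OF pl S(1) Q 1(1) this] 1 show ?thesis by (simp add: t_def)
  qed
  then show ?thesis by blast
qed

subsection \<open>Finiteness of zeros and poles\<close>

text \<open>Approximate idempotents at distinct zeros of \<open>y\<close> are independent over
  \<open>'k(y)\<close>: in a relation whose coefficient at \<open>Q\<close> has nonzero constant
  term, the term of \<open>Q\<close> is a unit at \<open>Q\<close> and all other terms vanish there.
  Their number is therefore bounded.\<close>

lemma finite_zeros:
  assumes y: "y \<notin> range emb"
  shows "finite {P \<in> places emb. P y > 0}"
proof (rule ccontr)
  assume inf: "infinite {P \<in> places emb. P y > 0}"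
  obtain n where n: "\<And>(I :: 'f place set) z. finite I \<Longrightarrow> n < card I \<Longrightarrow>
    \<exists>c. (\<exists>i\<in>I. coeff (c i) 0 \<noteq> 0) \<and> (\<Sum>i\<in>I. ev y (c i) * z i) = 0"
    using polynomial_dependence[OF y] by blast
  obtain S where S: "S \<subseteq> {P \<in> places emb. P y > 0}" "card S = Suc n" "finite S"
    using inf infinite_arbitrarily_large by blast
  have "\<forall>Q\<in>S. \<exists>e. e - 1 \<in> ball Q (int 1) \<and> (\<forall>Q'\<in>S - {Q}. e \<in> ball Q' (int 1))"
    using S by (intro ballI approximate_idempotent) auto
  from bchoice[OF this] obtain e where e: "\<And>Q. Q \<in> S \<Longrightarrow> e Q - 1 \<in> ball Q 1"
    "\<And>Q Q'. Q \<in> S \<Longrightarrow> Q' \<in> S \<Longrightarrow> Q' \<noteq> Q \<Longrightarrow> e Q \<in> ball Q' 1"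
    unfolding of_nat_1 by blast
  obtain c Q where c: "Q \<in> S" "coeff (c Q) 0 \<noteq> 0" "(\<Sum>Q\<in>S. ev y (c Q) * e Q) = 0"
    using n[OF S(3), of e] S(2) by auto
  have pl: "Q \<in> places emb" "Q y > 0" using c S by auto
  have yQ: "y \<in> ball Q 0" using pl by (auto simp: ball_def)
  have e1: "e Q \<noteq> 0" "Q (e Q) = 0"
    using place_add_dominant[OF pl(1), of 1 "e Q - 1"] e(1)[OF c(1)] by (auto simp: place_1[OF pl(1)])
  have c1: "ev y (c Q) \<noteq> 0 \<and> Q (ev y (c Q)) = 0"
  proof -
    obtain a p where ap: "c Q = pCons a p" by (cases "c Q")
    have "y * ev y p \<in> ball Q (1 + 0)"
      using pl yQ by (intro ball_mult[OF pl(1)] ball_ev[OF pl(1)]) (auto simp: ball_def)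
    then show ?thesis
      using place_add_dominant[OF pl(1), of "emb a" "y * ev y p"] ap c(2) by (auto simp: ev_pCons place_emb[OF pl(1)])
  qed
  have ne: "ev y (c Q) * e Q \<noteq> 0" and v: "Q (ev y (c Q) * e Q) = 0"
    using c1 e1 by (auto simp: place_mult[OF pl(1)])
  have "ev y (c Q') * e Q' \<in> ball Q (Q (ev y (c Q) * e Q) + 1)" if "Q' \<in> S" "Q' \<noteq> Q" for Q'
    unfolding v using that e(2)[of Q' Q] c(1) by (intro ball_mult[OF pl(1)] ball_ev[OF pl(1) yQ]) auto
  from place_sum_dominant(1)[where a="\<lambda>Q. ev y (c Q) * e Q", OF pl(1) S(3) c(1) ne this] c(3)
  show False by simp
qed

lemma inverse_nonconstant:
  assumes "f \<notin> range emb" shows "inverse f \<notin> range emb"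
proof
  assume "inverse f \<in> range emb"
  then obtain c where "inverse f = emb c" by blast
  then have "f = emb (inverse c)" unfolding emb_inverse by (metis inverse_inverse_eq)
  then show False using assms by blast
qed

lemma finite_poles: "finite {P \<in> places emb. P f < 0}"
proof (cases "f \<in> range emb")
  case True
  then have "{P \<in> places emb. P f < 0} = {}" by (auto simp: place_emb)
  then show ?thesis by (metis finite.emptyI)
next
  case False
  from finite_zeros[OF inverse_nonconstant[OF this]] show ?thesis
    by (rule rev_finite_subset) (auto simp: place_inverse)
qed

subsection \<open>Every nonconstant function has a pole\<close>

definition is_subalgebra :: "'f set \<Rightarrow> bool" where
  "is_subalgebra M \<longleftrightarrow> range emb \<subseteq> M \<and> (\<forall>a\<in>M. \<forall>b\<in>M. a - b \<in> M \<and> a * b \<in> M)"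

lemma is_subalgebraD:
  assumes "is_subalgebra M"
  shows "emb c \<in> M" "0 \<in> M" "1 \<in> M" "a \<in> M \<Longrightarrow> b \<in> M \<Longrightarrow> a - b \<in> M"
    "a \<in> M \<Longrightarrow> b \<in> M \<Longrightarrow> a * b \<in> M" "a \<in> M \<Longrightarrow> - a \<in> M" "a \<in> M \<Longrightarrow> b \<in> M \<Longrightarrow> a + b \<in> M"
    "a \<in> M \<Longrightarrow> a ^ n \<in> M"
proof -
  show e: "emb c \<in> M" and d: "a \<in> M \<Longrightarrow> b \<in> M \<Longrightarrow> a - b \<in> M"
    and m: "a \<in> M \<Longrightarrow> b \<in> M \<Longrightarrow> a * b \<in> M" for a b c
    using assms by (auto simp: is_subalgebra_def)
  show 0: "0 \<in> M" and 1: "1 \<in> M" using e[of 0] e[of 1] by (simp_all add: emb_1)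
  show n: "a \<in> M \<Longrightarrow> - a \<in> M" for a using d[OF 0, of a] by simp
  show "a \<in> M \<Longrightarrow> b \<in> M \<Longrightarrow> a + b \<in> M" using d[of a "- b"] n[of b] by simp
  show "a \<in> M \<Longrightarrow> a ^ n \<in> M" by (induction n) (auto intro: m 1)
qed

lemma is_subalgebra_sum:
  assumes "is_subalgebra M" "\<And>i. i \<in> I \<Longrightarrow> f i \<in> M"
  shows "(\<Sum>i\<in>I. f i) \<in> M"
  using assms(2) by (induction I rule: infinite_finite_induct) (auto simp: is_subalgebraD[OF assms(1)])

lemma is_subalgebra_adjoin:
  assumes M: "is_subalgebra M"
  shows "is_subalgebra {poly p f | p. \<forall>i. coeff p i \<in> M}"
  unfolding is_subalgebra_def
proof (intro conjI ballI subsetI)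
  fix a assume "a \<in> range emb"
  then obtain c where "a = poly [:emb c:] f" by auto
  moreover have "\<forall>i. coeff [:emb c:] i \<in> M" using is_subalgebraD[OF M] by (auto simp: coeff_pCons split: nat.split)
  ultimately show "a \<in> {poly p f | p. \<forall>i. coeff p i \<in> M}" by blast
next
  fix a b assume "a \<in> {poly p f | p. \<forall>i. coeff p i \<in> M}" "b \<in> {poly p f | p. \<forall>i. coeff p i \<in> M}"
  then obtain p q where p: "a = poly p f" "\<forall>i. coeff p i \<in> M" and q: "b = poly q f" "\<forall>i. coeff q i \<in> M"
    by blast
  have "a - b = poly (p - q) f" "\<forall>i. coeff (p - q) i \<in> M" using p q is_subalgebraD[OF M] by auto
  then show "a - b \<in> {poly p f | p. \<forall>i. coeff p i \<in> M}" by blast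
  have "a * b = poly (p * q) f" "\<forall>i. coeff (p * q) i \<in> M" using p q is_subalgebraD[OF M]
    by (auto simp: coeff_mult intro!: is_subalgebra_sum[OF M])
  then show "a * b \<in> {poly p f | p. \<forall>i. coeff p i \<in> M}" by blast
qed

text \<open>Zorn's lemma, starting from \<open>'k[1/y]\<close>, which misses \<open>y\<close>
  because \<open>1/y\<close> is transcendental. The maximal \<open>M\<close> will be the valuation
  ring of a pole of \<open>y\<close>.\<close>

lemma exists_maximal_subalgebra:
  assumes y: "y \<notin> range emb"
  shows "\<exists>M. is_subalgebra M \<and> inverse y \<in> M \<and> y \<notin> M \<and>
    (\<forall>M'. is_subalgebra M' \<longrightarrow> M \<subseteq> M' \<longrightarrow> y \<notin> M' \<longrightarrow> M' = M)"
proof -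
  define A where "A = {M. is_subalgebra M \<and> inverse y \<in> M \<and> y \<notin> M}"
  have y0: "y \<noteq> 0" using y emb_0 by (metis rangeI)
  note z = inverse_nonconstant[OF y]
  have "range (ev (inverse y)) \<in> A"
  proof -
    have "is_subalgebra (range (ev (inverse y)))"
      unfolding is_subalgebra_def
    proof (intro conjI ballI subsetI)
      fix a assume "a \<in> range emb"
      then obtain c where "a = ev (inverse y) [:c:]" by (auto simp: ev_pCons)
      then show "a \<in> range (ev (inverse y))" by blast
    next
      fix a b assume "a \<in> range (ev (inverse y))" "b \<in> range (ev (inverse y))"
      then obtain p q where "a = ev (inverse y) p" "b = ev (inverse y) q" by auto
      then show "a - b \<in> range (ev (inverse y))" "a * b \<in> range (ev (inverse y))"
        by (auto simp flip: ev_diff ev_mult)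
    qed
    moreover have "inverse y = ev (inverse y) [:0, 1:]" by (simp add: ev_pCons emb_1)
    then have "inverse y \<in> range (ev (inverse y))" by blast
    moreover have "y \<notin> range (ev (inverse y))"
    proof
      assume "y \<in> range (ev (inverse y))"
      then obtain p where "y = ev (inverse y) p" by blast
      then have "ev (inverse y) (pCons 0 p - 1) = inverse y * y - 1" by (simp add: ev_diff ev_pCons)
      then have "pCons 0 p = 1" using ev_eq_0_iff[OF z, of "pCons 0 p - 1"] y0 by simp
      then show False by (simp add: one_pCons)
    qed
    ultimately show ?thesis by (simp add: A_def)
  qed
  then have "A \<noteq> {}" by blast
  moreover have "\<Union>C \<in> A" if C: "C \<noteq> {}" "subset.chain A C" for C
  proof -
    have CA: "\<And>M. M \<in> C \<Longrightarrow> M \<in> A" and ch: "\<And>M N. M \<in> C \<Longrightarrow> N \<in> C \<Longrightarrow> M \<subseteq> N \<or> N \<subseteq> M"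
      using C(2) by (auto simp: subset_chain_def)
    have "a - b \<in> \<Union>C" "a * b \<in> \<Union>C" if ab: "a \<in> \<Union>C" "b \<in> \<Union>C" for a b
    proof -
      obtain M N where "M \<in> C" "N \<in> C" "a \<in> M" "b \<in> N" using ab by blast
      then obtain M where M: "M \<in> C" "a \<in> M" "b \<in> M" using ch by blast
      then have "is_subalgebra M" using CA by (auto simp: A_def)
      then show "a - b \<in> \<Union>C" "a * b \<in> \<Union>C" using M is_subalgebraD(4,5) by blast+
    qed
    moreover obtain M where "M \<in> C" using C(1) by blast
    then have "range emb \<subseteq> \<Union>C" "inverse y \<in> \<Union>C"
      using CA[of M] by (auto simp: A_def is_subalgebra_def)
    moreover have "y \<notin> \<Union>C" using CA by (auto simp: A_def)
    ultimately show ?thesis by (simp add: A_def is_subalgebra_def)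
  qed
  ultimately obtain M where "M \<in> A" "\<forall>X\<in>A. M \<subseteq> X \<longrightarrow> X = M"
    using subset_Zorn_nonempty[of A] by blast
  then show ?thesis by (intro exI[of _ M]) (auto simp: A_def)
qed

section \<open>Maximal subalgebras avoiding \<open>y\<close> are valuation rings\<close>

context
  fixes y M
  assumes y: "y \<notin> range emb" and M: "is_subalgebra M" and zM: "inverse y \<in> M" and yM: "y \<notin> M"
    and max: "\<And>M'. is_subalgebra M' \<Longrightarrow> M \<subseteq> M' \<Longrightarrow> y \<notin> M' \<Longrightarrow> M' = M"
begin

lemma maximal_y_nonzero: "y \<noteq> 0"
  using y emb_0 by (metis rangeI)

lemma maximal_adjoin:
  assumes "f \<notin> M"
  shows "\<exists>n a. (\<forall>i. a i \<in> M) \<and> y = (\<Sum>i\<le>n. a i * f ^ i)"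
proof -
  let ?M = "{poly p f | p. \<forall>i. coeff p i \<in> M}"
  have "M \<subseteq> ?M"
  proof
    fix a assume "a \<in> M"
    then have "\<forall>i. coeff [:a:] i \<in> M" "a = poly [:a:] f"
      using is_subalgebraD(2)[OF M] by (auto simp: coeff_pCons split: nat.split)
    then show "a \<in> ?M" by blast
  qed
  moreover have "f \<in> ?M"
  proof -
    have "\<forall>i. coeff [:0, 1:] i \<in> M" "f = poly [:0, 1:] f"
      using is_subalgebraD(2,3)[OF M] by (auto simp: coeff_pCons split: nat.split)
    then show ?thesis by blast
  qed
  ultimately have "y \<in> ?M" using max[OF is_subalgebra_adjoin[OF M]] assms by blast
  then obtain p where "y = poly p f" "\<forall>i. coeff p i \<in> M" by blast
  then show ?thesis by (intro exI[of _ "degree p"] exI[of _ "coeff p"]) (simp add: poly_altdef)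
qed

text \<open>Put \<open>u = 1 - b/y\<close>. If \<open>1/u\<close> were missing from
  \<open>M\<close>, adjoining it would produce \<open>y\<close>, hence
  \<open>y * u ^ n \<in> M\<close> for some \<open>n\<close>. But \<open>u ^ n = 1 - b'/y\<close>
  with \<open>b' \<in> M\<close>, so \<open>y = y * u ^ n + b'\<close> would lie in
  \<open>M\<close>.\<close>

lemma maximal_unit:
  assumes b: "b \<in> M"
  shows "1 - inverse y * b \<noteq> 0" "inverse (1 - inverse y * b) \<in> M"
proof -
  let ?u = "1 - inverse y * b"
  show u0: "?u \<noteq> 0"
  proof
    assume "?u = 0"
    then have "y = b" using maximal_y_nonzero by (simp add: field_simps)
    then show False using yM b by simp
  qed
  have uM: "?u \<in> M" using b zM M by (intro is_subalgebraD(4,5)[OF M] is_subalgebraD(3)[OF M])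
  have pow: "\<exists>b'\<in>M. ?u ^ n = 1 - inverse y * b'" for n
  proof (induction n)
    case 0
    then show ?case using is_subalgebraD(2)[OF M] by (intro bexI[of _ 0]) auto
  next
    case (Suc n)
    then obtain b' where b': "b' \<in> M" "?u ^ n = 1 - inverse y * b'" by blast
    have "?u ^ Suc n = 1 - inverse y * (b + b' - inverse y * b * b')"
      by (simp only: power_Suc b'(2)) (simp add: algebra_simps)
    moreover have "b + b' - inverse y * b * b' \<in> M"
      using b b' zM by (intro is_subalgebraD(4,5,7)[OF M])
    ultimately show ?case by blast
  qed
  show "inverse ?u \<in> M"
  proof (rule ccontr)
    assume "inverse ?u \<notin> M"
    then obtain n a where a: "\<And>i. a i \<in> M" "y = (\<Sum>i\<le>n. a i * inverse ?u ^ i)"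
      using maximal_adjoin by blast
    have "y * ?u ^ n = (\<Sum>i\<le>n. a i * ?u ^ (n - i))"
    proof -
      have "inverse ?u ^ i * ?u ^ n = ?u ^ (n - i)" if "i \<le> n" for i
        using u0 that by (simp add: power_diff field_simps)
      then have "(\<Sum>i\<le>n. a i * inverse ?u ^ i) * ?u ^ n = (\<Sum>i\<le>n. a i * ?u ^ (n - i))"
        by (simp add: sum_distrib_right mult.assoc)
      then show ?thesis using a(2) by simp
    qed
    also have "\<dots> \<in> M" using a uM by (intro is_subalgebra_sum[OF M] is_subalgebraD(5,8)[OF M])
    finally have *: "y * ?u ^ n \<in> M" .
    obtain b' where b': "b' \<in> M" "?u ^ n = 1 - inverse y * b'" using pow by blast
    have "y = y * ?u ^ n + b'" unfolding b'(2) using maximal_y_nonzero by (simp add: algebra_simps)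
    then show False using yM is_subalgebraD(7)[OF M * b'(1)] by simp
  qed
qed

text \<open>In the relation for \<open>inverse f\<close> the term \<open>b 0\<close> is absorbed by
  dividing by the unit \<open>1 - b 0 / y\<close>. The result, multiplied by
  \<open>f ^ n / y\<close>, expresses \<open>f ^ n\<close> through lower powers of \<open>f\<close>;
  the exponents stay nonnegative because \<open>m \<le> n\<close>. Substitution lowers the relation
  for \<open>f\<close>.\<close>

lemma maximal_descent:
  assumes f: "f \<noteq> 0" and a: "\<And>i. a i \<in> M" "y = (\<Sum>i\<le>n. a i * f ^ i)"
    and b: "\<And>i. b i \<in> M" "y = (\<Sum>i\<le>m. b i * inverse f ^ i)" and mn: "m \<le> n"
  shows "n > 0 \<and> (\<exists>a'. (\<forall>i. a' i \<in> M) \<and> y = (\<Sum>i\<le>n - 1. a' i * f ^ i))"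
proof -
  have n0: "n > 0"
  proof (rule ccontr)
    assume "\<not> n > 0"
    then show False using a yM by simp
  qed
  note u = maximal_unit[OF b(1)[of 0]]
  define b' where "b' j = inverse (1 - inverse y * b 0) * b j" for j
  have b'M: "b' j \<in> M" for j using b u by (auto simp: b'_def intro: is_subalgebraD(5)[OF M])
  have "y = b 0 + (\<Sum>j\<in>{1..m}. b j * inverse f ^ j)"
    using b(2) by (simp add: sum.atLeast1_atMost_eq sum.atMost_shift)
  moreover have "y * (1 - inverse y * b 0) = y - b 0"
    using maximal_y_nonzero by (simp add: right_diff_distrib mult.assoc[symmetric])
  ultimately have "y * (1 - inverse y * b 0) = (\<Sum>j\<in>{1..m}. b j * inverse f ^ j)"
    by (metis add_diff_cancel_left')
  then have "y = (\<Sum>j\<in>{1..m}. b' j * inverse f ^ j)"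
    using u(1) unfolding b'_def by (simp add: mult.assoc flip: sum_distrib_left) (simp add: field_simps)
  then have "1 = inverse y * (\<Sum>j\<in>{1..m}. b' j * inverse f ^ j)" using maximal_y_nonzero by simp
  then have "f ^ n = inverse y * (\<Sum>j\<in>{1..m}. b' j * (inverse f ^ j * f ^ n))"
    by (metis (no_types, lifting) mult.assoc mult_1 sum.cong sum_distrib_right)
  also have "(\<Sum>j\<in>{1..m}. b' j * (inverse f ^ j * f ^ n)) = (\<Sum>j\<in>{1..m}. b' j * f ^ (n - j))"
    using f mn by (intro sum.cong) (auto simp: power_diff field_simps)
  also have "\<dots> = (\<Sum>i\<in>{n-m..n-1}. b' (n - i) * f ^ i)"
    using mn n0 by (intro sum.reindex_bij_witness[of _ "\<lambda>i. n - i" "\<lambda>i. n - i"]) auto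
  also have "\<dots> = (\<Sum>i\<le>n-1. (if n - m \<le> i then b' (n - i) else 0) * f ^ i)"
    by (intro sum.mono_neutral_cong_left) auto
  finally have fn: "f ^ n = inverse y * (\<Sum>i\<le>n-1. (if n - m \<le> i then b' (n - i) else 0) * f ^ i)" .
  define a' where "a' i = a i + a n * (inverse y * (if n - m \<le> i then b' (n - i) else 0))" for i
  have "y = (\<Sum>i\<le>n-1. a i * f ^ i) + a n * f ^ n"
    using a(2) n0 by (cases n) auto
  also have "\<dots> = (\<Sum>i\<le>n-1. a' i * f ^ i)"
    unfolding fn a'_def by (simp add: sum_distrib_left sum.distrib algebra_simps)
  finally have "y = (\<Sum>i\<le>n-1. a' i * f ^ i)" .
  moreover have "a' i \<in> M" for i
    unfolding a'_def using a(1) b'M zM is_subalgebraD(2)[OF M]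
    by (intro is_subalgebraD(5,7)[OF M]) auto
  ultimately show ?thesis using n0 by blast
qed

text \<open>If both \<open>f\<close> and its inverse were missing, both would have relations of
  minimal degree, and the one of larger degree could be lowered.\<close>

lemma maximal_valuation_ring:
  assumes f: "f \<notin> M"
  shows "inverse f \<in> M"
proof (rule ccontr)
  assume f': "inverse f \<notin> M"
  have f0: "f \<noteq> 0" using f is_subalgebraD(2)[OF M] by auto
  define R where "R g n \<longleftrightarrow> (\<exists>a. (\<forall>i. a i \<in> M) \<and> y = (\<Sum>i\<le>n. a i * g ^ i))" for g n
  define n where "n = (LEAST n. R f n)"
  define m where "m = (LEAST n. R (inverse f) n)"
  have "\<exists>n. R f n" "\<exists>n. R (inverse f) n" using maximal_adjoin[OF f] maximal_adjoin[OF f'] by (auto simp: R_def)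
  then have nm: "R f n" "R (inverse f) m" unfolding n_def m_def by (auto intro: LeastI_ex)
  have desc: "k > 0 \<and> R g (k - 1)" if g: "g \<noteq> 0" "R g k" "R (inverse g) l" "l \<le> k" for g k l
  proof -
    obtain a where a: "\<And>i. a i \<in> M" "y = (\<Sum>i\<le>k. a i * g ^ i)" using g(2) by (auto simp: R_def)
    obtain b where b: "\<And>i. b i \<in> M" "y = (\<Sum>i\<le>l. b i * inverse g ^ i)" using g(3) by (auto simp: R_def)
    show ?thesis using maximal_descent[OF g(1) a b g(4)] by (simp add: R_def)
  qed
  show False
  proof (cases "m \<le> n")
    case True
    then have "n > 0" "R f (n - 1)" using desc[OF f0 nm] by auto
    then show False using Least_le[of "R f" "n - 1"] by (simp add: n_def[symmetric])
  next
    case False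
    then have "m > 0" "R (inverse f) (m - 1)" using desc[of "inverse f" m n] nm f0 by auto
    then show False using Least_le[of "R (inverse f)" "m - 1"] by (simp add: m_def[symmetric])
  qed
qed

section \<open>The maximal ideal of \<open>M\<close> and its discreteness\<close>

definition nonunits :: "'f set" where
  "nonunits = {f \<in> M. f = 0 \<or> inverse f \<notin> M}"

lemma nonunits_sub: "f \<in> nonunits \<Longrightarrow> f \<in> M"
  by (simp add: nonunits_def)

lemma nonunits_0: "0 \<in> nonunits"
  using is_subalgebraD(2)[OF M] by (simp add: nonunits_def)

lemma nonunitsI: "f \<notin> M \<Longrightarrow> inverse f \<in> nonunits"
  using maximal_valuation_ring[of f] by (simp add: nonunits_def)

lemma nonunits_mult: 
  assumes a: "a \<in> M" and f: "f \<in> nonunits" shows "a * f \<in> nonunits"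
proof -
  have "inverse f \<in> M" if "inverse (a * f) \<in> M" "a \<noteq> 0"
    using is_subalgebraD(5)[OF M a that(1)] that(2) by (simp add: mult.assoc[symmetric])
  then show ?thesis using assms is_subalgebraD(5)[OF M] by (auto simp: nonunits_def)
qed

text \<open>One of the quotients \<open>f / g\<close> and \<open>g / f\<close> lies in
  \<open>M\<close>, so the sum is a multiple in \<open>M\<close> of \<open>g\<close> or of
  \<open>f\<close>.\<close>

lemma nonunits_add:
  assumes "f \<in> nonunits" "g \<in> nonunits" shows "f + g \<in> nonunits"
proof -
  have *: "a + b \<in> nonunits" if "a \<in> nonunits" "b \<in> nonunits" "b \<noteq> 0" "a / b \<in> M" for a b
  proof -
    have "(a / b + 1) * b \<in> nonunits"
      using that is_subalgebraD(3,7)[OF M] by (intro nonunits_mult) auto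
    then show ?thesis using that by (simp add: distrib_right)
  qed
  show ?thesis
  proof (cases "f = 0 \<or> g = 0")
    case True
    then show ?thesis using assms by auto
  next
    case False
    then have "f / g \<in> M \<or> g / f \<in> M" using maximal_valuation_ring[of "f / g"] by auto
    then show ?thesis using *[of f g] *[of g f] False assms by (auto simp: add.commute)
  qed
qed

lemma nonunits_sum: "(\<And>i. i \<in> I \<Longrightarrow> f i \<in> nonunits) \<Longrightarrow> (\<Sum>i\<in>I. f i) \<in> nonunits"
  by (induction I rule: infinite_finite_induct) (auto intro: nonunits_add nonunits_0)

lemma emb_nonunit: "emb c \<in> nonunits \<Longrightarrow> c = 0"
  using is_subalgebraD(1)[OF M, of "inverse c"] by (auto simp: nonunits_def emb_inverse)

lemma nonunits_uminus: "f \<in> nonunits \<Longrightarrow> - f \<in> nonunits"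
  using nonunits_mult[of "- 1" f] is_subalgebraD(3,6)[OF M] by simp

lemma ev_subalgebra: "w \<in> M \<Longrightarrow> ev w p \<in> M"
  by (induction p) (auto simp: ev_pCons intro!: is_subalgebraD[OF M])

text \<open>A strictly increasing chain of principal ideals above \<open>w\<close> is linearly independent over
  \<open>'k(w)\<close>, hence of bounded length.\<close>

lemma nonunit_chain_bounded:
  assumes w: "w \<in> nonunits" "w \<noteq> 0"
  obtains n where "\<And>x r. x 0 = w \<Longrightarrow> (\<And>i. i < r \<Longrightarrow> x i \<in> nonunits \<and> x i \<noteq> 0) \<Longrightarrow>
    (\<And>i j. i < j \<Longrightarrow> j < r \<Longrightarrow> x i / x j \<in> nonunits) \<Longrightarrow> r \<le> (n::nat)"
proof -
  have wk: "w \<notin> range emb" using w emb_nonunit by auto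
  obtain n where n: "\<And>(I :: nat set) z. finite I \<Longrightarrow> n < card I \<Longrightarrow>
    \<exists>c. (\<exists>i\<in>I. coeff (c i) 0 \<noteq> 0) \<and> (\<Sum>i\<in>I. ev w (c i) * z i) = 0"
    using polynomial_dependence[OF wk] by blast
  have "r \<le> n" if x0: "x 0 = w" and xN: "\<And>i. i < r \<Longrightarrow> x i \<in> nonunits \<and> x i \<noteq> 0"
    and ch: "\<And>i j. i < j \<Longrightarrow> j < r \<Longrightarrow> x i / x j \<in> nonunits" for x r
  proof (rule ccontr)
    assume "\<not> r \<le> n"
    then obtain c where c: "\<exists>i<r. coeff (c i) 0 \<noteq> 0" "(\<Sum>i<r. ev w (c i) * x i) = 0"
      using n[of "{..<r}" x] by auto
    \<comment> \<open>After division by \<open>x j\<close> every other term is a nonunit: for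
      \<open>i < j\<close> because \<open>x i / x j\<close> is one, for \<open>i > j\<close> because
      \<open>c i\<close> has no constant term, so a factor \<open>w\<close> splits off, which
      \<open>x j\<close> divides. Then \<open>ev w (c j)\<close> is a nonunit as well, although its
      constant term is not zero.\<close>
    define j where "j = (GREATEST i. i < r \<and> coeff (c i) 0 \<noteq> 0)"
    have j: "j < r" "coeff (c j) 0 \<noteq> 0"
      using GreatestI_ex_nat[of "\<lambda>i. i < r \<and> coeff (c i) 0 \<noteq> 0" r] c(1) unfolding j_def by auto
    have jmax: "coeff (c i) 0 = 0" if "i < r" "i > j" for i
      using Greatest_le_nat[of "\<lambda>i. i < r \<and> coeff (c i) 0 \<noteq> 0" i r] that unfolding j_def by fastforce
    have xj: "x j \<noteq> 0" using xN j by blast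
    have summand: "ev w (c i) * x i / x j \<in> nonunits" if i: "i < r" "i \<noteq> j" for i
    proof (cases "i < j")
      case True
      have "ev w (c i) * (x i / x j) \<in> nonunits"
        using ch[OF True j(1)] w by (intro nonunits_mult ev_subalgebra nonunits_sub)
      then show ?thesis by simp
    next
      case False
      then obtain p where p: "c i = pCons 0 p" using jmax[of i] i by (cases "c i") auto
      have "w / x j \<in> M"
      proof (cases "j = 0")
        case True
        then show ?thesis using x0 w is_subalgebraD(3)[OF M] by simp
      next
        case False
        then show ?thesis using ch[of 0 j] x0 j nonunits_sub by auto
      qed
      then have "(w / x j * ev w p) * x i \<in> nonunits"
        using xN[OF i(1)] w nonunits_sub by (intro nonunits_mult is_subalgebraD(5)[OF M] ev_subalgebra) auto
      then show ?thesis by (simp add: p ev_pCons mult_ac)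
    qed
    have "(\<Sum>i<r. ev w (c i) * x i / x j) = 0" using c(2) by (simp flip: sum_divide_distrib)
    then have "ev w (c j) * x j / x j + (\<Sum>i\<in>{..<r} - {j}. ev w (c i) * x i / x j) = 0"
      using j by (subst (asm) sum.remove[of _ j]) auto
    then have "ev w (c j) = - (\<Sum>i\<in>{..<r} - {j}. ev w (c i) * x i / x j)"
      using xj by (simp add: eq_neg_iff_add_eq_0)
    moreover have "- (\<Sum>i\<in>{..<r} - {j}. ev w (c i) * x i / x j) \<in> nonunits"
      using summand by (intro nonunits_uminus nonunits_sum) auto
    ultimately have evN: "ev w (c j) \<in> nonunits" by simp
    obtain a p where ap: "c j = pCons a p" by (cases "c j")
    have "ev w p * w \<in> nonunits" using w by (intro nonunits_mult ev_subalgebra nonunits_sub)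
    then have "ev w (c j) + - (ev w p * w) \<in> nonunits" using evN by (intro nonunits_add nonunits_uminus)
    then have "emb a \<in> nonunits" by (simp add: ap ev_pCons mult_ac)
    then show False using emb_nonunit j(2) ap by simp
  qed
  then show ?thesis using that by blast
qed

lemma inverse_y_nonunit: "inverse y \<in> nonunits"
  using nonunitsI[OF yM] .

text \<open>If no nonunit \<open>t\<close> divided all others, there would be a nonunit
  \<open>s t\<close> not divisible by \<open>t\<close>, and in a valuation ring
  \<open>t / s t\<close> is then a nonunit. Iterating \<open>s\<close> from \<open>1/y\<close> gives
  a chain longer than \<open>nonunit_chain_bounded\<close> permits.\<close>

lemma exists_nonunit_generator:
  "\<exists>t\<in>nonunits. t \<noteq> 0 \<and> (\<forall>f\<in>nonunits. f / t \<in> M)"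
proof (rule ccontr)
  assume "\<not> ?thesis"
  then have "\<forall>t\<in>nonunits - {0}. \<exists>f. f \<in> nonunits \<and> f / t \<notin> M" by auto
  from bchoice[OF this] obtain s where s: "\<And>t. t \<in> nonunits \<Longrightarrow> t \<noteq> 0 \<Longrightarrow> s t \<in> nonunits \<and> s t / t \<notin> M" by blast
  define x where "x = rec_nat (inverse y) (\<lambda>_. s)"
  have x0: "x 0 = inverse y" and xS: "x (Suc i) = s (x i)" for i by (simp_all add: x_def)
  have xN: "x i \<in> nonunits \<and> x i \<noteq> 0" for i
  proof (induction i)
    case 0
    then show ?case using inverse_y_nonunit maximal_y_nonzero by (simp add: x0)
  next
    case (Suc i)
    then show ?case using s[of "x i"] is_subalgebraD(2)[OF M] by (auto simp: xS)
  qed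
  have step: "x i / x (Suc i) \<in> nonunits" for i
    using s[of "x i"] xN[of i] nonunitsI[of "s (x i) / x i"] by (simp add: xS)
  have ch: "x i / x j \<in> nonunits" if "i < j" for i j
    using that
  proof (induction j)
    case (Suc j)
    show ?case
    proof (cases "i = j")
      case True
      then show ?thesis using step by simp
    next
      case False
      then have "x i / x j * (x j / x (Suc j)) \<in> nonunits"
        using Suc step by (intro nonunits_mult nonunits_sub[of "x i / x j"]) auto
      then show ?thesis using xN[of j] by simp
    qed
  qed simp
  obtain n where "\<And>x r. x 0 = inverse y \<Longrightarrow> (\<And>i. i < r \<Longrightarrow> x i \<in> nonunits \<and> x i \<noteq> 0) \<Longrightarrow>
    (\<And>i j. i < j \<Longrightarrow> j < r \<Longrightarrow> x i / x j \<in> nonunits) \<Longrightarrow> r \<le> (n::nat)"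
    using nonunit_chain_bounded[OF inverse_y_nonunit] maximal_y_nonzero by (metis inverse_nonzero_iff_nonzero)
  from this[of x "Suc n"] x0 xN ch show False by auto
qed

text \<open>With \<open>t\<close> generating the maximal ideal, every nonzero \<open>f\<close> is a
  unit times a power of \<open>t\<close>, and the exponent is the required point. It is positive at
  \<open>1/y\<close>, a nonunit.\<close>

lemma maximal_place: "\<exists>P\<in>places emb. P y < 0"
proof -
  obtain t where t: "t \<in> nonunits" "t \<noteq> 0" "\<And>f. f \<in> nonunits \<Longrightarrow> f / t \<in> M"
    using exists_nonunit_generator by blast
  have tM: "t \<in> M" using t nonunits_sub by blast
  have tpow: "t ^ Suc i \<in> nonunits" for i
    using nonunits_mult[OF is_subalgebraD(8)[OF M tM, of i] t(1)] by (simp add: mult.commute)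
  have notall: "\<exists>n. f / t ^ n \<notin> M" if f: "f \<noteq> 0" for f
  proof (rule ccontr)
    assume "\<not> ?thesis"
    then have all: "f / t ^ n \<in> M" for n by blast
    have fN: "f / t ^ i \<in> nonunits" for i
      using nonunits_mult[OF all[of "Suc i"] t(1)] t(2) by simp
    have "f \<in> nonunits" using fN[of 0] by simp
    then obtain n where n: "\<And>x r. x 0 = f \<Longrightarrow> (\<And>i. i < r \<Longrightarrow> x i \<in> nonunits \<and> x i \<noteq> 0) \<Longrightarrow>
      (\<And>i j. i < j \<Longrightarrow> j < r \<Longrightarrow> x i / x j \<in> nonunits) \<Longrightarrow> r \<le> (n::nat)"
      using nonunit_chain_bounded[OF _ f] by metis
    \<comment> \<open>The chain \<open>f, t ^ n, ..., t\<close>: if every \<open>f / t ^ k\<close>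
      is in \<open>M\<close>, then \<open>f\<close> is properly divisible by all powers of
      \<open>t\<close> and may stand at its beginning.\<close>
    define x where "x i = (if i = 0 then f else t ^ (Suc n - i))" for i
    have "x i \<in> nonunits \<and> x i \<noteq> 0" if "i < Suc n" for i
      using that fN[of 0] f t(2) tpow[of "n - i"] by (auto simp: x_def Suc_diff_le)
    moreover have "x i / x j \<in> nonunits" if "i < j" "j < Suc n" for i j
    proof (cases "i = 0")
      case True
      then show ?thesis using that fN by (simp add: x_def)
    next
      case False
      have "t ^ (Suc n - i) = t ^ (j - i) * t ^ (Suc n - j)" using that by (simp flip: power_add)
      then have "x i / x j = t ^ (j - i)" using that False t(2) by (simp add: x_def)
      moreover have "j - i = Suc (j - i - 1)" using that by simp
      ultimately show ?thesis using tpow[of "j - i - 1"] by simp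
    qed
    ultimately have "Suc n \<le> n" by (intro n[of x]) (auto simp: x_def)
    then show False by simp
  qed
  define unit where "unit u \<longleftrightarrow> u \<noteq> 0 \<and> u \<in> M \<and> inverse u \<in> M" for u
  have unit_mult: "unit u \<Longrightarrow> unit v \<Longrightarrow> unit (u * v)" and unit_inverse: "unit u \<Longrightarrow> unit (inverse u)" for u v
    using is_subalgebraD(5)[OF M] by (auto simp: unit_def)
  have exM: "\<exists>n::nat. unit (f / t ^ n)" if f: "f \<in> M" "f \<noteq> 0" for f
  proof -
    \<comment> \<open>The order of \<open>f\<close> is one less than this:
      \<open>f / t ^ (n - 1)\<close> still lies in \<open>M\<close>, but as a nonunit it would admit
      one more division by \<open>t\<close>.\<close>
    define n where "n = (LEAST n. f / t ^ n \<notin> M)"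
    have n: "f / t ^ n \<notin> M" unfolding n_def using notall[OF f(2)] by (rule LeastI_ex)
    then have n0: "n \<noteq> 0" using f by (intro notI) simp
    then have "n - 1 < n" by simp
    then have n1: "f / t ^ (n - 1) \<in> M" unfolding n_def using not_less_Least by blast
    moreover have "f / t ^ (n - 1) \<notin> nonunits"
    proof
      assume "f / t ^ (n - 1) \<in> nonunits"
      then have "f / t ^ (n - 1) / t \<in> M" by (rule t(3))
      then show False using n n0 by (cases n) (auto simp: mult.commute)
    qed
    ultimately show ?thesis using f t by (intro exI[of _ "n - 1"]) (auto simp: unit_def nonunits_def)
  qed
  have exU: "\<exists>k::int. unit (f * t powi (- k))" if f: "f \<noteq> 0" for f
  proof (cases "f \<in> M")
    case True
    then obtain n where "unit (f / t ^ n)" using exM f by blast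
    then show ?thesis by (intro exI[of _ "int n"]) (simp add: power_int_minus divide_inverse)
  next
    case False
    then obtain n where "unit (inverse f / t ^ n)" using exM[of "inverse f"] maximal_valuation_ring f by auto
    then have "unit (inverse (inverse f / t ^ n))" by (rule unit_inverse)
    then show ?thesis by (intro exI[of _ "- int n"]) (simp add: divide_inverse)
  qed
  have tk: "k \<le> 0" if "unit (t powi k)" for k
  proof (rule ccontr)
    assume "\<not> k \<le> 0"
    then obtain i where "k = int (Suc i)" by (metis Suc_pred linorder_not_le nat_0_le zero_less_nat_eq order_less_imp_le)
    then have "t powi k = t ^ Suc i" by (simp only: power_int_of_nat)
    then have "t powi k \<in> nonunits" using tpow by simp
    then show False using that by (auto simp: unit_def nonunits_def)
  qed
  have tk0: "k = 0" if "unit (t powi k)" for k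
    using tk[OF that] tk[of "- k"] unit_inverse[OF that] by (simp add: power_int_minus)
  have uniq: "k = l" if "unit (f * t powi (- k))" "unit (f * t powi (- l))" for f k l
  proof -
    have "unit (f * t powi (- k) * inverse (f * t powi (- l)))" by (intro unit_mult unit_inverse that)
    moreover have "f * t powi (- k) * inverse (f * t powi (- l)) = t powi (l - k)"
      using that t(2) by (simp add: unit_def power_int_diff power_int_minus field_simps)
    ultimately show ?thesis using tk0[of "l - k"] by simp
  qed
  define v where "v f = (if f = 0 then 0 else THE k. unit (f * t powi (- k)))" for f
  have v: "unit (f * t powi (- v f))" if "f \<noteq> 0" for f
    using theI'[of "\<lambda>k. unit (f * t powi (- k))"] exU[OF that] uniq that unfolding v_def by auto
  have vI: "v f = k" if "unit (f * t powi (- k))" for f k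
    using v[of f] uniq[OF _ that] that by (auto simp: unit_def)
  have vM: "v f \<ge> k" if "f \<noteq> 0" "f * t powi (- k) \<in> M" for f k
  proof (rule ccontr)
    assume "\<not> v f \<ge> k"
    then obtain i where i: "k - v f = int (Suc i)"
      by (metis Suc_pred linorder_not_le nat_0_le zero_less_nat_eq order_less_imp_le diff_gt_0_iff_gt)
    have "t powi (k - v f) * (f * t powi (- k)) = f * t powi (- v f)"
      using t(2) by (simp add: power_int_diff power_int_minus field_simps)
    moreover have "t powi (k - v f) = t ^ Suc i" unfolding i by (simp only: power_int_of_nat)
    ultimately have "f * t powi (- v f) \<in> nonunits"
      using nonunits_mult[OF that(2) tpow[of i]] by (metis mult.commute)
    then show False using v[OF that(1)] by (auto simp: unit_def nonunits_def)
  qed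
  have powM: "t powi k \<in> M" if "k \<ge> 0" for k
    using that is_subalgebraD(8)[OF M tM] by (simp add: power_int_def)
  have vM': "f * t powi (- k) \<in> M" if "f \<noteq> 0" "k \<le> v f" for f k
  proof -
    have "f * t powi (- v f) * t powi (v f - k) \<in> M"
      by (rule is_subalgebraD(5)[OF M]) (use v[OF that(1)] powM that(2) in \<open>auto simp: unit_def\<close>)
    then show ?thesis using t(2) by (simp add: power_int_diff power_int_minus field_simps)
  qed
  have "v \<in> places emb"
    unfolding places_def
  proof (intro CollectI conjI allI impI)
    show "v 0 = 0" by (simp add: v_def)
    show "v (emb c) = 0" for c
    proof (cases "c = 0")
      case False
      then have "unit (emb c * t powi (- 0))"
        using is_subalgebraD(1)[OF M, of c] is_subalgebraD(1)[OF M, of "inverse c"] by (simp add: unit_def emb_inverse)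
      then show ?thesis by (rule vI)
    qed (simp add: v_def)
    show "v (a * b) = v a + v b" if "a \<noteq> 0" "b \<noteq> 0" for a b
    proof (rule vI)
      have "unit ((a * t powi (- v a)) * (b * t powi (- v b)))" using that by (intro unit_mult v)
      then show "unit (a * b * t powi (- (v a + v b)))"
        using t(2) by (simp add: power_int_diff power_int_minus divide_inverse mult_ac)
    qed
    show "min (v a) (v b) \<le> v (a + b)" if "a \<noteq> 0" "b \<noteq> 0" "a + b \<noteq> 0" for a b
    proof (rule vM[OF that(3)])
      show "(a + b) * t powi - min (v a) (v b) \<in> M"
        unfolding distrib_right using that by (intro is_subalgebraD(7)[OF M] vM') auto
    qed
    show "\<exists>s. v s = 1" using t(2) is_subalgebraD(3)[OF M]
      by (intro exI[of _ t] vI) (simp add: unit_def power_int_minus)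
  qed
  moreover have "v (inverse y) \<ge> 1"
    using t(3)[OF inverse_y_nonunit] maximal_y_nonzero by (intro vM) (auto simp: power_int_minus divide_inverse)
  ultimately show ?thesis using place_inverse[of v y] by (intro bexI[of _ v]) auto
qed

end

lemma exists_pole:
  assumes "y \<notin> range emb"
  shows "\<exists>P\<in>places emb. P y < 0"
proof -
  obtain M where "is_subalgebra M" "inverse y \<in> M" "y \<notin> M"
    "\<forall>M'. is_subalgebra M' \<longrightarrow> M \<subseteq> M' \<longrightarrow> y \<notin> M' \<longrightarrow> M' = M"
    using exists_maximal_subalgebra[OF assms] by blast
  then show ?thesis using maximal_place[OF assms] by blast
qed

subsection \<open>The Frobenius map\<close>

lemma CHAR_function_field: "CHAR('f) = CHAR('k)"
proof (rule CHAR_eqI)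
  have of_nat_emb: "of_nat n = emb (of_nat n)" for n
    by (induction n) (auto simp: emb_add emb_1)
  show "of_nat CHAR('k) = (0::'f)" by (simp add: of_nat_emb)
  show "CHAR('k) dvd n" if "of_nat n = (0::'f)" for n
    using that by (simp add: of_nat_emb of_nat_eq_0_iff_char_dvd)
qed

lemma prime_CHAR: "prime CHAR('f)"
  unfolding CHAR_function_field by (intro prime_CHAR_semidom finite_imp_CHAR_pos) simp

lemma CHAR_positive: "CHAR('f) > 0"
  using prime_CHAR prime_gt_0_nat by blast

definition frob :: "'f \<Rightarrow> 'f" where
  "frob a = a ^ CHAR('f)"

lemma frob_add: "frob (a + b) = frob a + frob b"
  unfolding frob_def by (rule freshmans_dream[OF prime_CHAR refl])

lemma frob_sum: "frob (\<Sum>i\<in>I. f i) = (\<Sum>i\<in>I. frob (f i))"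
  unfolding frob_def by (rule freshmans_dream_sum[OF prime_CHAR refl])

lemma frob_mult: "frob (a * b) = frob a * frob b"
  by (simp add: frob_def power_mult_distrib)

lemma frob_0 [simp]: "frob 0 = 0" and frob_1 [simp]: "frob 1 = 1"
  using CHAR_positive by (simp_all add: frob_def)

lemma frob_eq_0_iff [simp]: "frob a = 0 \<longleftrightarrow> a = 0"
  using CHAR_positive by (simp add: frob_def)

lemma frob_uminus: "frob (- a) = - frob a"
  using frob_add[of a "- a"] by (simp add: eq_neg_iff_add_eq_0 add.commute)

lemma frob_diff: "frob (a - b) = frob a - frob b"
  using frob_add[of a "- b"] by (simp add: frob_uminus)

lemma frob_inverse: "frob (inverse a) = inverse (frob a)"
  by (simp add: frob_def power_inverse)

lemma is_subfield_range_frob: "is_subfield (range frob)"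
  unfolding is_subfield_def
  by (auto simp flip: frob_diff frob_mult frob_inverse intro!: rev_image_eqI[of 1])

text \<open>The Frobenius map of the finite field \<open>'k\<close> is injective, hence surjective.
  Polynomials in \<open>x^p\<close> over \<open>'k\<close> thus become p-th powers of polynomials in
  \<open>x\<close>.\<close>

lemma constant_is_frob: "\<exists>d. emb c = frob (emb d)"
proof -
  have "inj (\<lambda>d::'k. d ^ CHAR('k))"
  proof (rule injI)
    fix a b :: 'k assume "a ^ CHAR('k) = b ^ CHAR('k)"
    then have "frob (emb a) = frob (emb b)" by (simp add: frob_def CHAR_function_field flip: emb_power)
    then have "frob (emb a - emb b) = 0" by (simp add: frob_diff)
    then show "a = b" by simp
  qed
  then have "surj (\<lambda>d::'k. d ^ CHAR('k))" by (rule finite_UNIV_inj_surj[OF finite])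
  then obtain d where "c = d ^ CHAR('k)" by (metis surjD)
  then show ?thesis by (intro exI[of _ d]) (simp add: frob_def CHAR_function_field emb_power)
qed

lemma ev_frob: "\<exists>q'. frob (ev x q) = ev (frob x) q'"
proof (induction q)
  case (pCons a q)
  then obtain q' where "frob (ev x q) = ev (frob x) q'" by blast
  then have "frob (ev x (pCons a q)) = ev (frob x) (pCons (a ^ CHAR('f)) q')"
    by (simp add: ev_pCons frob_add frob_mult) (simp add: frob_def emb_power)
  then show ?case by blast
qed (auto intro: exI[of _ 0])

lemma ev_frob_root: "\<exists>q'. ev (frob x) q = frob (ev x q')"
proof (induction q)
  case (pCons a q)
  then obtain q' where q': "ev (frob x) q = frob (ev x q')" by blast
  obtain d where "emb a = frob (emb d)" using constant_is_frob by blast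
  then have "ev (frob x) (pCons a q) = frob (ev x (pCons d q'))"
    using q' by (simp add: ev_pCons frob_add frob_mult)
  then show ?case by blast
qed (auto intro: exI[of _ 0])

lemma exists_nonconstant: "\<exists>x. x \<notin> range emb"
proof -
  obtain x where x: "\<And>p. p \<noteq> 0 \<Longrightarrow> ev x p \<noteq> 0" using function_field_ext by blast
  have "x \<noteq> emb c" for c
    using x[of "[:- c, 1:]"] by (auto simp: ev_pCons emb_1 emb_uminus)
  then show ?thesis by blast
qed

lemma frob_nonconstant:
  assumes "x \<notin> range emb" shows "frob x \<notin> range emb"
proof
  assume "frob x \<in> range emb"
  then obtain c0 where "frob x = emb c0" by blast
  then obtain c where "frob x = frob (emb c)" using constant_is_frob[of c0] by auto
  then have "frob (x - emb c) = 0" by (simp add: frob_diff)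
  then show False using assms by auto
qed

lemma ev_power: "ev y (p ^ n) = ev y p ^ n"
  by (induction n) (auto simp: ev_mult)

text \<open>A fraction \<open>a / b\<close> equals \<open>a * b ^ (p - 1) / b ^ p\<close>, where the
  denominator is a polynomial in \<open>x^p\<close>; the powers of \<open>x\<close> in the numerator
  are reduced modulo \<open>p\<close>.\<close>

lemma rational_subfield_over_frob:
  assumes x: "x \<notin> range emb" and r: "r \<in> rational_subfield emb x"
  shows "\<exists>s. (\<forall>j<CHAR('f). s j \<in> rational_subfield emb (frob x)) \<and> r = (\<Sum>j<CHAR('f). s j * x ^ j)"
proof -
  let ?p = "CHAR('f)" and ?K = "rational_subfield emb (frob x)"
  note x' = frob_nonconstant[OF x]
  note K = is_subfield_rational_subfield[OF x']
  have "x ^ i \<in> power_span ?K x ?p" for i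
  proof -
    have "x ^ (i mod ?p) \<in> power_span ?K x ?p" using CHAR_positive by (intro power_span_base[OF K]) simp
    then have "ev (frob x) (monom 1 (i div ?p)) * x ^ (i mod ?p) \<in> power_span ?K x ?p"
      by (intro power_span_scale[OF K] ev_in_rational_subfield[OF x'])
    moreover have "ev (frob x) (monom 1 (i div ?p)) * x ^ (i mod ?p) = x ^ i"
      by (simp add: ev_monom emb_1 frob_def flip: power_mult power_add)
    ultimately show ?thesis by simp
  qed
  note W_ev = ev_in_power_span[OF x' this]
  obtain a b where ab: "b \<noteq> 0" "r = ev x a / ev x b" using r mem_rational_subfield_iff[OF x] by blast
  have b0: "ev x b \<noteq> 0" using ab ev_eq_0_iff[OF x] by simp
  obtain q' where q': "frob (ev x b) = ev (frob x) q'" using ev_frob by blast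
  have "frob (ev x b) = ev x b * ev x b ^ (?p - 1)"
    unfolding frob_def using CHAR_positive by (simp add: power_eq_if)
  then have "r = inverse (frob (ev x b)) * (ev x a * ev x b ^ (?p - 1))"
    using ab b0 by (simp add: field_simps)
  also have "ev x b ^ (?p - 1) = ev x (b ^ (?p - 1))" by (rule ev_power[symmetric])
  finally have "r = inverse (ev (frob x) q') * ev x (a * b ^ (?p - 1))"
    by (simp add: ev_mult q')
  also have "\<dots> \<in> power_span ?K x ?p"
    by (intro power_span_scale[OF K] W_ev is_subfieldD(5)[OF K] ev_in_rational_subfield[OF x'])
  finally show ?thesis by (simp add: power_span_def)
qed

text \<open>Write \<open>F\<close> for the function field. Both towers
  \<open>'k(x^p) \<subseteq> 'k(x) \<subseteq> F\<close> and
  \<open>'k(x^p) \<subseteq> F^p \<subseteq> F\<close> are compared. Frobenius carries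
  \<open>F\<close> over \<open>'k(x)\<close> to \<open>F^p\<close> over \<open>'k(x^p)\<close>, so
  those degrees agree, and what remains is the degree \<open>p\<close> of \<open>'k(x)\<close> over
  \<open>'k(x^p)\<close>.\<close>

lemma frob_degree_le:
  assumes Z: "indep_over (range frob) Z"
  shows "card Z \<le> CHAR('f)"
proof (rule ccontr)
  let ?p = "CHAR('f)"
  assume "\<not> card Z \<le> ?p"
  then have cZ: "card Z > ?p" by simp
  obtain x where x: "x \<notin> range emb" using exists_nonconstant by blast
  let ?L = "rational_subfield emb x" and ?K = "rational_subfield emb (frob x)"
  note x' = frob_nonconstant[OF x]
  note K = is_subfield_rational_subfield[OF x']
  obtain U where U: "indep_over ?L U" "spans_over ?L U" using finite_over_rational_subfield[OF x] by blast
  have fin: "finite U" "finite Z" using U Z by (auto simp: indep_over_def)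
  have "U \<noteq> {}"
  proof
    assume "U = {}"
    then have "\<And>f::'f. f = 0" using U(2) by (auto simp: spans_over_def)
    then show False using one_neq_zero by blast
  qed
  then have card: "card (U \<times> {..<?p}) < card (U \<times> Z)"
    using cZ fin by (simp add: card_cartesian_product card_gt_0_iff)
  have coord: "\<exists>c. (\<forall>u\<in>U. \<forall>j<?p. c (u, j) \<in> ?K) \<and> f = (\<Sum>u\<in>U. \<Sum>j<?p. c (u, j) * (x ^ j * u))" for f
  proof -
    obtain r where r: "\<forall>u\<in>U. r u \<in> ?L" "f = (\<Sum>u\<in>U. r u * u)" using U(2) unfolding spans_over_def by blast
    have "\<forall>u\<in>U. \<exists>s. (\<forall>j<?p. s j \<in> ?K) \<and> r u = (\<Sum>j<?p. s j * x ^ j)"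
      using r rational_subfield_over_frob[OF x] by blast
    from bchoice[OF this] obtain s where s: "\<forall>u\<in>U. (\<forall>j<?p. s u j \<in> ?K) \<and> r u = (\<Sum>j<?p. s u j * x ^ j)"
      by blast
    have "f = (\<Sum>u\<in>U. \<Sum>j<?p. s u j * (x ^ j * u))"
      unfolding r(2) using s by (intro sum.cong) (auto simp: sum_distrib_right mult.assoc)
    then show ?thesis using s by (intro exI[of _ "\<lambda>(u, j). s u j"]) auto
  qed
  then have "\<forall>f. \<exists>c. (\<forall>u\<in>U. \<forall>j<?p. c (u, j) \<in> ?K) \<and> f = (\<Sum>u\<in>U. \<Sum>j<?p. c (u, j) * (x ^ j * u))" by blast
  from choice[OF this] obtain c where c: "\<And>f u j. u \<in> U \<Longrightarrow> j < ?p \<Longrightarrow> c f (u, j) \<in> ?K"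
    "\<And>f. f = (\<Sum>u\<in>U. \<Sum>j<?p. c f (u, j) * (x ^ j * u))" by blast
  \<comment> \<open>The products \<open>frob u * z\<close> number \<open>card U * card Z\<close>,
    more than the \<open>card U * p\<close> elements spanning over \<open>'k(x^p)\<close>; hence
    they are dependent.\<close>
  let ?e = "\<lambda>i. frob (fst i) * snd i"
  have cK: "c (?e i) s \<in> ?K" if "i \<in> U \<times> Z" "s \<in> U \<times> {..<?p}" for i s
    using that c(1) by auto
  obtain d where d: "\<forall>i\<in>U \<times> Z. d i \<in> ?K" "\<exists>i\<in>U \<times> Z. d i \<noteq> 0"
    "\<forall>s\<in>U \<times> {..<?p}. (\<Sum>i\<in>U \<times> Z. d i * c (?e i) s) = 0"
    using homogeneous_system_nontrivial[where c="\<lambda>i. c (?e i)",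
        OF K finite_cartesian_product[OF fin(1) finite_lessThan] finite_cartesian_product[OF fin] card cK] by blast
  have "(\<Sum>i\<in>U \<times> Z. d i * ?e i)
      = (\<Sum>i\<in>U \<times> Z. \<Sum>s\<in>U \<times> {..<?p}. d i * c (?e i) s * (x ^ snd s * fst s))"
    by (subst c(2)) (simp add: sum_distrib_left sum.cartesian_product split_beta mult.assoc)
  also have "\<dots> = (\<Sum>s\<in>U \<times> {..<?p}. (\<Sum>i\<in>U \<times> Z. d i * c (?e i) s) * (x ^ snd s * fst s))"
    by (subst sum.swap) (simp add: sum_distrib_right)
  also have "\<dots> = 0" using d(3) by (intro sum.neutral) auto
  finally have rel: "(\<Sum>i\<in>U \<times> Z. d i * ?e i) = 0" .
  obtain q b where qb: "q \<noteq> 0" "\<forall>i\<in>U \<times> Z. ev (frob x) q * d i = ev (frob x) (b i)"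
    using clear_denominators[OF x' finite_cartesian_product[OF fin], of d] d(1) by auto
  \<comment> \<open>The cleared coefficients are p-th powers. Grouped by \<open>z\<close>, the
    relation is one over \<open>F^p\<close> among the elements of \<open>Z\<close>, and extracting
    p-th roots leaves, for each \<open>z\<close>, a relation over \<open>'k(x)\<close> among the
    elements of \<open>U\<close>.\<close>
  have "\<forall>i. \<exists>q'. ev (frob x) (b i) = frob (ev x q')" using ev_frob_root by blast
  from choice[OF this] obtain r where r: "\<And>i. ev (frob x) (b i) = frob (ev x (r i))" by blast
  have "0 = ev (frob x) q * (\<Sum>i\<in>U \<times> Z. d i * ?e i)" using rel by simp
  also have "\<dots> = (\<Sum>i\<in>U \<times> Z. frob (ev x (r i)) * ?e i)"
    unfolding sum_distrib_left using qb(2) r by (intro sum.cong) (auto simp: mult.assoc[symmetric])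
  also have "\<dots> = (\<Sum>z\<in>Z. \<Sum>u\<in>U. frob (ev x (r (u, z))) * (frob u * z))"
    by (subst sum.swap) (simp add: sum.cartesian_product split_beta)
  also have "\<dots> = (\<Sum>z\<in>Z. frob (\<Sum>u\<in>U. ev x (r (u, z)) * u) * z)"
    by (simp add: frob_sum frob_mult sum_distrib_right mult.assoc)
  finally have 0: "(\<Sum>z\<in>Z. frob (\<Sum>u\<in>U. ev x (r (u, z)) * u) * z) = 0" by simp
  have "frob (\<Sum>u\<in>U. ev x (r (u, z)) * u) = 0" if "z \<in> Z" for z
    by (rule indep_overD[OF Z _ 0 that]) simp
  then have 1: "(\<Sum>u\<in>U. ev x (r (u, z)) * u) = 0" if "z \<in> Z" for z using that by simp
  have "ev x (r (u, z)) = 0" if "z \<in> Z" "u \<in> U" for u z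
    by (rule indep_overD[OF U(1) ev_in_rational_subfield[OF x] 1[OF that(1)] that(2)])
  then have "d i = 0" if "i \<in> U \<times> Z" for i
  proof -
    have "ev x (r i) = 0" using that \<open>\<And>z u. z \<in> Z \<Longrightarrow> u \<in> U \<Longrightarrow> ev x (r (u, z)) = 0\<close> by (cases i) auto
    then have "ev (frob x) q * d i = 0" using bspec[OF qb(2) that] r[of i] by simp
    then show ?thesis using qb(1) ev_eq_0_iff[OF x'] by simp
  qed
  then show False using d(2) by blast
qed

subsection \<open>Expansion in powers of a uniformizer over the \<open>p\<close>-th powers\<close>

context
  fixes Q t
  assumes Q: "Q \<in> places emb" and t: "Q t = 1"
begin

lemma local_parameter_nonzero: "t \<noteq> 0"
  using t place_0[OF Q] by auto

text \<open>The nonzero terms have pairwise distinct values, as these are distinct modulo \<open>p\<close>.\<close>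

lemma frob_expansion_ball:
  assumes f: "(\<Sum>i<CHAR('f). frob (a i) * t ^ i) \<in> ball Q n" and i: "i < CHAR('f)"
  shows "frob (a i) * t ^ i \<in> ball Q n"
proof (cases "a i = 0")
  case False
  let ?p = "CHAR('f)"
  let ?I = "{i. i < ?p \<and> a i \<noteq> 0}"
  let ?m = "\<lambda>i. frob (a i) * t ^ i"
  have v: "Q (?m i) = int ?p * Q (a i) + int i" if "a i \<noteq> 0" for i
    using that local_parameter_nonzero t
    by (simp add: place_mult[OF Q] place_power[OF Q]) (simp add: frob_def place_power[OF Q])
  have inj: "i = j" if "i < ?p" "a i \<noteq> 0" "j < ?p" "a j \<noteq> 0" "Q (?m i) = Q (?m j)" for i j
  proof -
    have "(int ?p * Q (a i) + int i) mod int ?p = (int ?p * Q (a j) + int j) mod int ?p"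
      using that v by simp
    then show ?thesis using that by simp
  qed
  have "finite ?I" "i \<in> ?I" using i False by auto
  then obtain j where "is_arg_min (\<lambda>i. Q (?m i)) (\<lambda>i. i \<in> ?I) j"
    using ex_is_arg_min_if_finite[of ?I "\<lambda>i. Q (?m i)"] by blast
  then have j: "j \<in> ?I" "\<And>i. i \<in> ?I \<Longrightarrow> Q (?m j) \<le> Q (?m i)"
    unfolding is_arg_min_linorder by blast+
  have "?m k \<in> ball Q (Q (?m j) + 1)" if k: "k \<in> {..<?p}" "k \<noteq> j" for k
  proof (cases "a k = 0")
    case False
    then have "Q (?m j) \<le> Q (?m k)" "Q (?m j) \<noteq> Q (?m k)" using j k inj[of k j] by auto
    then show ?thesis by (intro mem_ballI) linarith
  qed simp
  with place_sum_dominant[OF Q, of "{..<?p}" j ?m] j local_parameter_nonzero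
  have "(\<Sum>i<?p. ?m i) \<noteq> 0" "Q (\<Sum>i<?p. ?m i) = Q (?m j)" by auto
  then have "n \<le> Q (?m j)" using f mem_ballD by metis
  then show ?thesis using j(2)[of i] \<open>i \<in> ?I\<close> by (intro mem_ballI) linarith
qed simp

text \<open>A vanishing sum lies in every ball, in particular in the one just too small for its
  \<open>i\<close>-th term.\<close>

lemma frob_expansion_zero:
  assumes "(\<Sum>i<CHAR('f). frob (a i) * t ^ i) = 0" and i: "i < CHAR('f)"
  shows "a i = 0"
proof (rule ccontr)
  assume "a i \<noteq> 0"
  then have "frob (a i) * t ^ i \<noteq> 0" using local_parameter_nonzero by simp
  moreover have "frob (a i) * t ^ i \<in> ball Q (Q (frob (a i) * t ^ i) + 1)"
    using assms by (intro frob_expansion_ball) auto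
  ultimately show False using mem_ballD by fastforce
qed

text \<open>The \<open>p + 1\<close> elements \<open>1, t, ..., t ^ (p - 1), f\<close> are dependent
  over the p-th powers, and \<open>f\<close> must occur in the relation because the powers of
  \<open>t\<close> are independent.\<close>

lemma frob_expansion_exists: "\<exists>a. f = (\<Sum>i<CHAR('f). frob (a i) * t ^ i)"
proof -
  let ?p = "CHAR('f)"
  obtain U where U: "indep_over (range frob) U" "spans_over (range frob) U"
    using basis_over_exists[OF is_subfield_range_frob frob_degree_le] by blast
  have "card U < card {..?p}" using frob_degree_le[OF U(1)] by simp
  from spans_over_dependence[OF is_subfield_range_frob U(2) _ this, of "\<lambda>i. if i < ?p then t ^ i else f"]
  obtain d where d: "\<forall>i\<in>{..?p}. d i \<in> range frob" "\<exists>i\<in>{..?p}. d i \<noteq> 0"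
    "(\<Sum>i\<le>?p. d i * (if i < ?p then t ^ i else f)) = 0" by blast
  have "\<forall>i\<in>{..?p}. \<exists>b. d i = frob b" using d(1) by blast
  from bchoice[OF this] obtain b where b: "\<And>i. i \<le> ?p \<Longrightarrow> d i = frob (b i)" by auto
  have "(\<Sum>i\<le>?p. d i * (if i < ?p then t ^ i else f)) = (\<Sum>i<?p. frob (b i) * t ^ i) + frob (b ?p) * f"
    by (simp add: b flip: lessThan_Suc_atMost)
  then have s: "(\<Sum>i<?p. frob (b i) * t ^ i) + frob (b ?p) * f = 0" using d(3) by simp
  have "b ?p \<noteq> 0"
  proof
    assume p0: "b ?p = 0"
    have "b i = 0" if "i < ?p" for i
      by (rule frob_expansion_zero[of b]) (use s p0 that in auto)
    then have "d i = 0" if "i \<le> ?p" for i using b[OF that] p0 that by (cases "i = ?p") auto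
    then show False using d(2) by auto
  qed
  define a where "a i = - b i / b ?p" for i
  have "frob (b ?p) * (\<Sum>i<?p. frob (a i) * t ^ i) = (\<Sum>i<?p. - (frob (b i) * t ^ i))"
    unfolding sum_distrib_left
  proof (rule sum.cong)
    fix i
    have "frob (b ?p) * frob (a i) = - frob (b i)"
      unfolding a_def frob_mult[symmetric] using \<open>b ?p \<noteq> 0\<close> by (simp add: frob_uminus)
    then show "frob (b ?p) * (frob (a i) * t ^ i) = - (frob (b i) * t ^ i)"
      by (simp add: mult.assoc[symmetric])
  qed simp
  also have "\<dots> = frob (b ?p) * f" using s by (simp add: sum_negf minus_unique)
  finally have "f = (\<Sum>i<?p. frob (a i) * t ^ i)" using \<open>b ?p \<noteq> 0\<close> by simp
  then show ?thesis by blast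
qed

end

subsection \<open>Derivations\<close>

lemma derivation_power:
  assumes "\<delta> \<in> derivations emb"
  shows "\<delta> (a ^ n) = of_nat n * a ^ (n - 1) * \<delta> a"
proof (induction n)
  case 0
  have "\<delta> (emb 1) = 0" using assms unfolding derivations_def by blast
  then show ?case by (simp add: emb_1)
next
  case (Suc n)
  have "\<delta> (a * a ^ n) = a * \<delta> (a ^ n) + a ^ n * \<delta> a" using assms by (simp add: derivations_def)
  then show ?case using Suc by (cases n) (auto simp: algebra_simps)
qed

lemma derivation_frob:
  assumes "\<delta> \<in> derivations emb" shows "\<delta> (frob a) = 0"
  unfolding frob_def derivation_power[OF assms] by simp

lemma derivation_sum:
  assumes d: "\<delta> \<in> derivations emb" shows "\<delta> (\<Sum>i\<in>I. f i) = (\<Sum>i\<in>I. \<delta> (f i))"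
proof -
  have "\<delta> 0 = 0" using derivation_frob[OF d, of 0] by simp
  then show ?thesis using d by (induction I rule: infinite_finite_induct) (auto simp: derivations_def)
qed

text \<open>Derivations kill p-th powers and so are linear over them; the value at \<open>t\<close>
  determines everything.\<close>

lemma derivation_expansion:
  assumes d: "\<delta> \<in> derivations emb" and f: "f = (\<Sum>i<CHAR('f). frob (a i) * t ^ i)"
  shows "\<delta> f = (\<Sum>i<CHAR('f). frob (a i) * (of_nat i * t ^ (i - 1))) * \<delta> t"
proof -
  have "\<delta> (frob b * t ^ i) = frob b * (of_nat i * t ^ (i - 1)) * \<delta> t" for b i
    using d derivation_frob[OF d, of b] derivation_power[OF d, of t i] by (simp add: derivations_def)
  then show ?thesis unfolding f by (simp add: derivation_sum[OF d] sum_distrib_right)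
qed

section \<open>The derivation \<open>d/dt\<close>\<close>

definition frob_poly :: "'f poly \<Rightarrow> 'f poly" where
  "frob_poly = map_poly frob"

lemma frob_poly_add: "frob_poly (a + b) = frob_poly a + frob_poly b"
  by (intro poly_eqI) (simp add: frob_poly_def coeff_map_poly frob_add)

lemma frob_poly_diff: "frob_poly (a - b) = frob_poly a - frob_poly b"
  by (intro poly_eqI) (simp add: frob_poly_def coeff_map_poly frob_diff)

lemma frob_poly_mult: "frob_poly (a * b) = frob_poly a * frob_poly b"
  by (intro poly_eqI) (simp add: frob_poly_def coeff_map_poly coeff_mult frob_sum frob_mult)

text \<open>Elements of the function field are values at \<open>t\<close> of polynomials over the \<open>p\<close>-th powers; the
  derivation \<open>d/dt\<close> is induced by the formal derivative of these polynomials.\<close>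

definition param_deriv :: "'f \<Rightarrow> 'f \<Rightarrow> 'f" where
  "param_deriv t f = poly (pderiv (frob_poly (SOME a. poly (frob_poly a) t = f))) t"

context
  fixes Q t
  assumes Q: "Q \<in> places emb" and t: "Q t = 1"
begin

lemma poly_frob_poly_expansion:
  assumes "degree a < CHAR('f)"
  shows "poly (frob_poly a) t = (\<Sum>i<CHAR('f). frob (coeff a i) * t ^ i)"
proof -
  have "degree (frob_poly a) < CHAR('f)"
    using assms map_poly_degree_leq[of frob a] by (simp add: frob_poly_def)
  then have "poly (frob_poly a) t = (\<Sum>i<CHAR('f). coeff (frob_poly a) i * t ^ i)"
    unfolding poly_altdef by (intro sum.mono_neutral_left) (auto simp: coeff_eq_0)
  then show ?thesis by (simp add: frob_poly_def coeff_map_poly)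
qed

text \<open>This makes \<open>d/dt\<close> independent of the polynomial chosen: one that vanishes
  at \<open>t\<close> is a multiple of \<open>X^p - t^p\<close>, whose formal derivative is
  zero.\<close>

lemma pderiv_frob_poly_root:
  assumes "poly (frob_poly a) t = 0"
  shows "poly (pderiv (frob_poly a)) t = 0"
proof -
  let ?p = "CHAR('f)"
  \<comment> \<open>\<open>X^p - t\<close>, whose image under \<open>frob_poly\<close> is
    \<open>X^p - t^p\<close>. Division by \<open>m\<close> before applying \<open>frob_poly\<close>
    keeps the remainder a polynomial over the p-th powers.\<close>
  define m where "m = monom 1 ?p - [:t:]"
  have p0: "?p > 0" by (rule CHAR_positive)
  have m: "m \<noteq> 0" "degree m = ?p"
  proof -
    show d: "degree m = ?p" unfolding m_def diff_conv_add_uminus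
      using degree_add_eq_left[of "- [:t:]" "monom 1 ?p"] by (simp add: degree_monom_eq p0)
    show "m \<noteq> 0" using d p0 by auto
  qed
  have fm: "frob_poly m = monom 1 ?p - [:frob t:]"
    unfolding m_def frob_poly_diff by (simp add: frob_poly_def map_poly_monom map_poly_pCons)
  have fm0: "poly (frob_poly m) t = 0" unfolding fm by (simp add: poly_monom frob_def)
  have dm: "pderiv (frob_poly m) = 0" unfolding fm
    by (simp add: pderiv_diff pderiv_monom pderiv_pCons)
  have dec: "frob_poly a = frob_poly (a div m) * frob_poly m + frob_poly (a mod m)"
    by (simp flip: frob_poly_mult frob_poly_add)
  have "poly (frob_poly (a mod m)) t = 0" using assms dec fm0 by simp
  moreover have deg: "degree (a mod m) < ?p"
    using degree_mod_less[OF m(1), of a] m(2) p0 by auto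
  ultimately have "coeff (a mod m) i = 0" if "i < ?p" for i
    using frob_expansion_zero[OF Q t _ that, of "coeff (a mod m)"] poly_frob_poly_expansion by simp
  then have "a mod m = 0"
    using deg by (metis leading_coeff_0_iff)
  then have "frob_poly a = frob_poly (a div m) * frob_poly m" using dec by (simp add: frob_poly_def)
  then show ?thesis by (simp add: pderiv_mult dm fm0)
qed

lemma param_deriv_eqI:
  assumes "poly (frob_poly a) t = f"
  shows "param_deriv t f = poly (pderiv (frob_poly a)) t"
proof -
  define b where "b = (SOME a. poly (frob_poly a) t = f)"
  have "poly (frob_poly b) t = f" unfolding b_def using assms by (rule someI)
  then have "poly (frob_poly (b - a)) t = 0" using assms by (simp add: frob_poly_diff)
  from pderiv_frob_poly_root[OF this] show ?thesis
    by (simp add: param_deriv_def b_def[symmetric] frob_poly_diff pderiv_diff)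
qed

lemma frob_poly_value: "\<exists>a. poly (frob_poly a) t = f"
proof -
  obtain a where a: "f = (\<Sum>i<CHAR('f). frob (a i) * t ^ i)" using frob_expansion_exists[OF Q t] by blast
  define b where "b = (\<Sum>i<CHAR('f). monom (a i) i)"
  have "frob_poly b = (\<Sum>i<CHAR('f). monom (frob (a i)) i)"
    by (intro poly_eqI) (auto simp: b_def frob_poly_def coeff_map_poly coeff_sum)
  then have "poly (frob_poly b) t = f" by (simp add: a poly_sum poly_monom)
  then show ?thesis by blast
qed

lemma param_deriv_derivation: "param_deriv t \<in> derivations emb"
  unfolding derivations_def
proof (intro CollectI conjI allI)
  fix f g
  obtain a b where ab: "poly (frob_poly a) t = f" "poly (frob_poly b) t = g" using frob_poly_value by blast
  have "param_deriv t (f + g) = poly (pderiv (frob_poly (a + b))) t"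
    by (rule param_deriv_eqI) (simp add: frob_poly_add ab)
  then show "param_deriv t (f + g) = param_deriv t f + param_deriv t g"
    by (simp add: frob_poly_add pderiv_add param_deriv_eqI[OF ab(1)] param_deriv_eqI[OF ab(2)])
  have "param_deriv t (f * g) = poly (pderiv (frob_poly (a * b))) t"
    by (rule param_deriv_eqI) (simp add: frob_poly_mult ab)
  then show "param_deriv t (f * g) = f * param_deriv t g + g * param_deriv t f"
    by (simp add: frob_poly_mult pderiv_mult ab param_deriv_eqI[OF ab(1)] param_deriv_eqI[OF ab(2)])
next
  fix c
  obtain d where d: "emb c = frob (emb d)" using constant_is_frob by blast
  have *: "frob_poly [:emb d:] = [:emb c:]" by (simp add: frob_poly_def map_poly_pCons d)
  have "param_deriv t (emb c) = poly (pderiv (frob_poly [:emb d:])) t"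
    by (rule param_deriv_eqI) (simp add: *)
  then show "param_deriv t (emb c) = 0" by (simp add: * pderiv_pCons)
qed

lemma param_deriv_self: "param_deriv t t = 1"
proof -
  have *: "frob_poly [:0, 1:] = [:0, 1:]" by (simp add: frob_poly_def map_poly_pCons)
  have "param_deriv t t = poly (pderiv (frob_poly [:0, 1:])) t" by (rule param_deriv_eqI) (simp add: *)
  then show ?thesis by (simp add: * pderiv_pCons)
qed

lemma derivation_eq_param_deriv:
  assumes d: "\<delta> \<in> derivations emb"
  shows "\<delta> f = \<delta> t * param_deriv t f"
proof -
  obtain a where a: "f = (\<Sum>i<CHAR('f). frob (a i) * t ^ i)" using frob_expansion_exists[OF Q t] by blast
  show ?thesis
    using derivation_expansion[OF d a] derivation_expansion[OF param_deriv_derivation a]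
    by (simp add: param_deriv_self mult.commute)
qed

text \<open>Each term \<open>frob (a i) * t ^ i\<close> of an integral \<open>f\<close> is integral.
  Its value is \<open>p * Q (a i) + i\<close> with \<open>i < p\<close>, so already
  \<open>a i\<close> is integral, and termwise differentiation creates no pole.\<close>

lemma param_deriv_ball:
  assumes f: "f \<in> ball Q 0" shows "param_deriv t f \<in> ball Q 0"
proof -
  let ?p = "CHAR('f)"
  obtain a where a: "f = (\<Sum>i<?p. frob (a i) * t ^ i)" using frob_expansion_exists[OF Q t] by blast
  have tb: "t \<in> ball Q 0" using t by (intro mem_ballI) simp
  have nb: "of_nat n \<in> ball Q 0" for n
    by (induction n) (auto intro: ball_add[OF Q] ball_1[OF Q])
  have "frob (a i) \<in> ball Q 0" if i: "i < ?p" for i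
  proof (cases "a i = 0")
    case False
    have "frob (a i) * t ^ i \<in> ball Q 0" using f a i by (intro frob_expansion_ball[OF Q t]) auto
    then have "0 \<le> Q (frob (a i) * t ^ i)"
      using False local_parameter_nonzero[OF Q t] by (intro mem_ballD) auto
    also have "\<dots> = int ?p * Q (a i) + int i"
      using False local_parameter_nonzero[OF Q t] t
      by (simp add: place_mult[OF Q] place_power[OF Q]) (simp add: frob_def place_power[OF Q])
    finally have "int ?p * (- 1) < int ?p * Q (a i)" using i by linarith
    then have "- 1 < Q (a i)" using CHAR_positive by (simp only: mult_less_cancel_left_pos of_nat_0_less_iff)
    then show ?thesis by (intro mem_ballI) (simp add: frob_def place_power[OF Q])
  qed simp
  then have "frob (a i) * (of_nat i * t ^ (i - 1)) \<in> ball Q 0" if "i < ?p" for i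
    using that ball_mult[OF Q, of _ 0 _ 0] nb ball_power[OF Q tb] by simp
  then show ?thesis
    unfolding derivation_expansion[OF param_deriv_derivation a] param_deriv_self
    using ball_sum[OF Q, of "{..<?p}" "\<lambda>i. frob (a i) * (of_nat i * t ^ (i - 1))" 0] by simp
qed

end

text \<open>\<open>dt/ds\<close> and \<open>ds/dt\<close> are integral and inverse to each
  other.\<close>

lemma param_deriv_unit:
  assumes Q: "Q \<in> places emb" and s: "Q s = 1" and t: "Q t = 1"
  shows "param_deriv s t \<noteq> 0" "Q (param_deriv s t) = 0"
proof -
  have "param_deriv s t * param_deriv t s = 1"
    using derivation_eq_param_deriv[OF Q t param_deriv_derivation[OF Q s], of s] param_deriv_self[OF Q s] by simp
  moreover from this have nz: "param_deriv s t \<noteq> 0" "param_deriv t s \<noteq> 0" by auto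
  moreover have "param_deriv s t \<in> ball Q 0" "param_deriv t s \<in> ball Q 0"
    by (rule param_deriv_ball[OF Q s], rule mem_ballI, simp add: t)
      (rule param_deriv_ball[OF Q t], rule mem_ballI, simp add: s)
  ultimately show "param_deriv s t \<noteq> 0" "Q (param_deriv s t) = 0"
    using place_mult[OF Q nz] place_1[OF Q]
      mem_ballD[of "param_deriv s t" Q 0] mem_ballD[of "param_deriv t s" Q 0]
    by auto
qed

subsection \<open>Differentials\<close>

lemma diff_eq_dscale:
  assumes Q: "Q \<in> places emb" and t: "Q t = 1"
  shows "Defs.diff emb g = dscale (param_deriv t g) (Defs.diff emb t)"
  using derivation_eq_param_deriv[OF Q t, of _ g] by (auto simp: diff_def dscale_def fun_eq_iff mult.commute)

lemma dscale_diff_cancel: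
  assumes Q: "Q \<in> places emb" and t: "Q t = 1"
  shows "dscale h (Defs.diff emb t) = dscale h' (Defs.diff emb t) \<longleftrightarrow> h = h'"
proof
  assume "dscale h (Defs.diff emb t) = dscale h' (Defs.diff emb t)"
  then have "dscale h (Defs.diff emb t) (param_deriv t) = dscale h' (Defs.diff emb t) (param_deriv t)" by simp
  then show "h = h'" 
    using param_deriv_derivation[OF Q t] param_deriv_self[OF Q t] by (simp add: dscale_def diff_def)
qed simp

lemma differentials_iff:
  assumes Q: "Q \<in> places emb" and t: "Q t = 1"
  shows "\<omega> \<in> differentials emb \<longleftrightarrow> (\<exists>h. \<omega> = dscale h (Defs.diff emb t))"
proof -
  interpret dv: vector_space dscale by (rule vector_space_dscale)
  show ?thesis
  proof
    assume "\<omega> \<in> differentials emb"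
    then have "\<omega> \<in> dv.span (range (Defs.diff emb))" by (simp add: differentials_def)
    then show "\<exists>h. \<omega> = dscale h (Defs.diff emb t)"
    proof (induction rule: dv.span_induct_alt)
      case base
      show ?case by (intro exI[of _ 0]) (simp add: dscale_def fun_eq_iff)
    next
      case (step c x y)
      then obtain g h where "x = Defs.diff emb g" "y = dscale h (Defs.diff emb t)" by blast
      then have "dscale c x + y = dscale (c * param_deriv t g + h) (Defs.diff emb t)"
        using diff_eq_dscale[OF Q t, of g] by (simp add: dscale_def fun_eq_iff algebra_simps)
      then show ?case by blast
    qed
  next
    assume "\<exists>h. \<omega> = dscale h (Defs.diff emb t)"
    then show "\<omega> \<in> differentials emb"
      unfolding differentials_def using dv.span_scale[OF dv.span_base] by blast
  qed
qed

text \<open>The chain rule \<open>h dt = h (dt/du) du\<close> for the uniformizer \<open>u\<close>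
  chosen at \<open>P\<close>.\<close>

lemma local_coeff_dscale_diff:
  assumes P: "P \<in> places emb" and Q: "Q \<in> places emb" and t: "Q t = 1"
  shows "local_coeff emb P (dscale h (Defs.diff emb t)) = h * param_deriv (uniformizer P) t"
  unfolding local_coeff_def
proof (rule the_equality)
  note u = uniformizer[OF P]
  have *: "dscale h (Defs.diff emb t) = dscale (h * param_deriv (uniformizer P) t) (Defs.diff emb (uniformizer P))"
    by (subst diff_eq_dscale[OF P u, of t]) (simp add: dscale_def fun_eq_iff)
  show "dscale h (Defs.diff emb t) = dscale (h * param_deriv (uniformizer P) t) (Defs.diff emb (uniformizer P))"
    by (rule *)
  show "h' = h * param_deriv (uniformizer P) t"
    if "dscale h (Defs.diff emb t) = dscale h' (Defs.diff emb (uniformizer P))" for h'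
    using that unfolding * dscale_diff_cancel[OF P u] by simp
qed

end

subsection \<open>Traces of operators of finite rank\<close>

locale operator_trace = vector_space scale
  for scale :: "'a::field \<Rightarrow> 'b::ab_group_add \<Rightarrow> 'b"
begin

abbreviation lin :: "('b \<Rightarrow> 'b) \<Rightarrow> bool" where
  "lin \<equiv> Vector_Spaces.linear scale scale"

definition finite_rank :: "('b \<Rightarrow> 'b) \<Rightarrow> bool" where
  "finite_rank U \<longleftrightarrow> (\<exists>B. finite B \<and> range U \<subseteq> span B)"

definition hamel :: "'b set" where
  "hamel = extend_basis {}"

definition coord :: "'b \<Rightarrow> 'b \<Rightarrow> 'a" where
  "coord v b = representation hamel v b"

text \<open>The diagonal sum in one fixed Hamel basis, meaningful for operators of finite rank. Its
  use rests on additivity, \<open>trace_commute\<close> and the value on operators of rank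
  one.\<close>

definition trace :: "('b \<Rightarrow> 'b) \<Rightarrow> 'a" where
  "trace U = (\<Sum>b | b \<in> hamel \<and> coord (U b) b \<noteq> 0. coord (U b) b)"

lemma hamel: "independent hamel" "span hamel = UNIV"
  unfolding hamel_def using independent_extend_basis[OF independent_empty] span_extend_basis[OF independent_empty] .

lemma coord_add: "coord (v + w) b = coord v b + coord w b"
  and coord_scale: "coord (scale c v) b = c * coord v b"
  and coord_diff: "coord (v - w) b = coord v b - coord w b"
  and coord_0: "coord 0 b = 0"
  using hamel by (simp_all add: coord_def representation_add representation_scale representation_diff representation_zero)

lemma coord_sum: "coord (\<Sum>i\<in>I. f i) b = (\<Sum>i\<in>I. coord (f i) b)"
  by (induction I rule: infinite_finite_induct) (auto simp: coord_add coord_0)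

lemma finite_coord: "finite {b. coord v b \<noteq> 0}"
  unfolding coord_def by (rule finite_representation)

lemma coord_nonzero: "coord v b \<noteq> 0 \<Longrightarrow> b \<in> hamel"
  unfolding coord_def by (rule representation_ne_zero)

lemma sum_coord:
  assumes "finite C" "{b. coord v b \<noteq> 0} \<subseteq> C"
  shows "(\<Sum>b\<in>C. scale (coord v b) b) = v"
proof -
  have "(\<Sum>b\<in>C. scale (coord v b) b) = (\<Sum>b | coord v b \<noteq> 0. scale (coord v b) b)"
    using assms by (intro sum.mono_neutral_right) auto
  then show ?thesis using hamel by (simp add: coord_def sum_nonzero_representation_eq)
qed

lemma finite_rank_support:
  assumes "finite_rank U"
  obtains C where "finite C" "C \<subseteq> hamel" "\<And>v. {b. coord (U v) b \<noteq> 0} \<subseteq> C"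
proof -
  obtain B where B: "finite B" "range U \<subseteq> span B" using assms by (auto simp: finite_rank_def)
  define C where "C = (\<Union>v\<in>B. {b. coord v b \<noteq> 0})"
  have "span B \<subseteq> {v. {b. coord v b \<noteq> 0} \<subseteq> C}"
  proof (rule span_minimal)
    show "B \<subseteq> {v. {b. coord v b \<noteq> 0} \<subseteq> C}" by (auto simp: C_def)
    have "coord (v + w) b \<noteq> 0 \<Longrightarrow> coord v b \<noteq> 0 \<or> coord w b \<noteq> 0" for v w b by (auto simp: coord_add)
    then show "subspace {v. {b. coord v b \<noteq> 0} \<subseteq> C}"
      unfolding subspace_def by (auto simp: coord_0 coord_scale) blast
  qed
  then have "\<And>v. {b. coord (U v) b \<noteq> 0} \<subseteq> C" using B by blast
  moreover have "finite C" "C \<subseteq> hamel" using B finite_coord coord_nonzero by (auto simp: C_def)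
  ultimately show ?thesis using that by blast
qed

lemma trace_eq_sum:
  assumes "finite C" "C \<subseteq> hamel" "\<And>b. b \<in> hamel \<Longrightarrow> coord (U b) b \<noteq> 0 \<Longrightarrow> b \<in> C"
  shows "trace U = (\<Sum>b\<in>C. coord (U b) b)"
  unfolding trace_def using assms by (intro sum.mono_neutral_left) auto

lemma finite_rank_add: "finite_rank U \<Longrightarrow> finite_rank V \<Longrightarrow> finite_rank (\<lambda>v. U v + V v)"
proof -
  assume "finite_rank U" "finite_rank V"
  then obtain B C where "finite B" "range U \<subseteq> span B" "finite C" "range V \<subseteq> span C" by (auto simp: finite_rank_def)
  then show ?thesis unfolding finite_rank_def
    using span_mono[of B "B \<union> C"] span_mono[of C "B \<union> C"]
    by (intro exI[of _ "B \<union> C"]) (auto intro!: span_add)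
qed

lemma finite_rank_diff: "finite_rank U \<Longrightarrow> finite_rank V \<Longrightarrow> finite_rank (\<lambda>v. U v - V v)"
proof -
  assume "finite_rank U" "finite_rank V"
  then obtain B C where "finite B" "range U \<subseteq> span B" "finite C" "range V \<subseteq> span C" by (auto simp: finite_rank_def)
  then show ?thesis unfolding finite_rank_def
    using span_mono[of B "B \<union> C"] span_mono[of C "B \<union> C"]
    by (intro exI[of _ "B \<union> C"]) (auto intro!: span_diff)
qed

lemma finite_rank_compose_right: "finite_rank U \<Longrightarrow> finite_rank (\<lambda>v. U (V v))"
  unfolding finite_rank_def by blast

lemma finite_rank_compose_left:
  assumes V: "lin V" and U: "finite_rank U"
  shows "finite_rank (\<lambda>v. V (U v))"
proof -
  obtain B where B: "finite B" "range U \<subseteq> span B" using U by (auto simp: finite_rank_def)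
  interpret vsp: vector_space_pair scale scale ..
  have "V ` span B = span (V ` B)" using vsp.linear_span_image[OF V] by simp
  then show ?thesis unfolding finite_rank_def using B by (intro exI[of _ "V ` B"]) auto
qed

lemma trace_add:
  assumes "finite_rank U" "finite_rank V"
  shows "trace (\<lambda>v. U v + V v) = trace U + trace V"
proof -
  obtain C where C: "finite C" "C \<subseteq> hamel" "\<And>v. {b. coord (U v) b \<noteq> 0} \<subseteq> C"
    using finite_rank_support[OF assms(1)] by blast
  obtain D where D: "finite D" "D \<subseteq> hamel" "\<And>v. {b. coord (V v) b \<noteq> 0} \<subseteq> D"
    using finite_rank_support[OF assms(2)] by blast
  have fin: "finite (C \<union> D)" "C \<union> D \<subseteq> hamel" using C D by auto
  have out: "coord (U v) b = 0 \<and> coord (V v) b = 0" if "b \<notin> C \<union> D" for v b using that C(3)[of v] D(3)[of v] by blast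
  have "trace U = (\<Sum>b\<in>C \<union> D. coord (U b) b)" by (rule trace_eq_sum[OF fin]) (use out in blast)
  moreover have "trace V = (\<Sum>b\<in>C \<union> D. coord (V b) b)" by (rule trace_eq_sum[OF fin]) (use out in blast)
  moreover have "trace (\<lambda>v. U v + V v) = (\<Sum>b\<in>C \<union> D. coord (U b + V b) b)"
    by (rule trace_eq_sum[OF fin]) (metis out coord_add add_0)
  ultimately show ?thesis by (simp add: coord_add sum.distrib)
qed

lemma trace_uminus: "trace (\<lambda>v. - U v) = - trace U"
proof -
  have "coord (- v) b = - coord v b" for v b using coord_diff[of 0 v b] by (simp add: coord_0)
  then show ?thesis by (simp add: trace_def sum_negf)
qed

text \<open>This evaluates the commutator that carries the residue: there \<open>l\<close> takes a
  value at the point and \<open>w\<close> is a fixed function.\<close>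

lemma trace_rank_one:
  assumes add: "\<And>v w. l (v + w) = l v + l w" and scale: "\<And>c v. l (scale c v) = c * l v"
  shows "trace (\<lambda>v. scale (l v) w) = l w"
proof -
  let ?C = "{b. coord w b \<noteq> 0}"
  have "trace (\<lambda>v. scale (l v) w) = (\<Sum>b\<in>?C. coord (scale (l b) w) b)"
    using finite_coord coord_nonzero by (intro trace_eq_sum) (auto simp: coord_scale)
  also have "\<dots> = (\<Sum>b\<in>?C. l (scale (coord w b) b))" by (simp add: coord_scale scale mult.commute)
  also have "\<dots> = l (\<Sum>b\<in>?C. scale (coord w b) b)"
  proof -
    have "l 0 = 0" using scale[of 0 0] by simp
    then have "(\<Sum>i\<in>I. l (f i)) = l (\<Sum>i\<in>I. f i)" for I :: "'b set" and f
      by (induction I rule: infinite_finite_induct) (auto simp: add)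
    then show ?thesis .
  qed
  also have "\<dots> = l w" by (subst sum_coord) (auto simp: finite_coord)
  finally show ?thesis .
qed

lemma coord_linear:
  assumes V: "lin V" and C: "finite C" "{b. coord w b \<noteq> 0} \<subseteq> C"
  shows "coord (V w) b = (\<Sum>c\<in>C. coord w c * coord (V c) b)"
proof -
  interpret vsp: vector_space_pair scale scale ..
  have "V w = (\<Sum>c\<in>C. scale (coord w c) (V c))"
    by (subst sum_coord[OF C, symmetric]) (simp add: vsp.linear_sum[OF V] vsp.linear_scale[OF V])
  then show ?thesis by (simp add: coord_sum coord_scale)
qed

text \<open>Only \<open>U\<close> has finite rank. Its coordinates live in a finite
  \<open>C\<close>, and those of \<open>V\<close> on \<open>C\<close> in a finite \<open>D\<close>,
  so both traces are the same finite double sum.\<close>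

lemma trace_commute:
  assumes U: "lin U" "finite_rank U" and V: "lin V"
  shows "trace (\<lambda>v. U (V v)) = trace (\<lambda>v. V (U v))"
proof -
  obtain C where C: "finite C" "C \<subseteq> hamel" "\<And>v. {b. coord (U v) b \<noteq> 0} \<subseteq> C"
    using finite_rank_support[OF U(2)] by blast
  define D where "D = (\<Union>b\<in>C. {c. coord (V b) c \<noteq> 0})"
  have D: "finite D" "D \<subseteq> hamel" using C finite_coord coord_nonzero by (auto simp: D_def)
  have "trace (\<lambda>v. U (V v)) = (\<Sum>b\<in>C. coord (U (V b)) b)"
    using C(3) by (intro trace_eq_sum C(1,2)) blast
  also have "\<dots> = (\<Sum>b\<in>C. \<Sum>c\<in>D. coord (V b) c * coord (U c) b)"
    by (intro sum.cong coord_linear[OF U(1)] D(1)) (auto simp: D_def)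
  also have "\<dots> = (\<Sum>c\<in>D. \<Sum>b\<in>C. coord (U c) b * coord (V b) c)"
    by (subst sum.swap) (simp add: mult.commute)
  also have "\<dots> = (\<Sum>c\<in>D. coord (V (U c)) c)"
    by (intro sum.cong refl coord_linear[OF V, symmetric] C)
  also have "\<dots> = trace (\<lambda>v. V (U v))"
  proof (rule trace_eq_sum[symmetric, OF D])
    fix c assume "coord (V (U c)) c \<noteq> 0"
    then have "(\<Sum>b\<in>C. coord (U c) b * coord (V b) c) \<noteq> 0" by (simp add: coord_linear[OF V C(1) C(3)])
    then obtain b where "b \<in> C" "coord (V b) c \<noteq> 0" by (metis (no_types, lifting) mult_zero_right sum.neutral)
    then show "c \<in> D" by (auto simp: D_def)
  qed
  finally show ?thesis .
qed

lemma trace_commutator_finite_rank: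
  assumes U: "lin U" "finite_rank U" and V: "lin V"
  shows "trace (\<lambda>v. U (V v) - V (U v)) = 0" "trace (\<lambda>v. V (U v) - U (V v)) = 0"
    "finite_rank (\<lambda>v. U (V v) - V (U v))" "finite_rank (\<lambda>v. V (U v) - U (V v))"
proof -
  have fin: "finite_rank (\<lambda>v. U (V v))" "finite_rank (\<lambda>v. V (U v))"
    using finite_rank_compose_right[OF U(2)] finite_rank_compose_left[OF V U(2)] .
  have neg: "finite_rank (\<lambda>v. - W v)" if "finite_rank W" for W :: "'b \<Rightarrow> 'b"
  proof -
    have "finite_rank (\<lambda>v. 0)" unfolding finite_rank_def by (intro exI[of _ "{}"]) auto
    from finite_rank_diff[OF this that] show ?thesis by simp
  qed
  show "finite_rank (\<lambda>v. U (V v) - V (U v))" "finite_rank (\<lambda>v. V (U v) - U (V v))"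
    using fin by (auto intro: finite_rank_diff)
  show "trace (\<lambda>v. U (V v) - V (U v)) = 0" "trace (\<lambda>v. V (U v) - U (V v)) = 0"
    using trace_add[OF fin(1) neg[OF fin(2)]] trace_add[OF fin(2) neg[OF fin(1)]] trace_commute[OF U V]
    by (simp_all add: trace_uminus)
qed

section \<open>Commensurable subspaces\<close>

text \<open>\<open>L\<close> embeds into the quotient by \<open>W\<close>, where its image is
  spanned by \<open>B\<close>. In place of a quotient space, a linear map \<open>g\<close> picks
  representatives in \<open>span B\<close>; it is injective on \<open>L\<close> since
  \<open>L \<inter> W\<close> is trivial.\<close>

lemma finite_dimensional_modulo:
  assumes L: "subspace L" and W: "subspace W" and LW: "L \<inter> W \<subseteq> {0}" and B: "finite B"
    and LB: "\<And>f. f \<in> L \<Longrightarrow> \<exists>b\<in>span B. f - b \<in> W"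
  shows "\<exists>X. finite X \<and> L \<subseteq> span X"
proof -
  interpret vsp: vector_space_pair scale scale ..
  obtain X where X: "X \<subseteq> L" "independent X" "L \<subseteq> span X" using maximal_independent_subset by blast
  have XL: "span X \<subseteq> L" using X L span_minimal by blast
  have "\<forall>x\<in>X. \<exists>b. b \<in> span B \<and> x - b \<in> W" using LB X(1) by blast
  from bchoice[OF this] obtain \<beta> where \<beta>: "\<And>x. x \<in> X \<Longrightarrow> \<beta> x \<in> span B \<and> x - \<beta> x \<in> W" by blast
  obtain g where g: "lin g" "\<forall>x\<in>X. g x = \<beta> x"
    using vsp.linear_independent_extend[OF X(2)] by blast
  have sub: "span X \<subseteq> {v. v - g v \<in> W}"
  proof (rule span_minimal)
    show "X \<subseteq> {v. v - g v \<in> W}" using \<beta> g by auto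
    have lin: "v + w - g (v + w) = (v - g v) + (w - g w)" "scale c v - g (scale c v) = scale c (v - g v)" for v w c
      by (simp_all add: scale_right_diff_distrib vsp.linear_add[OF g(1)] vsp.linear_scale[OF g(1)])
    show "subspace {v. v - g v \<in> W}"
      unfolding subspace_def mem_Collect_eq lin
      using W by (auto simp: vsp.linear_0[OF g(1)] intro: subspace_0 subspace_add subspace_scale)
  qed
  have "inj_on g (span X)"
    unfolding vsp.linear_inj_on_iff_eq_0[OF g(1) subspace_span]
  proof (intro ballI impI)
    fix v assume v: "v \<in> span X" "g v = 0"
    then have "v \<in> W" using sub by auto
    then show "v = 0" using v XL LW by auto
  qed
  then have ind: "independent (g ` X)" and inj: "inj_on g X"
    using vsp.linear_independent_injective_image[OF g(1) X(2)] span_superset inj_on_subset by blast+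
  have "g ` X \<subseteq> span B" using g \<beta> by auto
  then have "finite (g ` X)" using independent_span_bound[OF B ind] by blast
  then have "finite X" using inj finite_imageD by blast
  then show ?thesis using X by blast
qed

text \<open>A basis of the whole space is split into a basis of \<open>L\<close>, vectors of
  \<open>R\<close>, and finitely many vectors of \<open>B\<close>, with coordinate projections
  \<open>\<pi>\<close>, \<open>\<gamma>\<close>, \<open>\<mu>\<close>. Here
  \<open>\<pi> + \<mu>\<close> falls short of having kernel \<open>R\<close> only through
  \<open>L \<inter> R\<close>, which is finite-dimensional and can be corrected.\<close>

lemma commensurable_projections:
  assumes L: "subspace L" and R: "subspace R" and Z: "finite Z" "L \<inter> R \<subseteq> span Z"
    and B: "finite B" "\<And>f. \<exists>r\<in>R. \<exists>b\<in>span B. f - r - b \<in> L"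
  shows "\<exists>\<pi> \<sigma>. lin \<pi> \<and> lin \<sigma> \<and>
    range \<pi> \<subseteq> L \<and> (\<forall>v\<in>L. \<pi> v = v) \<and> (\<forall>v\<in>R. \<sigma> v = 0) \<and> (\<forall>v. v - \<sigma> v \<in> R) \<and>
    finite_rank (\<lambda>v. \<pi> v - \<sigma> v)"
proof -
  interpret vsp: vector_space_pair scale scale ..
  obtain BL where BL: "BL \<subseteq> L" "independent BL" "L \<subseteq> span BL" using maximal_independent_subset by blast
  obtain B1 where B1: "BL \<subseteq> B1" "B1 \<subseteq> BL \<union> R" "independent B1" "BL \<union> R \<subseteq> span B1"
    using maximal_independent_subset_extend[of BL "BL \<union> R"] BL by blast
  obtain B2 where B2: "B1 \<subseteq> B2" "B2 \<subseteq> B1 \<union> B" "independent B2" "B1 \<union> B \<subseteq> span B2"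
    using maximal_independent_subset_extend[of B1 "B1 \<union> B"] B1 by blast
  have sp1: "span B1 \<subseteq> span B2" and spB: "span B \<subseteq> span B2"
    using B2 span_minimal[OF _ subspace_span] by auto
  have spL: "L \<subseteq> span B1" using BL(3) B1(1) span_mono by blast
  have span2: "v \<in> span B2" for v
  proof -
    obtain r b where rb: "r \<in> R" "b \<in> span B" "v - r - b \<in> L" using B(2) by blast
    have "r + b + (v - r - b) \<in> span B2"
      using rb B1(4) sp1 spB spL by (intro span_add) auto
    then show ?thesis by simp
  qed
  obtain B0 where B0: "B0 \<subseteq> L \<inter> R" "independent B0" "L \<inter> R \<subseteq> span B0" using maximal_independent_subset by blast
  have "finite B0" using independent_span_bound[OF Z(1) B0(2)] B0(1) Z(2) by blast
  define part where "part A = vsp.construct B2 (\<lambda>b. if b \<in> A then b else 0)" for A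
  have part_lin: "lin (part A)" for A
    unfolding part_def by (rule vsp.linear_construct[OF B2(3)])
  have part_basis: "part A b = (if b \<in> A then b else 0)" if "b \<in> B2" for A b
    unfolding part_def by (rule vsp.construct_basis[OF B2(3) that])
  have part_range: "part A v \<in> span (A \<inter> B2)" for A v
  proof -
    have "part A v \<in> span ((\<lambda>b. if b \<in> A then b else 0) ` B2)"
      unfolding part_def by (rule vsp.construct_in_span[OF B2(3)])
    also have "\<dots> \<subseteq> span (insert 0 (A \<inter> B2))" by (intro span_mono) auto
    finally show ?thesis by simp
  qed
  have part_id: "part A v = v" if "A \<subseteq> B2" "v \<in> span A" for A v
    by (rule vsp.linear_eq_on[OF part_lin linear_ident that(2)]) (use that part_basis in auto)
  have part_zero: "part A v = 0" if "A' \<subseteq> B2" "A \<inter> A' = {}" "v \<in> span A'" for A A' v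
  proof (rule vsp.linear_eq_0_on_span[OF part_lin _ that(3)])
    fix b assume "b \<in> A'"
    then have "b \<in> B2" "b \<notin> A" using that by auto
    then show "part A b = 0" by (simp add: part_basis)
  qed
  \<comment> \<open>A linear map of the whole space into \<open>L \<inter> R\<close> that is the
    identity there.\<close>
  define \<kappa> where "\<kappa> = vsp.construct B0 (\<lambda>b. b)"
  have \<kappa>_lin: "lin \<kappa>" unfolding \<kappa>_def by (rule vsp.linear_construct[OF B0(2)])
  have \<kappa>_span: "\<kappa> v \<in> span B0" for v
    using vsp.construct_in_span[OF B0(2), of "\<lambda>b. b" v] unfolding \<kappa>_def by simp
  have \<kappa>_id: "\<kappa> v = v" if "v \<in> L \<inter> R" for v
    by (rule vsp.linear_eq_on[OF \<kappa>_lin linear_ident subsetD[OF B0(3) that]])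
      (simp add: \<kappa>_def vsp.construct_basis[OF B0(2)])
  define \<pi> where "\<pi> = part BL"
  define \<gamma> where "\<gamma> = part (B1 - BL)"
  define \<mu> where "\<mu> = part (B2 - B1)"
  have parts: "lin \<pi>" "lin \<gamma>" "lin \<mu>"
    unfolding \<pi>_def \<gamma>_def \<mu>_def by (rule part_lin)+
  have dec: "\<pi> v + \<gamma> v + \<mu> v = v" for v
  proof -
    have "lin (\<lambda>v. \<pi> v + \<gamma> v + \<mu> v)"
      by (intro vsp.linear_compose_add parts)
    then show ?thesis
      by (rule vsp.linear_eq_on[OF _ linear_ident span2])
        (use B1(1) B2(1) in \<open>auto simp: \<pi>_def \<gamma>_def \<mu>_def part_basis\<close>)
  qed
  have \<pi>L: "\<pi> v \<in> L" for v
    using part_range[of BL v] span_mono[of "BL \<inter> B2" BL] span_minimal[OF BL(1) L] unfolding \<pi>_def by blast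
  have \<gamma>R: "\<gamma> v \<in> R" for v
  proof -
    have "(B1 - BL) \<inter> B2 \<subseteq> R" using B1(2) by blast
    then show ?thesis using part_range[of "B1 - BL" v] span_minimal[OF _ R] unfolding \<gamma>_def by blast
  qed
  have \<mu>1: "\<mu> v = 0" if "v \<in> span B1" for v
    unfolding \<mu>_def by (rule part_zero[OF B2(1) _ that]) auto
  \<comment> \<open>On \<open>R\<close> the part \<open>\<mu>\<close> vanishes and
    \<open>\<pi> v = v - \<gamma> v\<close> lies in \<open>L \<inter> R\<close>, so the last term
    cancels it. The difference from \<open>\<pi>\<close> consists of \<open>\<mu>\<close> and
    \<open>\<kappa> \<circ> \<pi>\<close>, both of finite rank.\<close>
  define \<sigma> where "\<sigma> v = \<pi> v + \<mu> v - \<kappa> (\<pi> v)" for v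
  have "lin \<sigma>"
    using vsp.linear_compose_sub[OF vsp.linear_compose_add[OF parts(1,3)] Vector_Spaces.linear_compose[OF parts(1) \<kappa>_lin]]
    by (simp add: \<sigma>_def[abs_def] o_def)
  moreover have "\<forall>v\<in>L. \<pi> v = v"
    unfolding \<pi>_def using BL(3) B1(1) B2(1) by (auto intro!: part_id)
  moreover have "\<sigma> v = 0" if v: "v \<in> R" for v
  proof -
    have "\<mu> v = 0" using v B1(4) by (intro \<mu>1) auto
    moreover from this have "\<pi> v = v - \<gamma> v" using dec[of v] by (simp add: eq_diff_eq)
    then have "\<pi> v \<in> R" using subspace_diff[OF R v \<gamma>R] by simp
    then have "\<kappa> (\<pi> v) = \<pi> v" using \<pi>L by (intro \<kappa>_id) auto
    ultimately show ?thesis by (simp add: \<sigma>_def)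
  qed
  moreover have "v - \<sigma> v \<in> R" for v
  proof -
    have "\<kappa> (\<pi> v) \<in> R" using \<kappa>_span span_minimal[OF _ R, of B0] B0(1) by blast
    then have "\<gamma> v + \<kappa> (\<pi> v) \<in> R" using \<gamma>R R subspace_add by blast
    moreover have "v - \<sigma> v = \<gamma> v + \<kappa> (\<pi> v)"
      using dec[of v] by (simp add: \<sigma>_def algebra_simps)
    ultimately show ?thesis by simp
  qed
  moreover have "finite_rank (\<lambda>v. \<pi> v - \<sigma> v)"
  proof -
    have "finite_rank (\<lambda>v. \<kappa> (\<pi> v))" unfolding finite_rank_def using \<open>finite B0\<close> \<kappa>_span by blast
    moreover have "finite_rank \<mu>"
    proof -
      have "finite ((B2 - B1) \<inter> B2)" using B(1) B2(2) by (auto intro: finite_subset[of _ B])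
      then show ?thesis unfolding finite_rank_def \<mu>_def using part_range by blast
    qed
    ultimately show ?thesis using finite_rank_diff by (auto simp: \<sigma>_def)
  qed
  ultimately show ?thesis using parts(1) \<pi>L by (intro exI[of _ \<pi>] exI[of _ \<sigma>]) auto
qed

end

subsection \<open>Tate's cocycle\<close>

sublocale function_field \<subseteq> kv: operator_trace "\<lambda>c f. emb c * f"
  by (intro operator_trace.intro vector_space_constants)

context function_field
begin

abbreviation klinear :: "('f \<Rightarrow> 'f) \<Rightarrow> bool" where
  "klinear \<equiv> Vector_Spaces.linear (\<lambda>c f. emb c * f) (\<lambda>c f. emb c * f)"

lemma klinear_iff: "klinear U \<longleftrightarrow> (\<forall>v w. U (v + w) = U v + U w) \<and> (\<forall>c v. U (emb c * v) = emb c * U v)"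
  unfolding Vector_Spaces.linear_iff using vector_space_constants by auto

lemma klinearD:
  assumes "klinear U"
  shows "U (v + w) = U v + U w" "U (emb c * v) = emb c * U v" "U 0 = 0" "U (- v) = - U v" "U (v - w) = U v - U w"
proof -
  show a: "U (v + w) = U v + U w" and s: "U (emb c * v) = emb c * U v" for v w c
    using assms unfolding klinear_iff by blast+
  show "U 0 = 0" using s[of 0 0] by simp
  show m: "U (- v) = - U v" for v using s[of "- 1" v] by (simp add: emb_uminus emb_1)
  show "U (v - w) = U v - U w" using a[of v "- w"] m[of w] by simp
qed

lemma klinear_diff: "klinear U \<Longrightarrow> klinear V \<Longrightarrow> klinear (\<lambda>v. U v - V v)"
  unfolding klinear_iff by (simp add: right_diff_distrib)

lemma klinear_compose: "klinear U \<Longrightarrow> klinear V \<Longrightarrow> klinear (\<lambda>v. U (V v))"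
  unfolding klinear_iff by simp

text \<open>Tate's residue of \<open>f dg\<close>, where \<open>T f\<close> stands for
  multiplication by \<open>f\<close> compressed by a projection.\<close>

definition commutator_trace :: "('f \<Rightarrow> 'f \<Rightarrow> 'f) \<Rightarrow> 'f \<Rightarrow> 'f \<Rightarrow> 'k" where
  "commutator_trace T f g = kv.trace (\<lambda>v. T f (T g v) - T g (T f v))"

text \<open>Expanding with \<open>T = T' + e\<close> leaves the commutator of \<open>T'\<close> and
  two commutators having one factor of finite rank, which are traceless.\<close>

lemma commutator_trace_perturb:
  assumes T: "\<And>f. klinear (T f)" and T': "\<And>f. klinear (T' f)"
    and fin: "\<And>f. kv.finite_rank (\<lambda>v. T f v - T' f v)"
    and com: "kv.finite_rank (\<lambda>v. T' f (T' g v) - T' g (T' f v))"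
  shows "commutator_trace T f g = commutator_trace T' f g"
proof -
  define e where "e f = (\<lambda>v. T f v - T' f v)" for f
  have e: "klinear (e f)" "kv.finite_rank (e f)" for f
    unfolding e_def by (intro klinear_diff T T') (rule fin)
  note 1 = kv.trace_commutator_finite_rank[OF e[of f] T[of g]]
  note 2 = kv.trace_commutator_finite_rank[OF e[of g] T'[of f]]
  have "T f (T g v) - T g (T f v) = (e f (T g v) - T g (e f v)) + (T' f (e g v) - e g (T' f v))
      + (T' f (T' g v) - T' g (T' f v))" for v
    by (simp add: e_def klinearD[OF T] klinearD[OF T'])
  then show ?thesis
    unfolding commutator_trace_def
    by (simp add: kv.trace_add kv.finite_rank_add 1 2 com)
qed

context
  fixes T :: "'f \<Rightarrow> 'f \<Rightarrow> 'f"
  assumes T_linear: "\<And>f. klinear (T f)" and T_add: "\<And>f g v. T (f + g) v = T f v + T g v"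
    and T_mult: "\<And>f g. kv.finite_rank (\<lambda>v. T (f * g) v - T f (T g v))"
begin

lemma commutator_finite_rank: "kv.finite_rank (\<lambda>v. T f (T g v) - T g (T f v))"
  using kv.finite_rank_diff[OF T_mult[of g f] T_mult[of f g]] by (simp add: mult.commute)

lemma commutator_trace_antisym: "commutator_trace T g f = - commutator_trace T f g"
  unfolding commutator_trace_def kv.trace_uminus[symmetric] by simp

lemma commutator_trace_add_right:
  "commutator_trace T f (g + h) = commutator_trace T f g + commutator_trace T f h"
  unfolding commutator_trace_def kv.trace_add[OF commutator_finite_rank commutator_finite_rank, symmetric]
  by (simp add: T_add klinearD[OF T_linear] algebra_simps)

lemma commutator_trace_add_left:
  "commutator_trace T (f + h) g = commutator_trace T f g + commutator_trace T h g"
  using commutator_trace_add_right[of g f h] by (simp add: commutator_trace_antisym[of _ g])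

text \<open>Up to a traceless commutator of finite rank, \<open>T (g * h)\<close> may be replaced by
  the product of \<open>T g\<close> and \<open>T h\<close>. For operators the identity
  \<open>[F, GH] + [G, HF] + [H, FG] = 0\<close> holds exactly.\<close>

lemma commutator_trace_cyclic:
  "commutator_trace T f (g * h) + commutator_trace T g (h * f) + commutator_trace T h (f * g) = 0"
proof -
  have *: "kv.finite_rank (\<lambda>v. T f (T g (T h v)) - T g (T h (T f v)))
      \<and> commutator_trace T f (g * h) = kv.trace (\<lambda>v. T f (T g (T h v)) - T g (T h (T f v)))" for f g h
  proof -
    define e where "e = (\<lambda>v. T (g * h) v - T g (T h v))"
    have e: "klinear e" "kv.finite_rank e"
      unfolding e_def by (rule klinear_diff[OF T_linear klinear_compose[OF T_linear T_linear]]) (rule T_mult)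
    note 1 = kv.trace_commutator_finite_rank[OF e T_linear[of f]]
    have eq: "T f (T g (T h v)) - T g (T h (T f v))
        = (T f (T (g * h) v) - T (g * h) (T f v)) + (e (T f v) - T f (e v))" for v
      by (simp add: e_def klinearD[OF T_linear])
    show ?thesis
      unfolding commutator_trace_def eq
      by (simp add: kv.trace_add kv.finite_rank_add commutator_finite_rank 1)
  qed
  note fr = conjunct1[OF *]
  let ?c = "\<lambda>f g h v. T f (T g (T h v)) - T g (T h (T f v))"
  have "commutator_trace T f (g * h) + commutator_trace T g (h * f) + commutator_trace T h (f * g)
    = kv.trace (?c f g h) + kv.trace (?c g h f) + kv.trace (?c h f g)" using * by simp
  also have "\<dots> = kv.trace (\<lambda>v. ?c f g h v + ?c g h f v + ?c h f g v)"
    unfolding kv.trace_add[OF kv.finite_rank_add[OF fr[of f g h] fr[of g h f]] fr[of h f g]]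
      kv.trace_add[OF fr[of f g h] fr[of g h f]] ..
  also have "\<dots> = 0" by (simp add: kv.trace_def kv.coord_0)
  finally show ?thesis .
qed

text \<open>With the trace read as a function of \<open>f dg\<close>, this is the Leibniz rule
  \<open>f d(g h) = f g dh + f h dg\<close>.\<close>

lemma commutator_trace_mult_right:
  "commutator_trace T f (g * h) = commutator_trace T (f * g) h + commutator_trace T (f * h) g"
  using commutator_trace_cyclic[of f g h] commutator_trace_antisym[of h "f * g"] commutator_trace_antisym[of g "h * f"]
  by (simp add: mult.commute[of h f] diff_eq_eq)

lemma commutator_trace_power:
  "commutator_trace T f (a ^ n) = of_nat n * commutator_trace T (f * a ^ (n - 1)) a"
proof (induction n arbitrary: f)
  case 0
  have "commutator_trace T f 1 = commutator_trace T f 1 + commutator_trace T f 1"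
    using commutator_trace_mult_right[of f 1 1] by (simp only: mult_1_right)
  then have "commutator_trace T f 1 = 0" by (metis add_cancel_right_right)
  then show ?case by simp
next
  case (Suc n)
  have "commutator_trace T f (a * a ^ n) = commutator_trace T (f * a) (a ^ n) + commutator_trace T (f * a ^ n) a"
    by (rule commutator_trace_mult_right)
  then show ?case using Suc[of "f * a"] by (cases n) (auto simp: algebra_simps)
qed

text \<open>The Leibniz term with \<open>d(a^p) = p a^(p-1) da\<close> vanishes, so p-th powers pass
  through \<open>d\<close> like constants.\<close>

lemma commutator_trace_frob_mult: "commutator_trace T f (frob a * g) = commutator_trace T (f * frob a) g"
  unfolding commutator_trace_mult_right
  by (subst (2) frob_def, subst commutator_trace_power) (simp add: CHAR_function_field)

lemma commutator_trace_zero_left: "commutator_trace T 0 g = 0"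
  using commutator_trace_add_left[of 0 0 g] by (metis add_0 add_cancel_right_right)

lemma commutator_trace_zero_right: "commutator_trace T g 0 = 0"
  using commutator_trace_add_right[of g 0 0] by (metis add_0 add_cancel_right_right)

lemma commutator_trace_sum_left: "commutator_trace T (\<Sum>i\<in>I. f i) g = (\<Sum>i\<in>I. commutator_trace T (f i) g)"
  by (induction I rule: infinite_finite_induct) (auto simp: commutator_trace_add_left commutator_trace_zero_left)

lemma commutator_trace_sum_right: "commutator_trace T g (\<Sum>i\<in>I. f i) = (\<Sum>i\<in>I. commutator_trace T g (f i))"
  by (induction I rule: infinite_finite_induct) (auto simp: commutator_trace_add_right commutator_trace_zero_right)

lemma commutator_trace_of_nat: "commutator_trace T (of_nat n * f) g = of_nat n * commutator_trace T f g"
  by (induction n) (auto simp: commutator_trace_zero_left commutator_trace_add_left algebra_simps)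

text \<open>Expanding \<open>g\<close> in powers of \<open>t\<close> over the p-th powers turns
  \<open>f dg\<close> into \<open>f (dg/dt) dt\<close>.\<close>

lemma commutator_trace_param:
  assumes Q: "Q \<in> places emb" and t: "Q t = 1"
  shows "commutator_trace T f g = commutator_trace T (f * param_deriv t g) t"
proof -
  obtain a where a: "g = (\<Sum>i<CHAR('f). frob (a i) * t ^ i)" using frob_expansion_exists[OF Q t] by blast
  have "commutator_trace T f g = (\<Sum>i<CHAR('f). of_nat i * commutator_trace T (f * frob (a i) * t ^ (i - 1)) t)"
    unfolding a by (simp add: commutator_trace_sum_right commutator_trace_frob_mult commutator_trace_power)
  also have "\<dots> = commutator_trace T (\<Sum>i<CHAR('f). of_nat i * (f * frob (a i) * t ^ (i - 1))) t"
    by (simp add: commutator_trace_sum_left commutator_trace_of_nat)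
  also have "(\<Sum>i<CHAR('f). of_nat i * (f * frob (a i) * t ^ (i - 1))) = f * param_deriv t g"
    unfolding derivation_expansion[OF param_deriv_derivation[OF Q t] a] param_deriv_self[OF Q t]
    by (simp add: sum_distrib_left mult_ac)
  finally show ?thesis .
qed

end

subsection \<open>Commensurable lattices\<close>

abbreviation "lookup \<equiv> Poly_Mapping.lookup"

lemma constant_if_no_poles:
  assumes "\<And>Q. Q \<in> places emb \<Longrightarrow> f \<in> ball Q 0"
  shows "f \<in> range emb"
proof (rule ccontr)
  assume "f \<notin> range emb"
  then obtain P where "P \<in> places emb" "P f < 0" using exists_pole by blast
  then show False using assms[of P] place_0[of P] by (auto simp: ball_def)
qed

text \<open>The fractional ideals of the semilocal ring \<open>sball S 0\<close>; a common
  uniformizer of \<open>S\<close> generates \<open>sball S 1\<close>.\<close>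

definition sball :: "'f place set \<Rightarrow> int \<Rightarrow> 'f set" where
  "sball S n = {f. \<forall>Q\<in>S. f \<in> ball Q n}"

lemma sball_subspace:
  assumes "S \<subseteq> places emb" shows "kv.subspace (sball S n)"
  using assms unfolding kv.subspace_def sball_def by (auto intro: ball_add ball_scale)

lemma mult_span: "b \<in> kv.span B \<Longrightarrow> a * b \<in> kv.span ((*) a ` B)"
proof -
  interpret vsp: vector_space_pair "\<lambda>c f. emb c * f" "\<lambda>c f. emb c * f" ..
  have "klinear ((*) a)" by (simp add: klinear_iff distrib_left mult.left_commute)
  from vsp.linear_span_image[OF this, of B] show "b \<in> kv.span B \<Longrightarrow> a * b \<in> kv.span ((*) a ` B)" by blast
qed

context
  fixes S \<tau>
  assumes S: "finite S" "S \<subseteq> places emb" "S \<noteq> {}" and \<tau>: "\<forall>Q\<in>S. Q \<tau> = 1"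
begin

lemma sball_mult: "f \<in> sball S m \<Longrightarrow> g \<in> sball S n \<Longrightarrow> f * g \<in> sball S (m + n)"
  using S(2) by (auto simp: sball_def intro: ball_mult)

lemma sball_parameter_power: "\<tau> powi n \<in> sball S n"
proof -
  have "\<tau> powi n \<in> ball Q n" if "Q \<in> S" for Q
    using place_power_int[of Q \<tau> n] that S(2) bspec[OF \<tau> that] by (intro mem_ballI) auto
  then show ?thesis by (simp add: sball_def)
qed

lemma sball_parameter_nonzero: "\<tau> \<noteq> 0"
  using S \<tau> place_0 by fastforce

text \<open>Functions independent modulo \<open>\<tau>\<close> over the constants are independent over \<open>'k(\<tau>)\<close>.\<close>

lemma sball_quotient_finite: "\<exists>B. finite B \<and> (\<forall>f\<in>sball S 0. \<exists>b\<in>kv.span B. f - b \<in> sball S 1)"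
proof -
  obtain P where P: "P \<in> S" using S by blast
  have \<tau>k: "\<tau> \<notin> range emb"
    using place_nonzero_nonconstant[of P \<tau>] P S(2) bspec[OF \<tau> P] by auto
  obtain n where n: "\<And>(I :: 'f set) z. finite I \<Longrightarrow> n < card I \<Longrightarrow>
    \<exists>c. (\<exists>i\<in>I. coeff (c i) 0 \<noteq> 0) \<and> (\<Sum>i\<in>I. ev \<tau> (c i) * z i) = 0"
    using polynomial_dependence[OF \<tau>k] by blast
  define ind where "ind B \<longleftrightarrow> finite B \<and> B \<subseteq> sball S 0 \<and>
    (\<forall>c. (\<Sum>b\<in>B. emb (c b) * b) \<in> sball S 1 \<longrightarrow> (\<forall>b\<in>B. c b = 0))" for B
  have \<tau>0: "\<tau> \<in> sball S 1" "\<tau> \<in> sball S 0"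
    using sball_parameter_power[of 1] ball_mono[of \<tau> _ 1 0] by (auto simp: sball_def)
  have bound: "card B \<le> n" if B: "ind B" for B
  proof (rule ccontr)
    assume "\<not> card B \<le> n"
    then obtain c where c: "\<exists>b\<in>B. coeff (c b) 0 \<noteq> 0" "(\<Sum>b\<in>B. ev \<tau> (c b) * b) = 0"
      using n[of B "\<lambda>b. b"] B by (auto simp: ind_def)
    \<comment> \<open>Each coefficient is split into its constant term and \<open>\<tau>\<close>
      times the rest. The relation then puts a combination of \<open>B\<close> with constant
      coefficients, not all zero, into \<open>sball S 1\<close>.\<close>
    define q where "q b = poly_shift 1 (c b)" for b
    have cq: "c b = pCons (coeff (c b) 0) (q b)" for b
      by (intro poly_eqI) (auto simp: q_def coeff_poly_shift coeff_pCons split: nat.split)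
    have "ev \<tau> (c b) * b = emb (coeff (c b) 0) * b + \<tau> * (ev \<tau> (q b) * b)" for b
      by (subst cq) (simp add: ev_pCons algebra_simps)
    then have "(\<Sum>b\<in>B. emb (coeff (c b) 0) * b) + \<tau> * (\<Sum>b\<in>B. ev \<tau> (q b) * b) = 0"
      using c(2) by (simp add: sum.distrib sum_distrib_left)
    then have eq: "(\<Sum>b\<in>B. emb (coeff (c b) 0) * b) = - (\<tau> * (\<Sum>b\<in>B. ev \<tau> (q b) * b))"
      by (simp add: eq_neg_iff_add_eq_0)
    have "ev \<tau> (q b) \<in> sball S 0" for b
      using \<tau>0(2) S(2) by (auto simp: sball_def intro: ball_ev)
    then have "ev \<tau> (q b) * b \<in> sball S 0" if "b \<in> B" for b
      using sball_mult[of "ev \<tau> (q b)" 0 b 0] that B by (auto simp: ind_def)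
    then have "(\<Sum>b\<in>B. ev \<tau> (q b) * b) \<in> sball S 0"
      by (intro kv.subspace_sum[OF sball_subspace[OF S(2)]])
    from sball_mult[OF \<tau>0(1) this] have "- (\<tau> * (\<Sum>b\<in>B. ev \<tau> (q b) * b)) \<in> sball S 1"
      using kv.subspace_neg[OF sball_subspace[OF S(2)]] by simp
    then have "\<forall>b\<in>B. coeff (c b) 0 = 0"
      using B eq unfolding ind_def by metis
    then show False using c(1) by blast
  qed
  have ex: "\<exists>B. ind B \<and> card B = 0" by (intro exI[of _ "{}"]) (simp add: ind_def)
  define m where "m = (GREATEST m. \<exists>B. ind B \<and> card B = m)"
  have "\<exists>B. ind B \<and> card B = m"
    unfolding m_def by (rule GreatestI_nat[where P="\<lambda>m. \<exists>B. ind B \<and> card B = m", OF ex]) (use bound in auto)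
  then obtain B where B: "ind B" "card B = m" by blast
  have fB: "finite B" using B by (simp add: ind_def)
  have "\<exists>b\<in>kv.span B. f - b \<in> sball S 1" if f: "f \<in> sball S 0" for f
  proof (cases "f \<in> B")
    case True
    then show ?thesis using kv.span_base kv.subspace_0[OF sball_subspace[OF S(2)]] by (intro bexI[of _ f]) auto
  next
    case False
    have "\<not> ind (insert f B)"
    proof
      assume a: "ind (insert f B)"
      have "card (insert f B) \<le> m" unfolding m_def by (rule Greatest_le_nat[where b=n]) (use a bound in auto)
      then show False using B fB False by simp
    qed
    then obtain c where c: "(\<Sum>b\<in>insert f B. emb (c b) * b) \<in> sball S 1" "\<not> (\<forall>b\<in>insert f B. c b = 0)"
      using f B unfolding ind_def by auto
    have s: "emb (c f) * f + (\<Sum>b\<in>B. emb (c b) * b) \<in> sball S 1" using c(1) False fB by simp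
    have cf: "c f \<noteq> 0"
    proof
      assume "c f = 0"
      then show False using s c(2) B unfolding ind_def by auto
    qed
    let ?b = "\<Sum>b\<in>B. emb (- inverse (c f) * c b) * b"
    have "emb (inverse (c f)) * (emb (c f) * f + (\<Sum>b\<in>B. emb (c b) * b)) \<in> sball S 1"
      using kv.subspace_scale[OF sball_subspace[OF S(2)] s] .
    moreover have "emb (inverse (c f)) * (emb (c f) * f + (\<Sum>b\<in>B. emb (c b) * b)) = f - ?b"
      using cf by (simp add: distrib_left emb_inverse emb_mult emb_uminus sum_distrib_left sum_negf mult.assoc)
    moreover have "?b \<in> kv.span B" by (intro kv.span_sum kv.span_scale kv.span_base)
    ultimately show ?thesis by auto
  qed
  then show ?thesis using fB by blast
qed

text \<open>Multiplication by \<open>\<tau> powi m\<close> carries the finite quotient of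
  \<open>sball S 0\<close> by \<open>sball S 1\<close> to that of \<open>sball S m\<close> by
  \<open>sball S (m + 1)\<close>; these are accumulated step by step.\<close>

lemma sball_commensurable:
  assumes "n \<le> m"
  shows "\<exists>B. finite B \<and> (\<forall>f\<in>sball S n. \<exists>b\<in>kv.span B. f - b \<in> sball S m)"
  using assms
proof (induction m rule: int_ge_induct)
  case base
  show ?case by (intro exI[of _ "{}"]) simp
next
  case (step m)
  obtain B where B: "finite B" "\<forall>f\<in>sball S n. \<exists>b\<in>kv.span B. f - b \<in> sball S m" using step by blast
  obtain C where C: "finite C" "\<forall>f\<in>sball S 0. \<exists>b\<in>kv.span C. f - b \<in> sball S 1" using sball_quotient_finite by blast
  let ?D = "(*) (\<tau> powi m) ` C"
  have "\<exists>b\<in>kv.span (B \<union> ?D). f - b \<in> sball S (m + 1)" if f: "f \<in> sball S n" for f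
  proof -
    obtain b where b: "b \<in> kv.span B" "f - b \<in> sball S m" using B f by blast
    have "\<tau> powi (- m) * (f - b) \<in> sball S 0" using sball_mult[OF sball_parameter_power[of "- m"] b(2)] by simp
    then obtain c where c: "c \<in> kv.span C" "\<tau> powi (- m) * (f - b) - c \<in> sball S 1" using C by blast
    have "\<tau> powi m * (\<tau> powi (- m) * (f - b) - c) \<in> sball S (m + 1)"
      by (rule sball_mult[OF sball_parameter_power c(2)])
    moreover have "\<tau> powi m * (\<tau> powi (- m) * (f - b) - c) = f - (b + \<tau> powi m * c)"
      using sball_parameter_nonzero by (simp add: power_int_minus right_diff_distrib mult.assoc[symmetric])
    moreover have "b + \<tau> powi m * c \<in> kv.span (B \<union> ?D)"
      using b(1) mult_span[OF c(1), of "\<tau> powi m"] kv.span_mono[of B "B \<union> ?D"] kv.span_mono[of ?D "B \<union> ?D"]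
      by (intro kv.span_add) auto
    ultimately show ?thesis by auto
  qed
  then show ?case using B(1) C(1) by (intro exI[of _ "B \<union> ?D"]) auto
qed

end

subsection \<open>Riemann--Roch spaces\<close>

lemma mem_riemann_roch_space_iff:
  "f \<in> riemann_roch_space emb E \<longleftrightarrow> (\<forall>P\<in>places emb. f \<in> ball P (- lookup E P))"
proof -
  have "- a \<le> b \<longleftrightarrow> 0 \<le> b + a" for a b :: int by linarith
  then show ?thesis by (auto simp: riemann_roch_space_def ball_def)
qed

lemma riemann_roch_space_subspace: "kv.subspace (riemann_roch_space emb E)"
  unfolding kv.subspace_def Ball_def mem_riemann_roch_space_iff by (auto intro: ball_add ball_scale)

lemma riemann_roch_space_finite_dimensional:
  "\<exists>X. finite X \<and> riemann_roch_space emb E \<subseteq> kv.span X"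
proof -
  obtain P0 where P0: "P0 \<in> places emb" using exists_nonconstant exists_pole by blast
  \<comment> \<open>\<open>P0\<close> keeps \<open>S\<close> nonempty when \<open>E\<close> is zero.
    A function of the space that vanishes on all of \<open>S\<close> then has no pole and a zero at
    \<open>P0\<close>, hence is 0.\<close>
  define S where "S = insert P0 {Q \<in> places emb. lookup E Q \<noteq> 0}"
  have S: "finite S" "S \<subseteq> places emb" "S \<noteq> {}"
    using P0 finite_subset[of "{Q \<in> places emb. lookup E Q \<noteq> 0}" "Poly_Mapping.keys E"]
    by (auto simp: S_def in_keys_iff)
  obtain \<tau> where \<tau>: "\<forall>Q\<in>S. Q \<tau> = 1" using exists_common_uniformizer[OF S(1,2)] by blast
  define N where "N = (\<Sum>Q\<in>S. \<bar>lookup E Q\<bar>)"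
  have N: "lookup E Q \<le> N" if "Q \<in> S" for Q
    unfolding N_def using member_le_sum[OF that, of "\<lambda>Q. \<bar>lookup E Q\<bar>"] S by auto
  have "N \<ge> 0" unfolding N_def by (intro sum_nonneg) auto
  then obtain B where B: "finite B" "\<forall>f\<in>sball S (- N). \<exists>b\<in>kv.span B. f - b \<in> sball S 1"
    using sball_commensurable[OF S \<tau>, of "- N" 1] by auto
  have "riemann_roch_space emb E \<inter> sball S 1 \<subseteq> {0}"
  proof
    fix f assume f: "f \<in> riemann_roch_space emb E \<inter> sball S 1"
    have "f \<in> ball Q 0" if Q: "Q \<in> places emb" for Q
    proof (cases "Q \<in> S")
      case True
      then show ?thesis using f ball_mono[of f Q 1 0] by (auto simp: sball_def)
    next
      case False
      then have "lookup E Q = 0" using Q by (auto simp: S_def)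
      moreover have "f \<in> ball Q (- lookup E Q)" using f Q mem_riemann_roch_space_iff by blast
      ultimately show ?thesis by simp
    qed
    then obtain c where c: "f = emb c" using constant_if_no_poles by blast
    have "f \<in> ball P0 1" using f by (auto simp: sball_def S_def)
    then show "f \<in> {0}" using c place_emb[OF P0, of c] by (auto simp: ball_def)
  qed
  moreover have "riemann_roch_space emb E \<subseteq> sball S (- N)"
  proof
    fix f assume f: "f \<in> riemann_roch_space emb E"
    have "f \<in> ball Q (- N)" if "Q \<in> S" for Q
      using f mem_riemann_roch_space_iff[of f E] that N[OF that] S(2) ball_mono[of f Q "- lookup E Q" "- N"] by auto
    then show "f \<in> sball S (- N)" by (simp add: sball_def)
  qed
  then have "\<exists>b\<in>kv.span B. f - b \<in> sball S 1" if "f \<in> riemann_roch_space emb E" for f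
    using that B(2) by blast
  ultimately show ?thesis
    by (intro kv.finite_dimensional_modulo[OF riemann_roch_space_subspace sball_subspace[OF S(2)] _ B(1)])
qed

subsection \<open>Functions with prescribed principal parts\<close>

text \<open>\<open>u\<close> satisfies an equation of degree \<open>m\<close> over
  \<open>'k[x]\<close>, and its leading coefficient \<open>a\<close> makes \<open>a * u\<close>
  integral over \<open>'k[x]\<close>. At a point where \<open>x\<close> is regular, a pole of
  \<open>a * u\<close> would let the \<open>m\<close>-th power dominate the rest of the monic
  equation.\<close>

lemma integral_multiple:
  assumes x: "x \<notin> range emb"
  shows "\<exists>d. d \<noteq> 0 \<and> (\<forall>Q\<in>places emb. x \<in> ball Q 0 \<longrightarrow> ev x d * u \<in> ball Q 0)"
proof -
  obtain n where n: "\<And>(I :: nat set) z. finite I \<Longrightarrow> n < card I \<Longrightarrow>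
    \<exists>c. (\<exists>i\<in>I. coeff (c i) 0 \<noteq> 0) \<and> (\<Sum>i\<in>I. ev x (c i) * z i) = 0"
    using polynomial_dependence[OF x] by blast
  obtain c i0 where c: "i0 \<le> n" "coeff (c i0) 0 \<noteq> 0" "(\<Sum>i\<le>n. ev x (c i) * u ^ i) = 0"
    using n[of "{..n}" "\<lambda>i. u ^ i"] by auto
  have ci0: "c i0 \<noteq> 0" using c(2) by auto
  define m where "m = (GREATEST i. i \<le> n \<and> c i \<noteq> 0)"
  have m: "m \<le> n" "c m \<noteq> 0"
    using GreatestI_nat[of "\<lambda>i. i \<le> n \<and> c i \<noteq> 0" i0 n] c(1) ci0 unfolding m_def by auto
  have m_max: "c j = 0" if "j \<le> n" "j > m" for j
    using Greatest_le_nat[of "\<lambda>i. i \<le> n \<and> c i \<noteq> 0" j n] that unfolding m_def by fastforce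
  have "(\<Sum>i\<le>n. ev x (c i) * u ^ i) = (\<Sum>i\<le>m. ev x (c i) * u ^ i)"
    using m m_max by (intro sum.mono_neutral_right) auto
  then have rel: "ev x (c m) * u ^ m = - (\<Sum>i<m. ev x (c i) * u ^ i)"
    using c(3) by (simp add: lessThan_Suc_atMost[symmetric] eq_neg_iff_add_eq_0 add.commute)
  have m0: "m \<noteq> 0" using rel m(2) ev_eq_0_iff[OF x] by (intro notI) auto
  let ?a = "\<lambda>i. ev x (c i)"
  let ?w = "?a m * u"
  have "?w ^ m = ?a m ^ (m - 1) * (?a m * u ^ m)"
    using m0 by (cases m) (auto simp: power_mult_distrib mult_ac)
  also have "\<dots> = - (\<Sum>i<m. ?a i * ?a m ^ (m - 1 - i) * ?w ^ i)"
  proof -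
    have "?a m ^ (m - 1) * (?a i * u ^ i) = ?a i * ?a m ^ (m - 1 - i) * ?w ^ i" if "i < m" for i
    proof -
      have "?a m ^ (m - 1) = ?a m ^ (m - 1 - i) * ?a m ^ i" using that by (simp flip: power_add)
      then show ?thesis by (simp add: power_mult_distrib mult_ac)
    qed
    then have "(\<Sum>i<m. ?a m ^ (m - 1) * (?a i * u ^ i)) = (\<Sum>i<m. ?a i * ?a m ^ (m - 1 - i) * ?w ^ i)"
      by (intro sum.cong) auto
    then show ?thesis unfolding rel mult_minus_right sum_distrib_left by simp
  qed
  finally have wm: "?w ^ m = - (\<Sum>i<m. ?a i * ?a m ^ (m - 1 - i) * ?w ^ i)" .
  have "?w \<in> ball Q 0" if Q: "Q \<in> places emb" and xQ: "x \<in> ball Q 0" for Q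
  proof (rule ccontr)
    assume "?w \<notin> ball Q 0"
    then have w: "?w \<noteq> 0" "Q ?w < 0" by (auto simp: ball_def)
    have "?a i * ?a m ^ (m - 1 - i) * ?w ^ i \<in> ball Q (int (m - 1) * Q ?w)" if "i < m" for i
    proof -
      have "int (m - 1) * Q ?w \<le> int i * Q ?w" using that w by (intro mult_right_mono_neg) auto
      then have "?w ^ i \<in> ball Q (int (m - 1) * Q ?w)" by (intro mem_ballI) (simp add: place_power[OF Q])
      moreover have "?a i * ?a m ^ (m - 1 - i) \<in> ball Q 0"
        using ball_mult[OF Q ball_ev[OF Q xQ] ball_power[OF Q ball_ev[OF Q xQ]]] by simp
      ultimately show ?thesis using ball_mult[OF Q] by fastforce
    qed
    then have "?w ^ m \<in> ball Q (int (m - 1) * Q ?w)"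
      unfolding wm by (intro ball_uminus[OF Q] ball_sum[OF Q]) auto
    then have "int (m - 1) * Q ?w \<le> Q (?w ^ m)" by (rule mem_ballD) (use w in simp)
    then have "int (m - 1) * Q ?w \<le> int m * Q ?w" unfolding place_power[OF Q] .
    then show False using w m0 by (cases m) (auto simp: algebra_simps)
  qed
  then show ?thesis using m by blast
qed

text \<open>Over a generating set of functions integral outside \<open>S\<close>, each coefficient
  is a fraction \<open>p / q\<close> in \<open>x\<close>. Division with remainder puts the
  polynomial part into \<open>r\<close>, while the proper fraction has no pole where
  \<open>x\<close> has one; \<open>N\<close> bounds the poles of the generators on
  \<open>S\<close>.\<close>

lemma principal_parts:
  assumes x: "x \<notin> range emb" and S: "S = {Q \<in> places emb. Q x < 0}"
  shows "\<exists>N\<ge>0. \<forall>f. \<exists>r. (\<forall>Q\<in>places emb - S. r \<in> ball Q 0) \<and> f - r \<in> sball S (- N)"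
proof -
  have finS: "finite S" unfolding S by (rule finite_poles)
  have xS: "x \<in> ball Q 0" if "Q \<in> places emb - S" for Q using that S by (auto simp: ball_def)
  obtain U where U: "spans_over (rational_subfield emb x) U" using finite_over_rational_subfield[OF x] by blast
  have finU: "finite U" using U by (simp add: spans_over_def)
  have "\<forall>u. \<exists>d. d \<noteq> 0 \<and> (\<forall>Q\<in>places emb. x \<in> ball Q 0 \<longrightarrow> ev x d * u \<in> ball Q 0)"
    using integral_multiple[OF x] by blast
  from choice[OF this] obtain d where d: "\<And>u. d u \<noteq> 0"
    "\<And>u Q. Q \<in> places emb \<Longrightarrow> x \<in> ball Q 0 \<Longrightarrow> ev x (d u) * u \<in> ball Q 0" by blast
  let ?w = "\<lambda>u. ev x (d u) * u"
  define N where "N = (\<Sum>Q\<in>S. \<Sum>u\<in>U. \<bar>Q (?w u)\<bar>)"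
  have N0: "N \<ge> 0" unfolding N_def by (intro sum_nonneg) auto
  have N: "?w u \<in> ball Q (- N)" if "Q \<in> S" "u \<in> U" for Q u
  proof -
    have "\<bar>Q (?w u)\<bar> \<le> (\<Sum>u\<in>U. \<bar>Q (?w u)\<bar>)"
      using finU that by (intro member_le_sum[of u U "\<lambda>u. \<bar>Q (?w u)\<bar>"]) auto
    also have "\<dots> \<le> N" unfolding N_def
      using finS that by (intro member_le_sum[of Q S "\<lambda>Q. \<Sum>u\<in>U. \<bar>Q (?w u)\<bar>"]) (auto intro: sum_nonneg)
    finally show ?thesis by (intro mem_ballI) linarith
  qed
  have "\<exists>r. (\<forall>Q\<in>places emb - S. r \<in> ball Q 0) \<and> f - r \<in> sball S (- N)" for f
  proof -
    obtain c where c: "\<forall>u\<in>U. c u \<in> rational_subfield emb x" "f = (\<Sum>u\<in>U. c u * u)"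
      using U unfolding spans_over_def by blast
    have "\<forall>u\<in>U. \<exists>pq. snd pq \<noteq> 0 \<and> c u = ev x (fst pq) / ev x (snd pq)"
      using c(1) mem_rational_subfield_iff[OF x] by auto
    from bchoice[OF this] obtain pq where pq: "\<forall>u\<in>U. snd (pq u) \<noteq> 0 \<and> c u = ev x (fst (pq u)) / ev x (snd (pq u))" by blast
    define p where "p u = fst (pq u)" for u
    define q where "q u = snd (pq u) * d u" for u
    have q0: "q u \<noteq> 0" if "u \<in> U" for u using pq d that by (auto simp: q_def)
    have cu: "c u * u = ev x (p u) / ev x (q u) * ?w u" if "u \<in> U" for u
      using pq that d(1) ev_eq_0_iff[OF x] by (simp add: p_def q_def ev_mult)
    define r where "r = (\<Sum>u\<in>U. ev x (p u div q u) * ?w u)"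
    have "r \<in> ball Q 0" if Q: "Q \<in> places emb - S" for Q
      unfolding r_def
    proof (rule ball_sum)
      show pl: "Q \<in> places emb" using Q by blast
      show "ev x (p u div q u) * ?w u \<in> ball Q 0" for u
        using ball_mult[OF pl ball_ev[OF pl xS[OF Q]] d(2)[OF pl xS[OF Q]]] by simp
    qed
    moreover have "f - r \<in> sball S (- N)"
    proof -
      have "c u * u - ev x (p u div q u) * ?w u = ev x (p u mod q u) / ev x (q u) * ?w u" if "u \<in> U" for u
      proof -
        have "ev x (p u) = ev x (p u div q u) * ev x (q u) + ev x (p u mod q u)"
          by (simp flip: ev_mult ev_add)
        then have "ev x (p u) / ev x (q u) = ev x (p u div q u) + ev x (p u mod q u) / ev x (q u)"
          using q0[OF that] ev_eq_0_iff[OF x] by (simp add: add_divide_distrib)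
        then show ?thesis unfolding cu[OF that] by (simp add: distrib_right)
      qed
      then have fr: "f - r = (\<Sum>u\<in>U. ev x (p u mod q u) / ev x (q u) * ?w u)"
        unfolding c(2) r_def by (simp add: sum_subtractf[symmetric])
      have "f - r \<in> ball Q (- N)" if Q: "Q \<in> S" for Q
        unfolding fr
      proof (rule ball_sum)
        show pl: "Q \<in> places emb" using Q S by blast
        have xQ: "Q x < 0" using Q S by blast
        fix u assume u: "u \<in> U"
        have "ev x (p u mod q u) / ev x (q u) \<in> ball Q 0"
        proof (cases "p u mod q u = 0")
          case False
          have dg: "degree (p u mod q u) < degree (q u)" using degree_mod_less'[OF q0[OF u] False] .
          have "Q (ev x (p u mod q u) / ev x (q u)) = (int (degree (p u mod q u)) - int (degree (q u))) * Q x"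
            using False q0[OF u] ev_eq_0_iff[OF x] xQ
            by (simp add: place_divide[OF pl] place_ev_pole[OF pl] left_diff_distrib)
          moreover have "0 \<le> (int (degree (p u mod q u)) - int (degree (q u))) * Q x"
            using dg xQ by (intro mult_nonpos_nonpos) auto
          ultimately show ?thesis by (intro mem_ballI) simp
        qed simp
        from ball_mult[OF pl this N[OF Q u]] show "ev x (p u mod q u) / ev x (q u) * ?w u \<in> ball Q (- N)" by simp
      qed
      then show ?thesis by (simp add: sball_def)
    qed
    ultimately show ?thesis by blast
  qed
  then show ?thesis using N0 by blast
qed

subsection \<open>No differential has exactly one pole, that pole being simple\<close>

definition place_value :: "'f place \<Rightarrow> 'f \<Rightarrow> 'k" where
  "place_value P a = (SOME c. a - emb c \<in> ball P 1)"

lemma rational_placeD: "rational_place emb P \<Longrightarrow> P \<in> places emb"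
  by (simp add: rational_place_def)

lemma place_value:
  assumes P: "rational_place emb P" and a: "a \<in> ball P 0"
  shows "a - emb (place_value P a) \<in> ball P 1"
proof -
  have "\<exists>c. a = emb c \<or> 0 < P (a - emb c)"
    using a P place_0[OF rational_placeD[OF P]] by (auto simp: rational_place_def ball_def)
  then obtain c where "a = emb c \<or> 0 < P (a - emb c)" by blast
  then have "a - emb c \<in> ball P 1" by (auto simp: ball_def)
  then have "\<exists>c. a - emb c \<in> ball P 1" by blast
  then show ?thesis unfolding place_value_def by (rule someI_ex)
qed

lemma place_value_eqI:
  assumes P: "rational_place emb P" and a: "a - emb c \<in> ball P 1"
  shows "place_value P a = c"
proof -
  note pl = rational_placeD[OF P]
  have "a \<in> ball P 0"
    using ball_add[OF pl ball_mono[OF a, of 0] ball_emb[OF pl, of c]] by simp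
  from ball_diff[OF pl a place_value[OF P this]]
  have "emb (place_value P a - c) \<in> ball P 1" by (simp add: emb_diff)
  then show ?thesis using place_emb[OF pl, of "place_value P a - c"] by (auto simp: ball_def)
qed

lemma place_value_add:
  assumes P: "rational_place emb P" and "a \<in> ball P 0" "b \<in> ball P 0"
  shows "place_value P (a + b) = place_value P a + place_value P b"
  using ball_add[OF rational_placeD[OF P] place_value[OF P assms(2)] place_value[OF P assms(3)]]
  by (intro place_value_eqI[OF P]) (simp add: emb_add algebra_simps)

lemma place_value_scale:
  assumes P: "rational_place emb P" and "a \<in> ball P 0"
  shows "place_value P (emb c * a) = c * place_value P a"
  using ball_scale[OF rational_placeD[OF P] place_value[OF P assms(2)], of c]
  by (intro place_value_eqI[OF P]) (simp add: emb_mult algebra_simps)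

text \<open>Multiplication by \<open>g\<close> takes \<open>sball S 0\<close> into some
  \<open>sball S (- N)\<close>, which exceeds \<open>sball S 0\<close> by a finite-dimensional
  space, and the identity minus \<open>\<pi>\<close> sees only this excess. Hence compressed
  multiplications compose correctly up to finite rank.\<close>

lemma lattice_mult_finite_rank:
  assumes S: "finite S" "S \<subseteq> places emb" "S \<noteq> {}"
    and \<pi>: "klinear \<pi>" "range \<pi> \<subseteq> sball S 0" "\<forall>v\<in>sball S 0. \<pi> v = v"
  shows "kv.finite_rank (\<lambda>v. g * \<pi> v - \<pi> (g * \<pi> v))"
proof -
  obtain \<tau> where \<tau>: "\<forall>Q\<in>S. Q \<tau> = 1" using exists_common_uniformizer[OF S(1,2)] by blast
  define N where "N = (\<Sum>Q\<in>S. \<bar>Q g\<bar>)"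
  have "g \<in> ball Q (- N)" if "Q \<in> S" for Q
    using member_le_sum[OF that, of "\<lambda>Q. \<bar>Q g\<bar>"] S by (intro mem_ballI) (auto simp: N_def)
  then have g: "g \<in> sball S (- N)" by (simp add: sball_def)
  have "N \<ge> 0" unfolding N_def by (intro sum_nonneg) auto
  then obtain B where B: "finite B" "\<forall>f\<in>sball S (- N). \<exists>b\<in>kv.span B. f - b \<in> sball S 0"
    using sball_commensurable[OF S \<tau>, of "- N" 0] by auto
  have "g * \<pi> v - \<pi> (g * \<pi> v) \<in> kv.span (B \<union> \<pi> ` B)" for v
  proof -
    have "g * \<pi> v \<in> sball S (- N)"
      using sball_mult[OF S \<tau> g, of "\<pi> v" 0] \<pi>(2) by auto
    then obtain b where b: "b \<in> kv.span B" "g * \<pi> v - b \<in> sball S 0" using B(2) by blast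
    then have "\<pi> (g * \<pi> v) - \<pi> b = g * \<pi> v - b" using \<pi>(3) klinearD(5)[OF \<pi>(1)] by metis
    then have "g * \<pi> v - \<pi> (g * \<pi> v) = b - \<pi> b" by (simp add: algebra_simps)
    moreover have "b \<in> kv.span (B \<union> \<pi> ` B)" using b(1) kv.span_mono[of B "B \<union> \<pi> ` B"] by auto
    moreover have "\<pi> b \<in> kv.span (B \<union> \<pi> ` B)"
    proof -
      interpret vsp: vector_space_pair "\<lambda>c f. emb c * f" "\<lambda>c f. emb c * f" ..
      have "\<pi> b \<in> kv.span (\<pi> ` B)" using vsp.linear_span_image[OF \<pi>(1), of B] b(1) by blast
      then show ?thesis using kv.span_mono[of "\<pi> ` B" "B \<union> \<pi> ` B"] by auto
    qed
    ultimately show ?thesis using kv.span_diff by simp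
  qed
  then show ?thesis unfolding kv.finite_rank_def using B(1) by (intro exI[of _ "B \<union> \<pi> ` B"]) auto
qed

lemma klinear_mult_argument:
  assumes "klinear U" shows "klinear (\<lambda>v. U (f * v))"
proof -
  have "U (f * (emb c * v)) = emb c * U (f * v)" for c v
    using klinearD(2)[OF assms, of c "f * v"] by (simp add: mult.left_commute)
  then show ?thesis unfolding klinear_iff by (simp add: distrib_left klinearD[OF assms])
qed

text \<open>The hypothesis \<open>reg\<close> is regularity of \<open>h dt\<close> at
  \<open>Q\<close>: the product in it is the coefficient of \<open>h dt\<close> with respect to the
  chosen uniformizer.\<close>

lemma no_single_simple_pole_function:
  assumes P: "rational_place emb P" and t: "P t = 1" and h: "P h = - 1"
    and reg: "\<And>Q. Q \<in> places emb \<Longrightarrow> Q \<noteq> P \<Longrightarrow> h * param_deriv (uniformizer Q) t \<in> ball Q 0"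
  shows False
proof -
  note pl = rational_placeD[OF P]
  define S1 where "S1 = insert P ({Q \<in> places emb. Q h < 0} \<union> {Q \<in> places emb. Q t < 0})"
  have S1: "finite S1" "S1 \<subseteq> places emb" using pl finite_poles by (auto simp: S1_def)
  obtain \<tau>1 where \<tau>1: "\<And>Q. Q \<in> S1 \<Longrightarrow> Q \<tau>1 = 1" using exists_common_uniformizer[OF S1] by blast
  \<comment> \<open>\<open>S\<close> must be the complete pole set of one function, so
    \<open>S1\<close> is enlarged to all zeros of \<open>\<tau>1\<close>. At the new points
    \<open>\<tau>1\<close> may vanish to higher order, whence the second uniformizer
    \<open>\<tau>\<close>.\<close>
  define x where "x = inverse \<tau>1"
  define S where "S = {Q \<in> places emb. Q x < 0}"
  have S1S: "S1 \<subseteq> S"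
  proof
    fix Q assume "Q \<in> S1"
    then show "Q \<in> S" using \<tau>1[of Q] S1(2) place_inverse[of Q \<tau>1] by (auto simp: S_def x_def)
  qed
  then have PS: "P \<in> S" by (auto simp: S1_def)
  have S: "finite S" "S \<subseteq> places emb" "S \<noteq> {}" using finite_poles PS by (auto simp: S_def)
  have x: "x \<notin> range emb" using place_nonzero_nonconstant[OF pl, of x] PS by (auto simp: S_def)
  obtain \<tau> where \<tau>: "\<forall>Q\<in>S. Q \<tau> = 1" using exists_common_uniformizer[OF S(1,2)] by blast
  have P\<tau>: "P \<tau> = 1" using \<tau> PS by blast
  define L where "L = sball S 0"
  define R where "R = {f. \<forall>Q\<in>places emb - S. f \<in> ball Q 0}"
  have subL: "kv.subspace L" unfolding L_def by (rule sball_subspace[OF S(2)])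
  have subR: "kv.subspace R" unfolding kv.subspace_def R_def by (auto intro: ball_add ball_scale)
  have Rmult: "f * g \<in> R" if "f \<in> R" "g \<in> R" for f g
    using that ball_mult[of _ f 0 g 0] by (auto simp: R_def)
  have hR: "h \<in> R" and tR: "t \<in> R"
    using S1S by (auto simp: R_def S1_def ball_def not_less)
  have LR: "L \<inter> R \<subseteq> kv.span {1}"
  proof
    fix f assume f: "f \<in> L \<inter> R"
    have "f \<in> range emb" by (rule constant_if_no_poles) (use f in \<open>auto simp: L_def R_def sball_def\<close>)
    then obtain c where "f = emb c * 1" by auto
    then show "f \<in> kv.span {1}" using kv.span_scale[OF kv.span_base[of 1 "{1}"]] by blast
  qed
  obtain N where N: "N \<ge> 0" "\<And>f. \<exists>r. r \<in> R \<and> f - r \<in> sball S (- N)"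
    using principal_parts[OF x S_def] unfolding R_def by auto
  obtain B where B: "finite B" "\<forall>f\<in>sball S (- N). \<exists>b\<in>kv.span B. f - b \<in> L"
    using sball_commensurable[OF S \<tau>, of "- N" 0] N(1) by (auto simp: L_def)
  have "\<exists>r\<in>R. \<exists>b\<in>kv.span B. f - r - b \<in> L" for f using N(2)[of f] B(2) by blast
  from kv.commensurable_projections[OF subL subR _ LR B(1) this] obtain \<pi> \<sigma> where
    \<pi>: "klinear \<pi>" "range \<pi> \<subseteq> L" "\<forall>v\<in>L. \<pi> v = v" and \<sigma>: "klinear \<sigma>" "\<And>v. v \<in> R \<Longrightarrow> \<sigma> v = 0" "\<And>v. v - \<sigma> v \<in> R"
    and fr: "kv.finite_rank (\<lambda>v. \<pi> v - \<sigma> v)"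
    by auto
  have \<pi>\<pi>: "\<pi> (\<pi> v) = \<pi> v" for v using \<pi> by auto
  have \<sigma>\<sigma>: "\<sigma> (\<sigma> v) = \<sigma> v" for v using \<sigma>(2)[OF \<sigma>(3)[of v]] klinearD(5)[OF \<sigma>(1), of v "\<sigma> v"] by simp
  define T where "T = (\<lambda>f v. \<pi> (f * \<pi> v))"
  define T' where "T' = (\<lambda>f v. \<sigma> (f * \<sigma> v))"
  have T_lin: "klinear (T f)" and T'_lin: "klinear (T' f)" for f
    unfolding T_def T'_def
    using klinear_compose[OF klinear_mult_argument[OF \<pi>(1)] \<pi>(1)] klinear_compose[OF klinear_mult_argument[OF \<sigma>(1)] \<sigma>(1)] .
  have T_add: "T (f + g) v = T f v + T g v" for f g v
    by (simp add: T_def distrib_right klinearD[OF \<pi>(1)])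
  have T_mult: "kv.finite_rank (\<lambda>v. T (f * g) v - T f (T g v))" for f g
  proof -
    have "kv.finite_rank (\<lambda>v. \<pi> (f * (g * \<pi> v - \<pi> (g * \<pi> v))))"
      by (rule kv.finite_rank_compose_left[OF klinear_mult_argument[OF \<pi>(1)]])
        (rule lattice_mult_finite_rank[OF S \<pi>(1) \<pi>(2,3)[unfolded L_def]])
    then show ?thesis by (simp add: T_def \<pi>\<pi> right_diff_distrib klinearD[OF \<pi>(1)] mult.assoc)
  qed
  have TT': "kv.finite_rank (\<lambda>v. T f v - T' f v)" for f
  proof -
    have 1: "kv.finite_rank (\<lambda>v. \<pi> (f * \<pi> v) - \<sigma> (f * \<pi> v))" by (rule kv.finite_rank_compose_right[OF fr])
    have 2: "kv.finite_rank (\<lambda>v. \<sigma> (f * (\<pi> v - \<sigma> v)))" by (rule kv.finite_rank_compose_left[OF klinear_mult_argument[OF \<sigma>(1)] fr])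
    show ?thesis using kv.finite_rank_add[OF 1 2] by (simp add: T_def T'_def right_diff_distrib klinearD[OF \<sigma>(1)])
  qed
  \<comment> \<open>For \<open>R\<close> the composition rule holds exactly: the error
    \<open>g * \<sigma> v - \<sigma> (g * \<sigma> v)\<close> lies in \<open>R\<close>, stays there
    after multiplication by \<open>f\<close>, and is killed by \<open>\<sigma>\<close>.\<close>
  have T'_mult: "T' f (T' g v) = \<sigma> (f * g * \<sigma> v)" if "f \<in> R" "g \<in> R" for f g v
  proof -
    have "f * (g * \<sigma> v - \<sigma> (g * \<sigma> v)) \<in> R" using Rmult[OF that(1) \<sigma>(3)] .
    then have "\<sigma> (f * (g * \<sigma> v - \<sigma> (g * \<sigma> v))) = 0" by (rule \<sigma>(2))
    then show ?thesis by (simp add: T'_def \<sigma>\<sigma> right_diff_distrib klinearD[OF \<sigma>(1)] mult.assoc)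
  qed
  have T'_com: "(\<lambda>v. T' h (T' t v) - T' t (T' h v)) = (\<lambda>v. 0)"
    using T'_mult[OF hR tR] T'_mult[OF tR hR] by (simp add: mult.commute[of h t])
  have "kv.finite_rank (\<lambda>v. 0)" unfolding kv.finite_rank_def using kv.span_zero by (intro exI[of _ "{}"]) auto
  then have "commutator_trace T h t = commutator_trace T' h t"
    by (intro commutator_trace_perturb T_lin T'_lin TT') (simp only: T'_com)
  also have "\<dots> = 0" unfolding commutator_trace_def T'_com by (simp add: kv.trace_def kv.coord_0)
  finally have zero: "commutator_trace T h t = 0" .
  \<comment> \<open>The same differential in the form \<open>h' d\<tau>\<close>, with
    \<open>h'\<close> regular on \<open>S\<close> except for a simple pole at
    \<open>P\<close>.\<close>
  define h' where "h' = h * param_deriv \<tau> t"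
  have "commutator_trace T h t = commutator_trace T h' \<tau>"
    unfolding h'_def by (rule commutator_trace_param[OF T_lin T_add T_mult pl P\<tau>])
  with zero have zero': "commutator_trace T h' \<tau> = 0" by simp
  have h0: "h \<noteq> 0" using h place_0[OF pl] by auto
  have h'P: "h' \<noteq> 0" "P h' = - 1"
    using param_deriv_unit[OF pl P\<tau> t] h h0 by (auto simp: h'_def place_mult[OF pl])
  have h'Q: "h' \<in> ball Q 0" if Q: "Q \<in> S" "Q \<noteq> P" for Q
  proof -
    have Qpl: "Q \<in> places emb" using Q S by blast
    note u = uniformizer[OF Qpl]
    have "param_deriv \<tau> t = param_deriv \<tau> (uniformizer Q) * param_deriv (uniformizer Q) t"
      by (rule derivation_eq_param_deriv[OF Qpl u param_deriv_derivation[OF pl P\<tau>]])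
    then have "h' = h * param_deriv (uniformizer Q) t * param_deriv \<tau> (uniformizer Q)" by (simp add: h'_def)
    moreover have "param_deriv \<tau> (uniformizer Q) \<in> ball Q 0"
      using \<tau> Q(1) u by (intro param_deriv_ball[OF Qpl] mem_ballI) auto
    ultimately show ?thesis using ball_mult[OF Qpl reg[OF Qpl Q(2)]] by fastforce
  qed
  have \<tau>L: "\<tau> * v \<in> L" if "v \<in> L" for v
  proof -
    have "\<tau> * v \<in> ball Q 0" if "Q \<in> S" for Q
    proof (rule ball_mult_le[of Q \<tau> 1 v 0])
      show "Q \<in> places emb" "v \<in> ball Q 0" using that S(2) \<open>v \<in> L\<close> by (auto simp: L_def sball_def)
      show "\<tau> \<in> ball Q 1" using bspec[OF \<tau> that] by (intro mem_ballI) simp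
    qed simp
    then show ?thesis by (simp add: L_def sball_def)
  qed
  have h'\<tau>: "h' * v \<in> L" if v: "\<And>Q. Q \<in> S \<Longrightarrow> v \<in> ball Q 0" "v \<in> ball P 1" for v
  proof -
    have "h' * v \<in> ball Q 0" if "Q \<in> S" for Q
    proof (cases "Q = P")
      case True
      have "h' \<in> ball P (- 1)" using h'P by (intro mem_ballI) simp
      from ball_mult[OF pl this v(2)] show ?thesis using True by simp
    next
      case False
      then show ?thesis using ball_mult[of Q h' 0 v 0] h'Q[OF that] v(1)[OF that] that S(2) by auto
    qed
    then show ?thesis by (simp add: L_def sball_def)
  qed
  have Lv: "v \<in> ball Q 0" if "v \<in> L" "Q \<in> S" for v Q using that by (auto simp: L_def sball_def)
  define l where "l v = place_value P (\<pi> v)" for v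
  define w where "w = \<tau> * (h' - \<pi> h')"
  have \<pi>P: "\<pi> v \<in> ball P 0" for v using Lv[OF _ PS] \<pi>(2) by blast
  \<comment> \<open>\<open>h' * a\<close> fails to lie in \<open>L\<close> only through the value
    \<open>l v\<close> of \<open>a = \<pi> v\<close> at \<open>P\<close>: once this constant is
    subtracted from \<open>a\<close>, the simple pole is cancelled. So \<open>v\<close> enters the
    commutator only through \<open>l v\<close>.\<close>
  have op: "T h' (T \<tau> v) - T \<tau> (T h' v) = emb (l v) * w" for v
  proof -
    define a where "a = \<pi> v"
    have aL: "a \<in> L" using \<pi>(2) by (auto simp: a_def)
    have "h' * (\<tau> * a) \<in> L"
    proof (rule h'\<tau>)
      show "\<tau> * a \<in> ball Q 0" if "Q \<in> S" for Q using Lv[OF \<tau>L[OF aL] that] .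
      show "\<tau> * a \<in> ball P 1"
        using P\<tau> Lv[OF aL PS] by (intro ball_mult_le[OF pl, of \<tau> 1 a 0]) (auto intro: mem_ballI)
    qed
    then have 1: "T h' (T \<tau> v) = h' * (\<tau> * a)"
      using \<pi>(3) \<tau>L[OF aL] by (simp add: T_def a_def[symmetric])
    define a0 where "a0 = a - emb (l v)"
    have "h' * a0 \<in> L"
    proof (rule h'\<tau>)
      show "a0 \<in> ball Q 0" if "Q \<in> S" for Q
        using that S(2) Lv[OF aL that] by (auto simp: a0_def intro!: ball_diff ball_emb)
      show "a0 \<in> ball P 1" unfolding a0_def l_def a_def by (rule place_value[OF P \<pi>P])
    qed
    then have "\<pi> (h' * a0) = h' * a0" using \<pi>(3) by blast
    moreover have "h' * a = emb (l v) * h' + h' * a0" by (simp add: a0_def algebra_simps)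
    ultimately have \<pi>a: "\<pi> (h' * a) = emb (l v) * \<pi> h' + h' * a0" by (simp add: klinearD[OF \<pi>(1)])
    have 2: "T \<tau> (T h' v) = \<tau> * \<pi> (h' * a)"
      using \<pi>(2,3) \<tau>L[of "\<pi> (h' * a)"] by (auto simp: T_def a_def[symmetric] \<pi>\<pi>)
    show ?thesis unfolding 1 2 \<pi>a w_def a0_def by (simp add: algebra_simps)
  qed
  have "commutator_trace T h' \<tau> = kv.trace (\<lambda>v. emb (l v) * w)"
    unfolding commutator_trace_def op ..
  also have "\<dots> = l w"
    by (rule kv.trace_rank_one)
      (simp_all add: l_def klinearD[OF \<pi>(1)] place_value_add[OF P \<pi>P \<pi>P] place_value_scale[OF P \<pi>P])
  \<comment> \<open>Since \<open>\<tau> * \<pi> h'\<close> vanishes at \<open>P\<close>,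
    \<open>l w\<close> is the value of \<open>\<tau> * h'\<close> at \<open>P\<close>, that is, the
    residue. It cannot be 0, because \<open>\<tau> * h'\<close> has order 0 at
    \<open>P\<close>.\<close>
  finally have lw: "l w = 0" using zero' by simp
  have "\<tau> * h' \<in> L"
  proof -
    have "h' * \<tau> \<in> L" using \<tau> PS by (intro h'\<tau>) (auto simp: ball_def)
    then show ?thesis by (simp add: mult.commute)
  qed
  moreover have "\<tau> * \<pi> h' \<in> L" using \<pi>(2) by (intro \<tau>L) auto
  ultimately have wL: "w \<in> L" unfolding w_def right_diff_distrib by (rule kv.subspace_diff[OF subL])
  have "w - emb (l w) \<in> ball P 1"
    using place_value[OF P \<pi>P, of w] \<pi>(3) wL by (simp add: l_def)
  then have w1: "w \<in> ball P 1" using lw by simp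
  have "\<tau> * \<pi> h' \<in> ball P 1"
    using P\<tau> \<pi>P by (intro ball_mult_le[OF pl, of \<tau> 1 _ 0]) (auto intro: mem_ballI)
  from ball_add[OF pl w1 this] have "\<tau> * h' \<in> ball P 1" by (simp add: w_def algebra_simps)
  moreover have "\<tau> \<noteq> 0" using P\<tau> place_0[OF pl] by auto
  ultimately show False using h'P P\<tau> by (auto simp: ball_def place_mult[OF pl])
qed

subsection \<open>Orders of differentials\<close>

lemma dscale_differentials: "\<omega> \<in> differentials emb \<Longrightarrow> dscale f \<omega> \<in> differentials emb"
proof -
  interpret dv: vector_space dscale by (rule vector_space_dscale)
  show "\<omega> \<in> differentials emb \<Longrightarrow> dscale f \<omega> \<in> differentials emb"
    unfolding differentials_def by (rule dv.span_scale)
qed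

lemma ord_diff_dscale:
  assumes Q: "Q \<in> places emb" and w: "\<omega> \<in> differentials emb" "\<omega> \<noteq> 0" and f: "f \<noteq> 0"
  shows "ord_diff emb Q (dscale f \<omega>) = Q f + ord_diff emb Q \<omega>"
proof -
  let ?t = "uniformizer Q"
  note t = uniformizer[OF Q]
  obtain h where h: "\<omega> = dscale h (Defs.diff emb ?t)" using w(1) differentials_iff[OF Q t] by blast
  have h0: "h \<noteq> 0" using w(2) h by (auto simp: dscale_def fun_eq_iff)
  have fh: "dscale f \<omega> = dscale (f * h) (Defs.diff emb ?t)" by (simp add: h dscale_def mult.assoc)
  show ?thesis
    unfolding ord_diff_def fh unfolding h local_coeff_dscale_diff[OF Q Q t] param_deriv_self[OF Q t]
    using f h0 by (simp add: place_mult[OF Q])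
qed

lemma differentials_one_dimensional:
  assumes "\<omega> \<in> differentials emb" "\<omega> \<noteq> 0" "\<omega>' \<in> differentials emb" "\<omega>' \<noteq> 0"
  obtains z where "z \<noteq> 0" "\<omega> = dscale z \<omega>'"
proof -
  obtain P where P: "P \<in> places emb" using exists_nonconstant exists_pole by blast
  let ?t = "uniformizer P"
  note iff = differentials_iff[OF P uniformizer[OF P]]
  obtain h h' where h: "\<omega> = dscale h (Defs.diff emb ?t)" "\<omega>' = dscale h' (Defs.diff emb ?t)"
    using assms iff by blast
  have nz: "h \<noteq> 0" "h' \<noteq> 0" using assms h by (auto simp: dscale_def fun_eq_iff)
  have "\<omega> = dscale (h / h') \<omega>'" using nz by (simp add: h dscale_def)
  then show ?thesis using that[of "h / h'"] nz by simp
qed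

lemma no_single_simple_pole:
  assumes P: "rational_place emb P" and w: "\<omega> \<in> differentials emb" and ord: "ord_diff emb P \<omega> = - 1"
    and reg: "\<And>Q. Q \<in> places emb \<Longrightarrow> Q \<noteq> P \<Longrightarrow> 0 \<le> ord_diff emb Q \<omega>"
  shows False
proof -
  note pl = rational_placeD[OF P]
  let ?t = "uniformizer P"
  note t = uniformizer[OF pl]
  obtain h where h: "\<omega> = dscale h (Defs.diff emb ?t)" using w differentials_iff[OF pl t] by blast
  note lc = local_coeff_dscale_diff[OF _ pl t, of _ h, folded h]
  show False
  proof (rule no_single_simple_pole_function[OF P t])
    show "P h = - 1" using ord lc[OF pl] by (simp add: ord_diff_def param_deriv_self[OF pl t])
    show "h * param_deriv (uniformizer Q) ?t \<in> ball Q 0" if "Q \<in> places emb" "Q \<noteq> P" for Q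
      using reg[OF that] lc[OF that(1)] by (intro mem_ballI) (simp add: ord_diff_def)
  qed
qed

subsection \<open>Laurent expansions and residues\<close>

definition expands_to :: "'f place \<Rightarrow> 'f \<Rightarrow> 'f \<Rightarrow> 'k fls \<Rightarrow> bool" where
  "expands_to P t h \<phi> \<longleftrightarrow>
     (\<forall>n. h - (\<Sum>i=fls_subdegree \<phi>..n. emb (fls_nth \<phi> i) * t powi i) \<in> ball P (n + 1))"

lemma laurent_expansion_eq: "laurent_expansion emb P t h = (THE \<phi>. expands_to P t h \<phi>)"
proof -
  have "(h = s \<or> n < P (h - s)) \<longleftrightarrow> h - s \<in> ball P (n + 1)" for s n
    by (auto simp: ball_def)
  then show ?thesis by (simp add: laurent_expansion_def expands_to_def)
qed

lemma expands_to_unique: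
  assumes P: "P \<in> places emb" and t: "P t = 1" and ex: "expands_to P t h \<phi>" "expands_to P t h \<psi>"
  shows "\<phi> = \<psi>"
proof (rule ccontr)
  assume "\<phi> \<noteq> \<psi>"
  define d where "d = fls_subdegree (\<phi> - \<psi>)"
  have d: "fls_nth \<phi> d \<noteq> fls_nth \<psi> d" using \<open>\<phi> \<noteq> \<psi>\<close> nth_fls_subdegree_nonzero[of "\<phi> - \<psi>"] by (simp add: d_def)
  have below: "fls_nth \<phi> i = fls_nth \<psi> i" if "i < d" for i
    using fls_eq0_below_subdegree[of i "\<phi> - \<psi>"] that by (simp add: d_def)
  \<comment> \<open>A common lower bound of both summation ranges and of \<open>d\<close>; the added
    terms are zero.\<close>
  define m where "m = min d (min (fls_subdegree \<phi>) (fls_subdegree \<psi>))"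
  have sum_eq: "(\<Sum>i=fls_subdegree \<chi>..d. emb (fls_nth \<chi> i) * t powi i) = (\<Sum>i=m..d. emb (fls_nth \<chi> i) * t powi i)"
    if "m \<le> fls_subdegree \<chi>" for \<chi>
    using that by (intro sum.mono_neutral_left) auto
  have split: "(\<Sum>i=m..d. emb (fls_nth \<chi> i) * t powi i)
      = emb (fls_nth \<chi> d) * t powi d + (\<Sum>i\<in>{m..d} - {d}. emb (fls_nth \<chi> i) * t powi i)" for \<chi>
    by (rule sum.remove) (auto simp: m_def)
  have "(\<Sum>i\<in>{m..d} - {d}. emb (fls_nth \<phi> i) * t powi i) = (\<Sum>i\<in>{m..d} - {d}. emb (fls_nth \<psi> i) * t powi i)"
    using below by (intro sum.cong) auto
  moreover have "(h - (\<Sum>i=m..d. emb (fls_nth \<psi> i) * t powi i)) - (h - (\<Sum>i=m..d. emb (fls_nth \<phi> i) * t powi i)) \<in> ball P (d + 1)"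
  proof (rule ball_diff[OF P])
    have m: "m \<le> fls_subdegree \<phi>" "m \<le> fls_subdegree \<psi>" by (auto simp: m_def)
    show "h - (\<Sum>i=m..d. emb (fls_nth \<psi> i) * t powi i) \<in> ball P (d + 1)"
      using ex(2) unfolding expands_to_def sum_eq[OF m(2), symmetric] by blast
    show "h - (\<Sum>i=m..d. emb (fls_nth \<phi> i) * t powi i) \<in> ball P (d + 1)"
      using ex(1) unfolding expands_to_def sum_eq[OF m(1), symmetric] by blast
  qed
  ultimately have "emb (fls_nth \<phi> d - fls_nth \<psi> d) * t powi d \<in> ball P (d + 1)"
    unfolding split by (simp add: emb_diff algebra_simps)
  moreover have "t \<noteq> 0" using t place_0[OF P] by auto
  ultimately show False
    using d t by (auto simp: ball_def place_mult[OF P] place_emb[OF P] place_power_int[OF P])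
qed

text \<open>Digits are peeled off one at a time: \<open>r m\<close> is the remainder after
  \<open>m\<close> digits, divided by \<open>t powi (d + m)\<close>, and rationality of
  \<open>P\<close> puts the next digit \<open>c m\<close> into \<open>'k\<close>. The leading digit
  is nonzero because \<open>h * t powi (- d)\<close> is a unit.\<close>

lemma expands_to_exists:
  assumes P: "rational_place emb P" and t: "P t = 1" and h: "h \<noteq> 0"
  obtains \<phi> where "expands_to P t h \<phi>" "fls_nth \<phi> (P h) \<noteq> 0"
proof -
  note pl = rational_placeD[OF P]
  have t0: "t \<noteq> 0" using t place_0[OF pl] by auto
  define d where "d = P h"
  define r where "r = rec_nat (h * t powi (- d)) (\<lambda>_ s. (s - emb (place_value P s)) / t)"
  define c where "c m = place_value P (r m)" for m
  have r0: "r 0 = h * t powi (- d)" and rS: "r (Suc m) = (r m - emb (c m)) / t" for m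
    by (simp_all add: r_def c_def)
  have vr0: "P (r 0) = 0" "r 0 \<noteq> 0"
    using h t t0 by (simp_all add: r0 place_mult[OF pl] place_power_int[OF pl] d_def)
  have r_ball: "r m \<in> ball P 0" for m
  proof (induction m)
    case 0
    then show ?case using vr0 by (intro mem_ballI) simp
  next
    case (Suc m)
    have "inverse t \<in> ball P (- 1)" using t by (intro mem_ballI) (simp add: place_inverse[OF pl])
    from ball_mult[OF pl place_value[OF P Suc] this] show ?case by (simp add: rS c_def divide_inverse)
  qed
  have exp: "h = (\<Sum>i<m. emb (c i) * t powi (d + int i)) + t powi (d + int m) * r m" for m
  proof (induction m)
    case 0
    show ?case using t0 by (simp add: r0 power_int_minus)
  next
    case (Suc m)
    have "t powi (d + int m) * r m = emb (c m) * t powi (d + int m) + t powi (d + int (Suc m)) * r (Suc m)"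
      using t0 by (simp add: rS power_int_add field_simps)
    then show ?case using Suc by (simp add: add.assoc)
  qed
  define \<phi> where "\<phi> = fls_shift (- d) (fps_to_fls (Abs_fps c))"
  have nth: "fls_nth \<phi> i = (if i < d then 0 else c (nat (i - d)))" for i
    by (simp add: \<phi>_def)
  have c0: "c 0 \<noteq> 0"
  proof
    assume "c 0 = 0"
    then have "r 0 \<in> ball P 1" using place_value[OF P r_ball[of 0]] by (simp add: c_def)
    then show False using vr0 by (auto simp: ball_def)
  qed
  have sub: "fls_subdegree \<phi> = d" by (rule fls_subdegree_eqI) (auto simp: nth c0)
  have "h - (\<Sum>i=d..n. emb (fls_nth \<phi> i) * t powi i) \<in> ball P (n + 1)" for n
  proof (cases "n < d")
    case True
    then show ?thesis by (auto simp: ball_def d_def)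
  next
    case False
    define m where "m = nat (n - d + 1)"
    have "(\<Sum>i=d..n. emb (fls_nth \<phi> i) * t powi i) = (\<Sum>i<m. emb (c i) * t powi (d + int i))"
      using False by (intro sum.reindex_bij_witness[of _ "\<lambda>i. d + int i" "\<lambda>i. nat (i - d)"]) (auto simp: nth m_def)
    then have "h - (\<Sum>i=d..n. emb (fls_nth \<phi> i) * t powi i) = t powi (d + int m) * r m"
      using exp[of m] by (metis add_diff_cancel_left')
    also have "\<dots> \<in> ball P (n + 1)"
    proof (rule ball_mult_le[OF pl _ r_ball])
      show "t powi (d + int m) \<in> ball P (d + int m)" using t by (intro mem_ballI) (simp add: place_power_int[OF pl])
    qed (use False in \<open>simp add: m_def\<close>)
    finally show ?thesis .
  qed
  then have "expands_to P t h \<phi>" by (simp add: expands_to_def sub)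
  moreover have "fls_nth \<phi> (P h) \<noteq> 0" using c0 by (simp add: nth d_def)
  ultimately show ?thesis using that by blast
qed

text \<open>At a simple pole the residue is the leading coefficient of the expansion.\<close>

lemma residue_nonzero:
  assumes P: "rational_place emb P" and ord: "ord_diff emb P \<omega> = - 1"
  shows "residue emb P \<omega> \<noteq> 0"
proof -
  note pl = rational_placeD[OF P]
  let ?h = "local_coeff emb P \<omega>" and ?t = "uniformizer P"
  have h: "P ?h = - 1" using ord by (simp add: ord_diff_def)
  then have "?h \<noteq> 0" using place_0[OF pl] by auto
  then obtain \<phi> where \<phi>: "expands_to P ?t ?h \<phi>" "fls_nth \<phi> (P ?h) \<noteq> 0"
    using expands_to_exists[OF P uniformizer[OF pl]] by blast
  have "laurent_expansion emb P ?t ?h = \<phi>"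
    unfolding laurent_expansion_eq using \<phi>(1) expands_to_unique[OF pl uniformizer[OF pl] _ \<phi>(1)] by blast
  then show ?thesis using \<phi>(2) h by (simp add: residue_def)
qed

lemma residue_0:
  assumes P: "P \<in> places emb" shows "residue emb P 0 = 0"
proof -
  let ?t = "uniformizer P"
  have "(0 :: 'f differential) = dscale 0 (Defs.diff emb ?t)" by (simp add: dscale_def fun_eq_iff)
  then have "local_coeff emb P 0 = 0"
    using local_coeff_dscale_diff[OF P P uniformizer[OF P], of 0] by simp
  moreover have ex: "expands_to P ?t 0 0" by (simp add: expands_to_def)
  have "laurent_expansion emb P ?t 0 = 0"
    unfolding laurent_expansion_eq using ex expands_to_unique[OF P uniformizer[OF P] _ ex] by blast
  ultimately show ?thesis by (simp add: residue_def)
qed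

subsection \<open>Dimensions of Riemann--Roch spaces\<close>

lemma l_dim_basis:
  obtains X where "finite X" "X \<subseteq> riemann_roch_space emb E" "kv.independent X"
    "riemann_roch_space emb E \<subseteq> kv.span X" "card X = l_dim emb E"
proof -
  obtain Y where Y: "finite Y" "riemann_roch_space emb E \<subseteq> kv.span Y"
    using riemann_roch_space_finite_dimensional by blast
  obtain X where X: "X \<subseteq> riemann_roch_space emb E" "kv.independent X"
    "riemann_roch_space emb E \<subseteq> kv.span X" "card X = kv.dim (riemann_roch_space emb E)"
    using kv.basis_exists by blast
  have "finite X" using kv.independent_span_bound[OF Y(1) X(2)] X(1) Y(2) by blast
  then show ?thesis using that X by (simp add: l_dim_def)
qed

lemma l_dim_le_mult:
  assumes u: "u \<noteq> 0" and sub: "\<And>f. f \<in> riemann_roch_space emb E \<Longrightarrow> u * f \<in> riemann_roch_space emb E'"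
  shows "l_dim emb E \<le> l_dim emb E'"
proof -
  obtain X where X: "finite X" "X \<subseteq> riemann_roch_space emb E" "kv.independent X"
    "riemann_roch_space emb E \<subseteq> kv.span X" "card X = l_dim emb E" by (rule l_dim_basis)
  obtain Y where Y: "finite Y" "Y \<subseteq> riemann_roch_space emb E'" "kv.independent Y"
    "riemann_roch_space emb E' \<subseteq> kv.span Y" "card Y = l_dim emb E'" by (rule l_dim_basis)
  interpret vsp: vector_space_pair "\<lambda>c f. emb c * f" "\<lambda>c f. emb c * f" ..
  have lin: "klinear ((*) u)" by (simp add: klinear_iff distrib_left mult.left_commute)
  have inj: "inj_on ((*) u) A" for A using u by (auto simp: inj_on_def)
  have "kv.independent ((*) u ` X)" by (rule vsp.linear_independent_injective_image[OF lin X(3) inj])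
  moreover have "(*) u ` X \<subseteq> kv.span Y" using X(2) Y(4) sub by blast
  ultimately have "card ((*) u ` X) \<le> card Y" using kv.independent_span_bound[OF Y(1)] by blast
  then show ?thesis using X(5) Y(5) card_image[OF inj, of X] by simp
qed

text \<open>If the spaces differ, some \<open>f0\<close> in the larger one has order exactly
  \<open>- lookup E P\<close> at \<open>P\<close>. For any other \<open>f\<close> the quotient
  \<open>f / f0\<close> has a value in \<open>'k\<close> at the rational point, and subtracting that
  multiple of \<open>f0\<close> lands in the smaller space.\<close>

lemma l_dim_diff_frag_of:
  assumes P: "rational_place emb P"
  shows "l_dim emb (E - frag_of P) \<le> l_dim emb E" "l_dim emb E \<le> l_dim emb (E - frag_of P) + 1"
    "l_dim emb E \<noteq> l_dim emb (E - frag_of P) \<Longrightarrow>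
      \<exists>f\<in>riemann_roch_space emb E. f \<noteq> 0 \<and> P f = - lookup E P"
proof -
  note pl = rational_placeD[OF P]
  let ?L = "riemann_roch_space emb E" and ?L' = "riemann_roch_space emb (E - frag_of P)"
  have sub: "f \<in> ?L" if "f \<in> ?L'" for f
    using that ball_mono[of f P "1 - lookup E P" "- lookup E P"]
    by (auto simp: mem_riemann_roch_space_iff lookup_minus split: if_splits)
  have mem: "f \<in> ?L'" if "f \<in> ?L" "f \<in> ball P (1 - lookup E P)" for f
    using that by (auto simp: mem_riemann_roch_space_iff lookup_minus)
  show "l_dim emb (E - frag_of P) \<le> l_dim emb E"
    by (rule l_dim_le_mult[of 1]) (auto intro: sub)
  have "l_dim emb E \<le> l_dim emb (E - frag_of P) + 1 \<and> (l_dim emb E \<noteq> l_dim emb (E - frag_of P) \<longrightarrow>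
      (\<exists>f\<in>?L. f \<noteq> 0 \<and> P f = - lookup E P))"
  proof (cases "?L = ?L'")
    case True
    then show ?thesis by (simp add: l_dim_def)
  next
    case False
    then obtain f0 where f0: "f0 \<in> ?L" "f0 \<notin> ball P (1 - lookup E P)" using sub mem by blast
    have "f0 \<in> ball P (- lookup E P)" using f0(1) pl by (simp add: mem_riemann_roch_space_iff)
    then have Pf0: "f0 \<noteq> 0" "P f0 = - lookup E P" using f0(2) by (auto simp: ball_def)
    obtain X where X: "finite X" "X \<subseteq> ?L'" "kv.independent X" "?L' \<subseteq> kv.span X"
      "card X = l_dim emb (E - frag_of P)" by (rule l_dim_basis)
    have "f \<in> kv.span (insert f0 X)" if f: "f \<in> ?L" for f
    proof -
      have "f \<in> ball P (- lookup E P)" using f pl by (simp add: mem_riemann_roch_space_iff)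
      moreover have "inverse f0 \<in> ball P (lookup E P)"
        using Pf0 by (intro mem_ballI) (simp add: place_inverse[OF pl])
      ultimately have "f / f0 \<in> ball P 0" using ball_mult[OF pl] by (fastforce simp: divide_inverse)
      from place_value[OF P this] obtain c where "f / f0 - emb c \<in> ball P 1" by blast
      moreover have "f0 \<in> ball P (- lookup E P)" using Pf0 by (intro mem_ballI) simp
      ultimately have "(f / f0 - emb c) * f0 \<in> ball P (1 - lookup E P)"
        by (intro ball_mult_le[OF pl]) auto
      then have "f - emb c * f0 \<in> ball P (1 - lookup E P)" using Pf0(1) by (simp add: left_diff_distrib)
      moreover have "f - emb c * f0 \<in> ?L"
        using riemann_roch_space_subspace kv.subspace_diff kv.subspace_scale f f0(1) by blast
      ultimately have "f - emb c * f0 \<in> kv.span X" using mem X(4) by blast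
      then have "f - emb c * f0 \<in> kv.span (insert f0 X)" using kv.span_mono[of X "insert f0 X"] by blast
      moreover have "emb c * f0 \<in> kv.span (insert f0 X)" by (intro kv.span_scale kv.span_base) simp
      ultimately have "(f - emb c * f0) + emb c * f0 \<in> kv.span (insert f0 X)" by (rule kv.span_add)
      then show ?thesis by simp
    qed
    then have "l_dim emb E \<le> card (insert f0 X)"
      unfolding l_dim_def using X(1) by (intro kv.dim_le_card) auto
    also have "\<dots> \<le> l_dim emb (E - frag_of P) + 1" using X(1,5) by (simp add: card_insert_if)
    finally show ?thesis using f0 Pf0 by blast
  qed
  then show "l_dim emb E \<le> l_dim emb (E - frag_of P) + 1" "l_dim emb E \<noteq> l_dim emb (E - frag_of P) \<Longrightarrow>
      \<exists>f\<in>riemann_roch_space emb E. f \<noteq> 0 \<and> P f = - lookup E P" by blast+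
qed

definition points :: "'f place set \<Rightarrow> 'f divisor" where
  "points T = (\<Sum>P\<in>T. frag_of P)"

lemma lookup_points: "finite T \<Longrightarrow> lookup (points T) Q = (if Q \<in> T then 1 else 0)"
  unfolding points_def lookup_sum by simp

lemma points_insert: "finite T \<Longrightarrow> P \<notin> T \<Longrightarrow> points (insert P T) = frag_of P + points T"
  by (simp add: points_def)

text \<open>Removing the points of \<open>T\<close> one by one from \<open>A\<close> while adding them to \<open>B - T\<close>, the two
  dimensions cannot both change in one step: functions \<open>a\<close>, \<open>b\<close> witnessing the changes at \<open>P\<close> would
  make \<open>a b \<eta>\<close> a differential whose only pole is a simple one at \<open>P\<close>.\<close>

lemma l_dim_points_bound:
  assumes T: "finite T" "\<And>P. P \<in> T \<Longrightarrow> rational_place emb P"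
    and \<eta>: "\<eta> \<in> differentials emb" "\<eta> \<noteq> 0"
    and ord: "\<And>Q. Q \<in> places emb \<Longrightarrow>
      lookup (A + B - points T) Q \<le> ord_diff emb Q \<eta>"
    and ordT: "\<And>Q. Q \<in> T \<Longrightarrow> ord_diff emb Q \<eta> = lookup (A + B - points T) Q"
  shows "int (l_dim emb A) - int (l_dim emb (A - points T))
    + int (l_dim emb B) - int (l_dim emb (B - points T)) \<le> int (card T)"
proof -
  have "int (l_dim emb A) - int (l_dim emb (A - points T'))
    + int (l_dim emb (B - points (T - T'))) - int (l_dim emb (B - points T)) \<le> int (card T')"
    if "T' \<subseteq> T" for T'
    using finite_subset[OF that T(1)] that
  proof (induction T' rule: finite_induct)
    case empty
    then show ?case by (simp add: points_def)
  next
    case (insert P T')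
    then have P: "P \<in> T" "rational_place emb P" using T(2) by auto
    note pl = rational_placeD[OF P(2)]
    let ?T'' = "T - insert P T'"
    have fin: "finite T'" "finite ?T''" using insert T(1) by auto
    have 1: "A - points (insert P T') = A - points T' - frag_of P"
      unfolding points_insert[OF fin(1) insert.hyps(2)] by (simp add: algebra_simps)
    have TT': "T - T' = insert P ?T''" using insert by auto
    have "P \<notin> ?T''" by simp
    from points_insert[OF fin(2) this] have 2: "B - points (T - T') = B - points ?T'' - frag_of P"
      unfolding TT' by (simp only: diff_diff_eq add.commute)
    let ?A = "A - points T'" and ?B = "B - points ?T''"
    have "\<not> (l_dim emb ?A \<noteq> l_dim emb (?A - frag_of P) \<and> l_dim emb ?B \<noteq> l_dim emb (?B - frag_of P))"
    proof
      assume "l_dim emb ?A \<noteq> l_dim emb (?A - frag_of P) \<and> l_dim emb ?B \<noteq> l_dim emb (?B - frag_of P)"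
      then obtain a b where a: "a \<in> riemann_roch_space emb ?A" "a \<noteq> 0" "P a = - lookup ?A P"
        and b: "b \<in> riemann_roch_space emb ?B" "b \<noteq> 0" "P b = - lookup ?B P"
        using l_dim_diff_frag_of(3)[OF P(2)] by metis
      have o: "ord_diff emb Q (dscale (a * b) \<eta>) = Q a + Q b + ord_diff emb Q \<eta>" if "Q \<in> places emb" for Q
        using ord_diff_dscale[OF that \<eta>, of "a * b"] a b place_mult[OF that] by simp
      show False
      proof (rule no_single_simple_pole[OF P(2) dscale_differentials[OF \<eta>(1)]])
        \<comment> \<open>\<open>P\<close> belongs neither to \<open>T'\<close> nor to
          \<open>?T''\<close>, so the orders of \<open>a\<close> and \<open>b\<close> cancel
          \<open>A + B\<close> exactly, and \<open>points T\<close> contributes the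
          \<open>- 1\<close>.\<close>
        show "ord_diff emb P (dscale (a * b) \<eta>) = - 1"
          unfolding o[OF pl] a(3) b(3) ordT[OF P(1)] using insert P(1) fin T(1)
          by (simp add: lookup_minus lookup_add lookup_points)
        fix Q assume Q: "Q \<in> places emb" "Q \<noteq> P"
        have "a \<in> ball Q (- lookup ?A Q)" "b \<in> ball Q (- lookup ?B Q)"
          using a(1) b(1) Q(1) mem_riemann_roch_space_iff by blast+
        then have "- lookup ?A Q \<le> Q a" "- lookup ?B Q \<le> Q b"
          using a(2) b(2) mem_ballD by blast+
        moreover have "lookup (points T') Q + lookup (points ?T'') Q = lookup (points T) Q"
          using insert Q(2) fin T(1) by (auto simp: lookup_points)
        ultimately show "0 \<le> ord_diff emb Q (dscale (a * b) \<eta>)"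
          unfolding o[OF Q(1)] using ord[OF Q(1)] by (simp add: lookup_minus lookup_add)
      qed
    qed
    then have step: "int (l_dim emb ?A) - int (l_dim emb (?A - frag_of P))
        + int (l_dim emb ?B) - int (l_dim emb (?B - frag_of P)) \<le> 1"
      using l_dim_diff_frag_of(1,2)[OF P(2), of ?A] l_dim_diff_frag_of(1,2)[OF P(2), of ?B] by linarith
    have "int (l_dim emb A) - int (l_dim emb ?A)
        + int (l_dim emb (?B - frag_of P)) - int (l_dim emb (B - points T)) \<le> int (card T')"
      using insert.IH insert.prems 2 by simp
    then show ?case using step insert.hyps unfolding 1 by simp
  qed
  from this[of T] show ?thesis by (simp add: points_def)
qed

end

theorem theorem2p4:
  fixes emb :: "'k::{field,finite} \<Rightarrow> 'f::field"
    and ps :: "'f place list"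
    and K A B C D G Z :: "'f divisor"
    and g n :: nat
    and w :: "'k list"
  assumes "function_field emb" and "genus emb = g"
    and "canonical_divisor emb K"
    and "length ps = n" and "distinct ps" and "\<forall>P\<in>set ps. rational_place emb P"
    and "D = (\<Sum>P\<leftarrow>ps. frag_of P)"
    and "is_divisor emb G" and "Poly_Mapping.keys G \<inter> Poly_Mapping.keys D = {}"
    and "is_divisor emb A" and "is_divisor emb B" and "is_divisor emb C"
    and "is_divisor emb Z" and "effective Z"
    and "Poly_Mapping.keys Z \<inter> Poly_Mapping.keys D = {}"
    and "linearly_equivalent emb G (K + C)"
    and "linearly_equivalent emb G (A + B + Z)"
    and "w \<in> code_Omega emb ps G" and "w \<noteq> replicate n 0"
  shows "int (hamming_weight w) \<ge>
    int (l_dim emb A) - int (l_dim emb (A - C)) + int (l_dim emb B) - int (l_dim emb (B - C))"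
proof -
  interpret function_field emb by fact
  let ?l = "Poly_Mapping.lookup :: 'f divisor \<Rightarrow> 'f place \<Rightarrow> int"
  have "(\<Sum>P\<leftarrow>ps. frag_of P) = points (set ps)"
    unfolding points_def using assms(5) by (rule sum_list_distinct_conv_sum_set)
  then have D: "D = points (set ps)" using assms(7) by simp
  have lD: "?l D Q = (if Q \<in> set ps then 1 else 0)" for Q unfolding D by (simp add: lookup_points)
  have ps: "rational_place emb Q" "Q \<in> places emb" "?l G Q = 0" "?l Z Q = 0" if "Q \<in> set ps" for Q
  proof -
    have "Q \<in> Poly_Mapping.keys D" using lD[of Q] that by (simp add: in_keys_iff)
    then show "?l G Q = 0" "?l Z Q = 0" using assms(9,15) by (auto simp: in_keys_iff)
    show "rational_place emb Q" "Q \<in> places emb" using assms(6) that rational_placeD by auto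
  qed
  obtain \<omega> where \<omega>: "\<omega> \<in> differential_space emb (G - D)" "w = map (\<lambda>P. residue emb P \<omega>) ps"
    using assms(18) unfolding code_Omega_def assms(7) by blast
  have \<omega>0: "\<omega> \<noteq> 0"
  proof
    assume "\<omega> = 0"
    then have "w = map (\<lambda>P. 0) ps" unfolding \<omega>(2) using residue_0 ps(2) by (intro map_cong) auto
    then show False using assms(4,19) by (simp add: map_replicate_const)
  qed
  then have \<omega>d: "\<omega> \<in> differentials emb" and ord\<omega>: "\<And>Q. Q \<in> places emb \<Longrightarrow> ?l G Q - ?l D Q \<le> ord_diff emb Q \<omega>"
    using \<omega>(1) by (auto simp: differential_space_def lookup_minus)
  obtain \<omega>' where \<omega>': "\<omega>' \<in> differentials emb" "\<omega>' \<noteq> 0" "\<And>Q. Q \<in> places emb \<Longrightarrow> ?l K Q = ord_diff emb Q \<omega>'"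
    using assms(3) unfolding canonical_divisor_def by blast
  obtain z where z: "z \<noteq> 0" "\<omega> = dscale z \<omega>'"
    using differentials_one_dimensional[OF \<omega>d \<omega>0 \<omega>'(1,2)] by blast
  obtain f where f: "f \<noteq> 0" "\<And>Q. Q \<in> places emb \<Longrightarrow> ?l G Q = ?l K Q + ?l C Q + Q f"
    using assms(16) unfolding linearly_equivalent_def by (auto simp: lookup_add)
  obtain s where s: "s \<noteq> 0" "\<And>Q. Q \<in> places emb \<Longrightarrow> ?l G Q = ?l A Q + ?l B Q + ?l Z Q + Q s"
    using assms(17) unfolding linearly_equivalent_def by (auto simp: lookup_add)
  define T where "T = {Q \<in> set ps. ord_diff emb Q \<omega> = - 1}"
  have T: "finite T" "T \<subseteq> set ps" by (auto simp: T_def)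
  \<comment> \<open>At a point of \<open>ps\<close> outside \<open>T\<close> the order is at least
    \<open>- 1\<close> but not \<open>- 1\<close>, hence nonnegative, and \<open>G\<close> vanishes
    there; so \<open>D\<close> may be replaced by its part \<open>T\<close>.\<close>
  have ordT: "?l G Q - ?l (points T) Q \<le> ord_diff emb Q \<omega>" if Q: "Q \<in> places emb" for Q
    using ord\<omega>[OF Q] ps(3)[of Q] lookup_points[OF T(1), of Q] by (auto simp: lD T_def split: if_splits)
  have Zeff: "0 \<le> ?l Z Q" for Q using assms(14) by (simp add: effective_def)

  \<comment> \<open>\<open>z\<close> compares \<open>\<omega>\<close> with the differential defining
    \<open>K\<close>, and \<open>f\<close> compares \<open>G\<close> with \<open>K + C\<close>;
    after \<open>K\<close> cancels, \<open>z / f\<close> is the multiplier.\<close>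
  have C_le: "?l C Q \<le> ?l (points T) Q + Q (z / f)" if Q: "Q \<in> places emb" for Q
    using ordT[OF Q] f(2)[OF Q] \<omega>'(3)[OF Q] ord_diff_dscale[OF Q \<omega>'(1,2) z(1)] z f(1)
    by (simp add: place_divide[OF Q])
  have l_C: "l_dim emb (E - points T) \<le> l_dim emb (E - C)" for E
  proof (rule l_dim_le_mult[of "z / f"])
    show "z / f \<noteq> 0" using z f by simp
    fix v assume v: "v \<in> riemann_roch_space emb (E - points T)"
    have "z / f * v \<in> ball Q (- ?l (E - C) Q)" if Q: "Q \<in> places emb" for Q
    proof (rule ball_mult_le[OF Q])
      show "z / f \<in> ball Q (Q (z / f))" by (intro mem_ballI) simp
      show "v \<in> ball Q (- ?l (E - points T) Q)" using v Q mem_riemann_roch_space_iff by blast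
      show "- ?l (E - C) Q \<le> Q (z / f) + - ?l (E - points T) Q"
        using C_le[OF Q] by (simp add: lookup_minus)
    qed
    then show "z / f * v \<in> riemann_roch_space emb (E - C)" unfolding mem_riemann_roch_space_iff by blast
  qed

  \<comment> \<open>Dividing by \<open>s\<close> turns the equivalence of \<open>G\<close> and
    \<open>A + B + Z\<close> into an equality. The bound then follows from \<open>Z \<ge> 0\<close>,
    and equality on \<open>T\<close> from the vanishing of \<open>Z\<close> on
    \<open>D\<close>.\<close>
  let ?\<eta> = "dscale (inverse s) \<omega>"
  have ord\<eta>: "ord_diff emb Q ?\<eta> = ord_diff emb Q \<omega> - Q s" if "Q \<in> places emb" for Q
    using ord_diff_dscale[OF that \<omega>d \<omega>0, of "inverse s"] s(1) by (simp add: place_inverse[OF that])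
  have "int (l_dim emb A) - int (l_dim emb (A - points T))
    + int (l_dim emb B) - int (l_dim emb (B - points T)) \<le> int (card T)"
  proof (rule l_dim_points_bound[OF T(1)])
    show "rational_place emb P" if "P \<in> T" for P using that T ps by blast
    show "?\<eta> \<in> differentials emb" by (rule dscale_differentials[OF \<omega>d])
    show "?\<eta> \<noteq> 0"
      using \<omega>0 s(1) by (auto simp: dscale_def fun_eq_iff)
    show "?l (A + B - points T) Q \<le> ord_diff emb Q ?\<eta>" if "Q \<in> places emb" for Q
      unfolding ord\<eta>[OF that] using ordT[OF that] s(2)[OF that] Zeff[of Q] by (simp add: lookup_minus lookup_add)
    show "ord_diff emb Q ?\<eta> = ?l (A + B - points T) Q" if Q: "Q \<in> T" for Q
    proof -
      have Qp: "Q \<in> set ps" "ord_diff emb Q \<omega> = - 1" using Q by (auto simp: T_def)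
      show ?thesis
        unfolding ord\<eta>[OF ps(2)[OF Qp(1)]] Qp(2)
        using s(2)[OF ps(2)[OF Qp(1)]] ps(3,4)[OF Qp(1)] Q by (simp add: lookup_minus lookup_add lookup_points[OF T(1)])
    qed
  qed
  moreover have "card T \<le> hamming_weight w"
  proof -
    have "hamming_weight w = length (filter (\<lambda>P. residue emb P \<omega> \<noteq> 0) ps)"
      by (simp add: hamming_weight_def \<omega>(2) filter_map o_def)
    also have "\<dots> = card {P \<in> set ps. residue emb P \<omega> \<noteq> 0}"
      using distinct_card[OF distinct_filter[OF assms(5)]] by simp
    finally show ?thesis using residue_nonzero ps(1) by (auto simp: T_def intro!: card_mono)
  qed
  ultimately show ?thesis using l_C[of A] l_C[of B] by linarith
qed

end
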